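(* Let $\{\hat T,\hat P,\hat\Sigma\}$ be a reference finite element with $\hat T=[-1,1]^d$ such that, for an integer $l\ge0$, $\hat P\subset W^{l,\infty}(\hat T)$. Let $\{\mathcal{T}_h\}_{h\in(0,1]}$ be a locally quasiuniform family of affine partitions with constant $\sigma_0$, and let $0\le m\le l$ ($m$ an integer). Then: 1. For $1\le p,q\le\infty$ there exists a constant $C=C(l,m,p,q,d,\sigma_0,\hat T,\hat P)>0$ such that for all $h\in(0,1]$ and $T\in\mathcal{T}_h$ $$\|v\|_{l,p,T}\le C\,h_T^{\,m-l+d(\frac1p-\frac1q)}\,\|v\|_{m,q,T}\qquad\forall v\in P(T).$$ 2. For $1\le q\le p\le\infty$ and $\hat P=\mathbb{Q}_k(\hat T)$, $k\ge1$, there exists a constant $C=C(l,m,p,d,\sigma_0)>0$ (in particular independent of $k$, $q$ and $h_T$) such that for all $h\in(0,1]$ and $T\in\mathcal{T}_h$ $$\|v\|_{l,p,T}\le C\Big(\frac{h_T}{k^2}\Big)^{m-l}\Big(\frac{h_T}{2(q+1)k^2}\Big)^{d(\frac1p-\frac1q)}\|v\|_{m,q,T}\qquad\forall v\in P(T).$$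
   Context: $\Omega\subset\mathbb{R}^d$ is a bounded polyhedral Lipschitz domain. A partition $\mathcal{T}_h$ of $\Omega$ with maximal element diameter $h$ is affine if each closed element is $T=F_T(\hat T)$ with $F_T(\hat x)=J_T\hat x+b_T$, $J_T$ invertible. $h_T$ is the diameter of $T$, $\varrho_T$ the diameter of the largest ball contained in $T$; local quasiuniformity means $h_T/\varrho_T\le\sigma_0$ for all $h$ and all $T\in\mathcal{T}_h$. $\hat P$ is a finite-dimensional function space on $\hat T$, and $P(T)=\{\hat v\circ F_T^{-1}:\hat v\in\hat P\}$. $\mathbb{Q}_k(\hat T)$ is the span of the monomials $\hat x^\alpha$ with $\|\alpha\|_{\ell^\infty}\le k$. $\|v\|_{l,p,G}=\big(\sum_{|\alpha|\le l}\|\partial^\alpha v\|_{L^p(G)}^p\big)^{1/p}$ for $p<\infty$ and $\|v\|_{l,\infty,G}=\max_{|\alpha|\le l}\|\partial^\alpha v\|_{L^\infty(G)}$. Conventions: $1/\infty=0$, and the factor with exponent $d(1/p-1/q)$ is $1$ if $p=q$ (also for $p=q=\infty$). *)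

theory Defs
  imports
    "HOL-Analysis.Analysis"
    "HOL-Library.Function_Algebras"
    "HOL-Probability.Essential_Supremum"
begin

section \<open>Sobolev spaces and norms\<close>

text \<open>Exponents range over \<open>[1, \<infinity>]\<close> and have type \<^typ>\<open>ennreal\<close>. In this type
  \<open>inverse \<infinity> = 0\<close>, so \<open>recip\<close> follows the convention \<open>1/\<infinity> = 0\<close>.\<close>

definition recip :: "ennreal \<Rightarrow> real" where
  "recip p = enn2real (inverse p)"

definition Lp_space :: "ennreal \<Rightarrow> ('a::euclidean_space) set \<Rightarrow> ('a \<Rightarrow> real) set" where
  "Lp_space p U = {f \<in> borel_measurable (lebesgue_on U).
     if p = \<infinity> then \<exists>c. AE x in lebesgue_on U. \<bar>f x\<bar> \<le> c
     else integrable (lebesgue_on U) (\<lambda>x. \<bar>f x\<bar> powr enn2real p)}"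

text \<open>Only meaningful for \<open>f \<in> Lp_space p U\<close>.\<close>

definition Lp_norm :: "ennreal \<Rightarrow> ('a::euclidean_space) set \<Rightarrow> ('a \<Rightarrow> real) \<Rightarrow> real" where
  "Lp_norm p U f =
    (if p = \<infinity> then real_of_ereal (esssup (lebesgue_on U) (\<lambda>x. ereal \<bar>f x\<bar>))
     else (\<integral>x. \<bar>f x\<bar> powr enn2real p \<partial>lebesgue_on U) powr recip p)"

definition partial_deriv :: "'d \<Rightarrow> (real ^ 'd \<Rightarrow> real) \<Rightarrow> real ^ 'd::finite \<Rightarrow> real" where
  "partial_deriv i f x = frechet_derivative f (at x) (axis i 1)"

fun iter_partial :: "'d::finite list \<Rightarrow> (real ^ 'd \<Rightarrow> real) \<Rightarrow> real ^ 'd \<Rightarrow> real" where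
  "iter_partial [] f = f"
| "iter_partial (i # is) f = partial_deriv i (iter_partial is f)"

definition smooth :: "(real ^ 'd::finite \<Rightarrow> real) \<Rightarrow> bool" where
  "smooth f \<longleftrightarrow> (\<forall>is. iter_partial is f differentiable_on UNIV)"

definition test_functions :: "(real ^ 'd::finite) set \<Rightarrow> (real ^ 'd \<Rightarrow> real) set" where
  "test_functions U =
    {\<phi>. smooth \<phi> \<and> compact (closure {x. \<phi> x \<noteq> 0}) \<and> closure {x. \<phi> x \<noteq> 0} \<subseteq> U}"

text \<open>Multi-indices are functions \<open>\<alpha> :: 'd \<Rightarrow> nat\<close>.\<close>

definition mi_order :: "('d::finite \<Rightarrow> nat) \<Rightarrow> nat" where
  "mi_order \<alpha> = (\<Sum>i\<in>UNIV. \<alpha> i)"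

text \<open>\<open>w\<close> is the weak derivative \<open>\<partial>\<^sup>\<alpha> u\<close> on the open set \<open>U\<close>. The classical derivative
  \<open>\<partial>\<^sup>\<alpha> \<phi>\<close> of a test function is \<^term>\<open>iter_partial is \<phi>\<close> for every list \<open>is\<close> in which
  each coordinate \<open>i\<close> occurs exactly \<open>\<alpha> i\<close> times; by symmetry of the mixed partial derivatives
  of a smooth function all these lists give the same function.\<close>

definition weak_deriv ::
  "(real ^ 'd::finite) set \<Rightarrow> ('d \<Rightarrow> nat) \<Rightarrow> (real ^ 'd \<Rightarrow> real) \<Rightarrow> (real ^ 'd \<Rightarrow> real) \<Rightarrow> bool" where
  "weak_deriv U \<alpha> u w \<longleftrightarrow>
    (\<forall>K. compact K \<and> K \<subseteq> U \<longrightarrow> u absolutely_integrable_on K \<and> w absolutely_integrable_on K) \<and>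
    (\<forall>\<phi>\<in>test_functions U. \<forall>is. count_list is = \<alpha> \<longrightarrow>
       (\<integral>x. u x * iter_partial is \<phi> x \<partial>lebesgue_on U) =
       (-1) ^ mi_order \<alpha> * (\<integral>x. w x * \<phi> x \<partial>lebesgue_on U))"

definition Sobolev :: "nat \<Rightarrow> ennreal \<Rightarrow> (real ^ 'd::finite) set \<Rightarrow> (real ^ 'd \<Rightarrow> real) set" where
  "Sobolev l p U =
    {u \<in> Lp_space p U. \<forall>\<alpha>. mi_order \<alpha> \<le> l \<longrightarrow> (\<exists>w\<in>Lp_space p U. weak_deriv U \<alpha> u w)}"

text \<open>A weak derivative is unique up to a null set, so the choice of the representative does not
  affect the norm below.\<close>

definition wderiv ::
  "(real ^ 'd::finite) set \<Rightarrow> ('d \<Rightarrow> nat) \<Rightarrow> (real ^ 'd \<Rightarrow> real) \<Rightarrow> real ^ 'd \<Rightarrow> real" where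
  "wderiv U \<alpha> u = (SOME w. weak_deriv U \<alpha> u w)"

text \<open>Only meaningful for \<open>u \<in> Sobolev l p U\<close>.\<close>

definition Sobolev_norm ::
  "nat \<Rightarrow> ennreal \<Rightarrow> (real ^ 'd::finite) set \<Rightarrow> (real ^ 'd \<Rightarrow> real) \<Rightarrow> real" where
  "Sobolev_norm l p U u =
    (if p = \<infinity> then Max ((\<lambda>\<alpha>. Lp_norm p U (wderiv U \<alpha> u)) ` {\<alpha>. mi_order \<alpha> \<le> l})
     else (\<Sum>\<alpha> | mi_order \<alpha> \<le> l. Lp_norm p U (wderiv U \<alpha> u) powr enn2real p) powr recip p)"


section \<open>Finite elements on the reference cube\<close>

definition ref_cube :: "(real ^ 'd::finite) set" where
  "ref_cube = cbox (\<chi> i. -1) (\<chi> i. 1)"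

text \<open>A function on a set \<open>S\<close> is represented by its extension by zero to the whole space.\<close>

definition functions_on :: "'a set \<Rightarrow> ('a \<Rightarrow> real) set" where
  "functions_on S = {v. \<forall>x. x \<notin> S \<longrightarrow> v x = 0}"

interpretation fun_space: vector_space "\<lambda>(c::real) (f::'a \<Rightarrow> real) x. c * f x"
  by unfold_locales (auto simp: fun_eq_iff algebra_simps)

text \<open>The usual (Ciarlet) notion: a finite-dimensional space \<open>P\<close> of functions on the closed set
  \<open>S\<close> together with a finite \<open>P\<close>-unisolvent set of linear functionals, the degrees of freedom.\<close>

definition finite_element ::
  "(real ^ 'd::finite) set \<Rightarrow> (real ^ 'd \<Rightarrow> real) set \<Rightarrow> ((real ^ 'd \<Rightarrow> real) \<Rightarrow> real) set \<Rightarrow> bool" where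
  "finite_element S P dofs \<longleftrightarrow>
    closed S \<and> interior S \<noteq> {} \<and>
    P \<subseteq> functions_on S \<and>
    (\<exists>B. finite B \<and> P = fun_space.span B) \<and>
    finite dofs \<and>
    (\<forall>\<sigma>\<in>dofs. \<forall>u\<in>P. \<forall>v\<in>P. \<forall>c. \<sigma> (\<lambda>x. u x + v x) = \<sigma> u + \<sigma> v \<and> \<sigma> (\<lambda>x. c * u x) = c * \<sigma> u) \<and>
    (\<forall>a. \<exists>!v. v \<in> P \<and> (\<forall>\<sigma>\<in>dofs. \<sigma> v = a \<sigma>))"

definition Q_space :: "nat \<Rightarrow> (real ^ 'd::finite) set \<Rightarrow> (real ^ 'd \<Rightarrow> real) set" where
  "Q_space k S = fun_space.span
     {(\<lambda>x. indicat_real S x * (\<Prod>i\<in>UNIV. (x $ i) ^ \<alpha> i)) | \<alpha>. \<forall>i. \<alpha> i \<le> k}"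

definition affine_map :: "real ^ 'd ^ 'd \<Rightarrow> real ^ 'd \<Rightarrow> real ^ 'd \<Rightarrow> real ^ 'd::finite" where
  "affine_map J b x = J *v x + b"

definition local_space ::
  "real ^ 'd ^ 'd \<Rightarrow> real ^ 'd \<Rightarrow> (real ^ 'd \<Rightarrow> real) set \<Rightarrow> (real ^ 'd::finite \<Rightarrow> real) set" where
  "local_space J b P = {v \<circ> inv (affine_map J b) | v. v \<in> P}"


section \<open>Domains and partitions\<close>

text \<open>Near each boundary point, in suitable Cartesian coordinates, the domain lies on one side of
  the graph of a Lipschitz function. The unit vector \<open>\<nu>\<close> is the last coordinate direction and
  \<open>\<gamma>\<close> is a function on the hyperplane orthogonal to it.\<close>

definition lipschitz_boundary :: "('a::euclidean_space) set \<Rightarrow> bool" where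
  "lipschitz_boundary \<Omega> \<longleftrightarrow>
    (\<forall>z\<in>frontier \<Omega>. \<exists>r>0. \<exists>\<nu>. norm \<nu> = 1 \<and>
       (\<exists>L. \<exists>\<gamma> :: 'a \<Rightarrow> real. L-lipschitz_on {y. y \<bullet> \<nu> = 0} \<gamma> \<and>
          \<Omega> \<inter> ball z r = {y \<in> ball z r. \<gamma> (y - (y \<bullet> \<nu>) *\<^sub>R \<nu>) < y \<bullet> \<nu>}))"

definition polyhedral_lipschitz_domain :: "('a::euclidean_space) set \<Rightarrow> bool" where
  "polyhedral_lipschitz_domain \<Omega> \<longleftrightarrow>
    open \<Omega> \<and> connected \<Omega> \<and> \<Omega> \<noteq> {} \<and> bounded \<Omega> \<and>
    (\<exists>\<P>. finite \<P> \<and> (\<forall>S\<in>\<P>. polytope S) \<and> closure \<Omega> = \<Union>\<P>) \<and>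
    lipschitz_boundary \<Omega>"

text \<open>The maps \<open>F\<^sub>T = affine_map (J T) (b T)\<close> are part of the data, since \<open>T\<close> alone does not
  determine them.\<close>

definition affine_partition ::
  "(real ^ 'd::finite) set \<Rightarrow> real \<Rightarrow> (real ^ 'd) set set \<Rightarrow>
   ((real ^ 'd) set \<Rightarrow> real ^ 'd ^ 'd) \<Rightarrow> ((real ^ 'd) set \<Rightarrow> real ^ 'd) \<Rightarrow> bool" where
  "affine_partition \<Omega> h \<T> J b \<longleftrightarrow>
    finite \<T> \<and> \<Union>\<T> = closure \<Omega> \<and>
    pairwise (\<lambda>S T. interior S \<inter> interior T = {}) \<T> \<and>
    Max (diameter ` \<T>) = h \<and>
    (\<forall>T\<in>\<T>. invertible (J T) \<and> T = affine_map (J T) (b T) ` ref_cube)"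

definition inball_diameter :: "('a::euclidean_space) set \<Rightarrow> real" where
  "inball_diameter T = Sup {diameter (cball x r) | x r. 0 \<le> r \<and> cball x r \<subseteq> T}"

definition quasiuniform_affine_family ::
  "real \<Rightarrow> (real ^ 'd::finite) set \<Rightarrow> (real \<Rightarrow> (real ^ 'd) set set) \<Rightarrow>
   (real \<Rightarrow> (real ^ 'd) set \<Rightarrow> real ^ 'd ^ 'd) \<Rightarrow>
   (real \<Rightarrow> (real ^ 'd) set \<Rightarrow> real ^ 'd) \<Rightarrow> bool" where
  "quasiuniform_affine_family \<sigma>0 \<Omega> \<T> J b \<longleftrightarrow>
    polyhedral_lipschitz_domain \<Omega> \<and>
    (\<forall>h\<in>{0<..1}. affine_partition \<Omega> h (\<T> h) (J h) (b h) \<and>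
       (\<forall>T\<in>\<T> h. diameter T / inball_diameter T \<le> \<sigma>0))"

end

theory Submission
  imports Defs "HOL-Computational_Algebra.Polynomial"
begin

text \<open>All functions are pulled back to the reference cube, where only two facts are needed: a bound
  for one weak derivative within the space of derivatives of order \<open>j\<close>, and a comparison of the
  \<open>L\<^sup>p\<close> and \<open>L\<^sup>q\<close> norms there. The chain rule costs a factor of order \<open>1 / h\<^sub>T\<close> per derivative and
  the Jacobian, which is comparable to \<open>h\<^sub>T\<^sup>d\<close>, gives the exponent \<open>d(1/p - 1/q)\<close>.

  For a fixed space both facts are equivalence of seminorms in finite dimension. For \<open>Q\<^sub>k\<close> the
  derivative at the end of a segment is a combination of point values at Chebyshev extrema with
  total weight of order \<open>k\<^sup>2\<close>; since the points are translates of \<open>x\<close>, this bounds every \<open>L\<^sup>p\<close>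
  norm of the derivative. The sup norm is then controlled by the \<open>L\<^sup>q\<close> norm on a box of side of
  order \<open>1 / k\<^sup>2\<close> at a maximum point, and interpolation gives \<open>L\<^sup>p\<close>. The factor
  \<open>2(q + 1)\<close> in the statement only weakens the estimate.\<close>

section \<open>Affine changes of variables\<close>

text \<open>The functions in \<open>P\<close> only have weak derivatives, and \<open>wderiv\<close>
  picks an arbitrary representative of each. Hence the argument runs through the first-order
  relation \<open>weak_deriv U (count_list [i])\<close>: a higher derivative is a list of
  coordinates, processed one entry at a time. Since the norms are full Sobolev norms, orders below
  \<open>l\<close> have to be bounded too. Because \<open>diameter T \<le> 1\<close>, every further
  derivative costs a factor of at least 1, so the highest power dominates.

  All functions compared are essentially bounded on sets of finite measure and thus lie in every
  L^p. This is why the norm facts assume \<open>Lp_space \<infinity>\<close> even for finite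
  exponents.

  Uniformity in \<open>q\<close> has one source:
  \<open>\<bar>recip p - recip q\<bar> \<le> 1\<close>, so constants that depend on \<open>q\<close>
  are powers with exponent at most d of quantities free of \<open>q\<close>, and are replaced by the
  largest such power.\<close>

text \<open>The determinant formula of \<^theory>\<open>HOL-Analysis.Change_Of_Vars\<close> needs a well-ordered index type, which \<open>'d\<close> is not.
  Some scaling constant exists for any index type, since Lebesgue measure is the only
  translation-invariant measure up to a factor.\<close>

lemma translation_invariant_measure_lborel:
  fixes M :: "'a::euclidean_space measure"
  assumes M: "sets M = sets borel" "sigma_finite_measure M"
    and inv: "\<And>a. distr M borel (\<lambda>x. a + x) = M"
    and E: "E \<in> sets borel" and Q: "Q \<in> sets borel"
  shows "emeasure M E * emeasure lborel (uminus -` Q) = emeasure lborel E * emeasure M Q"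
proof -
  interpret M: sigma_finite_measure M by fact
  interpret pair_sigma_finite lborel M by unfold_locales
  interpret P2: pair_sigma_finite M lborel by unfold_locales
  have [measurable_cong]: "sets M = sets borel" by fact
  note [measurable] = E Q
  have "uminus \<in> borel_measurable (borel :: 'a measure)" by simp
  then have Q'[measurable]: "uminus -` Q \<in> sets borel"
    using measurable_sets[OF _ Q, of uminus borel] by simp
  have shift: "(\<integral>\<^sup>+y. g (a + y) \<partial>M) = (\<integral>\<^sup>+y. g y \<partial>M)"
    if [measurable]: "g \<in> borel_measurable borel" for g :: "'a \<Rightarrow> ennreal" and a
    by (subst (2) inv[of a, symmetric], subst nn_integral_distr) auto
  have shiftL: "(\<integral>\<^sup>+y. g (a + y) \<partial>lborel) = (\<integral>\<^sup>+y. g y \<partial>lborel)"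
    if [measurable]: "g \<in> borel_measurable borel" for g :: "'a \<Rightarrow> ennreal" and a
    by (subst (2) lborel_distr_plus[of a, symmetric], subst nn_integral_distr) auto
  \<comment> \<open>The double integral of \<open>1_E(x) 1_Q(y - x)\<close> is evaluated twice.
    Directly, invariance of \<open>M\<close> frees the inner integral from \<open>x\<close>.
    Alternatively the order is swapped, \<open>x\<close> is shifted by \<open>y\<close> using
    invariance of Lebesgue measure, and swapping back decouples \<open>E\<close> from
    \<open>Q\<close>.\<close>
  have "(\<integral>\<^sup>+x. (\<integral>\<^sup>+y. indicator E x * indicator Q (y - x) \<partial>M) \<partial>lborel)
      = (\<integral>\<^sup>+x. indicator E x * emeasure M Q \<partial>lborel)"
  proof (intro nn_integral_cong)
    fix x :: 'a
    have "(\<integral>\<^sup>+y. indicator E x * indicator Q (y - x) \<partial>M)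
        = indicator E x * (\<integral>\<^sup>+y. indicator Q (- x + y) \<partial>M)"
      by (simp add: nn_integral_cmult)
    also have "(\<integral>\<^sup>+y. indicator Q (- x + y) \<partial>M) = (\<integral>\<^sup>+y. indicator Q y \<partial>M)"
      by (rule shift) measurable
    finally show "(\<integral>\<^sup>+y. indicator E x * indicator Q (y - x) \<partial>M) = indicator E x * emeasure M Q"
      by simp
  qed
  also have "\<dots> = emeasure lborel E * emeasure M Q"
    by (simp add: nn_integral_multc)
  finally have 1: "(\<integral>\<^sup>+x. (\<integral>\<^sup>+y. indicator E x * indicator Q (y - x) \<partial>M) \<partial>lborel)
    = emeasure lborel E * emeasure M Q" .
  have "(\<integral>\<^sup>+x. (\<integral>\<^sup>+y. indicator E x * indicator Q (y - x) \<partial>M) \<partial>lborel)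
      = (\<integral>\<^sup>+y. (\<integral>\<^sup>+x. indicator E x * indicator Q (y - x) \<partial>lborel) \<partial>M)"
    by (rule Fubini'[symmetric]) measurable
  also have "\<dots> = (\<integral>\<^sup>+y. (\<integral>\<^sup>+x. indicator E (y + x) * indicator (uminus -` Q) x \<partial>lborel) \<partial>M)"
  proof (rule nn_integral_cong)
    fix y :: 'a
    have "(\<integral>\<^sup>+x. indicator E (y + x) * indicator Q (y - (y + x)) \<partial>lborel)
      = (\<integral>\<^sup>+x. indicator E x * indicator Q (y - x) \<partial>lborel)"
      by (rule shiftL[where g="\<lambda>x. indicator E x * indicator Q (y - x)"]) measurable
    then show "(\<integral>\<^sup>+x. indicator E x * indicator Q (y - x) \<partial>lborel)
      = (\<integral>\<^sup>+x. indicator E (y + x) * indicator (uminus -` Q) x \<partial>lborel)"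
      by (simp add: indicator_def)
  qed
  also have "\<dots> = (\<integral>\<^sup>+x. (\<integral>\<^sup>+y. indicator E (y + x) * indicator (uminus -` Q) x \<partial>M) \<partial>lborel)"
    by (rule Fubini') measurable
  also have "\<dots> = (\<integral>\<^sup>+x. emeasure M E * indicator (uminus -` Q) x \<partial>lborel)"
  proof (intro nn_integral_cong)
    fix x :: 'a
    have "(\<integral>\<^sup>+y. indicator E (y + x) * indicator (uminus -` Q) x \<partial>M)
       = (\<integral>\<^sup>+y. indicator E (x + y) \<partial>M) * indicator (uminus -` Q) x"
      by (subst nn_integral_multc) (auto simp: add.commute)
    also have "(\<integral>\<^sup>+y. indicator E (x + y) \<partial>M) = (\<integral>\<^sup>+y. indicator E y \<partial>M)"
      by (rule shift) measurable
    finally show "(\<integral>\<^sup>+y. indicator E (y + x) * indicator (uminus -` Q) x \<partial>M)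
       = emeasure M E * indicator (uminus -` Q) x" by simp
  qed
  also have "\<dots> = emeasure M E * emeasure lborel (uminus -` Q)"
    by (subst nn_integral_cmult) auto
  finally show ?thesis using 1 by simp
qed

text \<open>The image of Lebesgue measure under \<open>F\<close> is again translation invariant,
  because translation by \<open>a\<close> after \<open>F\<close> is \<open>F\<close> after
  translation by \<open>inv L a\<close>. Its ratio to Lebesgue measure is read off on the unit
  ball.\<close>

lemma lborel_affine_bij:
  fixes L :: "'a::euclidean_space \<Rightarrow> 'a"
  assumes L: "linear L" "bij L"
  obtains c where "c > 0" "lborel = density (distr lborel borel (\<lambda>x. L x + b)) (\<lambda>_. ennreal c)"
proof -
  define F where "F x = L x + b" for x
  define M where "M = distr lborel borel F"
  have contF: "continuous_on UNIV F"
    unfolding F_def using L(1) by (intro continuous_intros linear_continuous_on linear_linear[THEN iffD2]) 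
  then have [measurable]: "F \<in> borel_measurable borel" by (rule borel_measurable_continuous_onI)
  have setsM: "sets M = sets borel" by (simp add: M_def)
  define G where "G y = inv L (y - b)" for y
  have linG: "linear (inv L)"
    using L by (simp add: bij_is_inj inj_linear_imp_inv_linear)
  then have contG: "continuous_on A G" for A
    unfolding G_def by (intro continuous_intros linear_continuous_on_compose[OF _ linG])
  have FG: "F (G y) = y" for y using L(2) by (simp add: F_def G_def bij_is_surj surj_f_inv_f)
  have GF: "G (F y) = y" for y using L(2) by (simp add: F_def G_def bij_is_inj)
  have vim: "F -` A = G ` A" for A by (auto simp: image_iff) (metis FG GF)+
  have emM: "emeasure M A = emeasure lborel (F -` A)" if "A \<in> sets borel" for A
    using that by (simp add: M_def emeasure_distr)
  have finM: "emeasure M A < \<infinity>" if "compact A" for A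
  proof -
    have "compact (F -` A)" unfolding vim by (rule compact_continuous_image[OF contG that])
    then show ?thesis using that emeasure_compact_finite[of "F -` A"] by (simp add: emM borel_compact)
  qed
  have sf: "sigma_finite_measure M"
  proof
    show "\<exists>A. countable A \<and> A \<subseteq> sets M \<and> \<Union>A = space M \<and> (\<forall>a\<in>A. emeasure M a \<noteq> \<infinity>)"
    proof (intro exI[of _ "range (\<lambda>n::nat. cball 0 (real n))"] conjI)
      show "\<Union>(range (\<lambda>n::nat. cball 0 (real n))) = space M"
        by (auto simp: M_def real_arch_simple)
      show "\<forall>a\<in>range (\<lambda>n::nat. cball 0 (real n)). emeasure M a \<noteq> \<infinity>"
        using finM by (auto simp: less_top)
    qed (auto simp: setsM)
  qed
  have inv: "distr M borel (\<lambda>x. a + x) = M" for a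
  proof -
    have "distr M borel (\<lambda>x. a + x) = distr lborel borel (\<lambda>x. a + F x)"
      by (simp add: M_def distr_distr o_def)
    also have "(\<lambda>x. a + F x) = (\<lambda>x. F (inv L a + x))"
      using L by (simp add: F_def linear_add fun_eq_iff bij_is_surj surj_f_inv_f)
    also have "distr lborel borel \<dots> = distr (distr lborel borel ((+) (inv L a))) borel F"
      by (simp add: distr_distr o_def)
    also have "distr lborel borel ((+) (inv L a)) = (lborel :: 'a measure)"
      by (rule lborel_distr_plus)
    finally show ?thesis by (simp add: M_def)
  qed
  \<comment> \<open>A symmetric set removes the reflection from the comparison of measures, and
    compactness makes both of its measures finite.\<close>
  define Q :: "'a set" where "Q = cball 0 1"
  have Q: "uminus -` Q = Q" "Q \<in> sets borel" by (auto simp: Q_def)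
  have Qp: "emeasure lborel Q > 0" "emeasure lborel Q < \<infinity>"
  proof -
    show "emeasure lborel Q < \<infinity>" unfolding Q_def by (rule emeasure_compact_finite) simp
    have "\<not> negligible Q" unfolding Q_def
      by (metis ball_eq_empty ball_subset_cball negligible_subset not_one_le_zero open_ball open_not_negligible)
    then show "emeasure lborel Q > 0"
      by (simp add: negligible_iff_emeasure0 Q_def zero_less_iff_neq_zero)
  qed
  have eq: "emeasure M E * emeasure lborel Q = emeasure lborel E * emeasure M Q" if "E \<in> sets borel" for E
    using translation_invariant_measure_lborel[OF setsM sf inv that Q(2)] Q by simp
  have fM: "emeasure M Q < \<infinity>" by (intro finM) (simp add: Q_def)
  have "emeasure M Q \<noteq> 0"
  proof
    assume "emeasure M Q = 0"
    then have "emeasure M UNIV * emeasure lborel Q = 0" using eq[of UNIV] by simp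
    then have "emeasure M UNIV = 0" using Qp by auto
    then show False by (simp add: emM)
  qed
  then obtain m where m: "emeasure M Q = ennreal m" "m > 0"
    using fM by (cases "emeasure M Q") (auto simp: ennreal_eq_0_iff)
  obtain r where r: "emeasure lborel Q = ennreal r" "r > 0"
    using Qp by (cases "emeasure lborel Q") (auto simp: ennreal_less_zero_iff)
  have "lborel = density M (\<lambda>_. ennreal (r / m))"
  proof (rule measure_eqI)
    fix E assume "E \<in> sets (lborel :: 'a measure)"
    then have E: "E \<in> sets borel" by simp
    have "emeasure (density M (\<lambda>_. ennreal (r / m))) E = ennreal (r / m) * emeasure M E"
      using E setsM by (simp add: emeasure_density nn_integral_cmult)
    also have "\<dots> = ennreal (1/m) * (emeasure M E * emeasure lborel Q)"
    proof -
      have "ennreal (r / m) = ennreal (1/m) * ennreal r"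
        using r m by (simp flip: ennreal_mult)
      then show ?thesis by (simp only: r(1) mult_ac)
    qed
    also have "\<dots> = ennreal (1/m) * ennreal m * emeasure lborel E"
      unfolding eq[OF E] m(1) by (simp only: mult_ac)
    also have "\<dots> = emeasure lborel E"
      using m by (simp flip: ennreal_mult)
    finally show "emeasure lborel E = emeasure (density M (\<lambda>_. ennreal (r / m))) E" by simp
  qed (simp add: setsM)
  moreover have "r / m > 0" using r m by simp
  ultimately show thesis using that[of "r/m"] unfolding M_def F_def by blast
qed

text \<open>The identity for \<open>lborel\<close> passes to the completions once the image measure
  has the same null sets, and this is where \<open>c > 0\<close> enters.\<close>

lemma
  fixes L :: "'a::euclidean_space \<Rightarrow> 'a"
  assumes L: "linear L" "bij L"
  shows lebesgue_affine_bij_measurable: "(\<lambda>x. L x + b) \<in> lebesgue \<rightarrow>\<^sub>M lebesgue"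
    and lebesgue_affine_bij: "\<exists>c>0. lebesgue = density (distr lebesgue lebesgue (\<lambda>x. L x + b)) (\<lambda>_. ennreal c)"
proof -
  obtain c where c: "c > 0" "lborel = density (distr lborel borel (\<lambda>x. L x + b)) (\<lambda>_. ennreal c)"
    using lborel_affine_bij[OF L] .
  define T where "T x = L x + b" for x
  have "continuous_on UNIV T"
    unfolding T_def using L(1) by (intro continuous_intros linear_continuous_on linear_linear[THEN iffD2]) 
  then have T_borel[measurable]: "T \<in> borel_measurable borel" by (rule borel_measurable_continuous_onI)
  have c2: "lborel = density (distr lborel borel T) (\<lambda>_. ennreal c)"
    using c(2) unfolding T_def .
  { fix A :: "'a set" assume A: "A \<in> sets borel"
    then have "emeasure lborel A = 0 \<longleftrightarrow> emeasure (density (distr lborel borel T) (\<lambda>_. ennreal c)) A = 0"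
      by (subst c2[symmetric]) auto
    also have "\<dots> \<longleftrightarrow> emeasure (distr lebesgue lborel T) A = 0"
      using A c(1) by (simp add: distr_completion emeasure_density nn_integral_cmult cong: distr_cong)
    finally have "emeasure lborel A = 0 \<longleftrightarrow> emeasure (distr lebesgue lborel T) A = 0" . }
  then have eq: "null_sets lborel = null_sets (distr lebesgue lborel T)"
    by (auto simp: null_sets_def)
  show m: "(\<lambda>x. L x + b) \<in> lebesgue \<rightarrow>\<^sub>M lebesgue"
    using completion.measurable_completion2[of T lborel lborel]
    by (simp add: completion.measurable_completion2 eq measurable_completion flip: T_def)
  have "lebesgue = completion (density (distr lborel borel T) (\<lambda>_. ennreal c))"
    by (subst c2) simp
  also have "\<dots> = density (completion (distr lebesgue lborel T)) (\<lambda>_. ennreal c)"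
    using c by (auto intro!: always_eventually completion_density_eq simp: distr_completion cong: distr_cong)
  also have "\<dots> = density (distr lebesgue lebesgue T) (\<lambda>_. ennreal c)"
    by (subst completion.completion_distr_eq) (auto simp: eq measurable_completion)
  finally show "\<exists>c>0. lebesgue = density (distr lebesgue lebesgue (\<lambda>x. L x + b)) (\<lambda>_. ennreal c)"
    unfolding T_def using c(1) by blast
qed

text \<open>As a simp rule this would turn \<open>\<infinity>\<close> into \<open>top\<close>, which the facts about \<^const>\<open>Lp_norm\<close> do not match.\<close>

declare infinity_ennreal_def [simp del]

text \<open>For an affine map \<open>c\<close> is the absolute value of the determinant of the
  linear part. Measurability of \<open>inv F\<close> is included because images of Lebesgue sets
  have to be Lebesgue sets.\<close>

definition has_jacobian :: "('a::euclidean_space \<Rightarrow> 'a) \<Rightarrow> real \<Rightarrow> bool" where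
  "has_jacobian F c \<longleftrightarrow> c > 0 \<and> bij F \<and> F \<in> lebesgue \<rightarrow>\<^sub>M lebesgue \<and> inv F \<in> lebesgue \<rightarrow>\<^sub>M lebesgue
     \<and> lebesgue = density (distr lebesgue lebesgue F) (\<lambda>_. ennreal c)"

lemma has_jacobian_affine:
  fixes L :: "'a::euclidean_space \<Rightarrow> 'a"
  assumes "linear L" "bij L"
  shows "\<exists>c. has_jacobian (\<lambda>x. L x + b) c"
proof -
  have inv: "inv (\<lambda>x. L x + b) = (\<lambda>y. inv L y + (- inv L b))"
  proof (rule inv_equality)
    have lin: "linear (inv L)" using assms by (simp add: bij_is_inj inj_linear_imp_inv_linear)
    show "inv L (L x + b) + - inv L b = x" for x
      using assms by (simp add: linear_add[OF lin] bij_is_inj)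
    show "L (inv L y + - inv L b) + b = y" for y
      using assms by (simp add: linear_diff bij_is_surj surj_f_inv_f)
  qed
  have "bij (\<lambda>x. L x + b)"
    using assms(2) bij_comp[OF assms(2) bij_plus_right[of b]] by (simp add: o_def)
  moreover have "inv (\<lambda>x. L x + b) \<in> lebesgue \<rightarrow>\<^sub>M lebesgue"
    unfolding inv using assms
    by (intro lebesgue_affine_bij_measurable) (auto simp: bij_is_inj inj_linear_imp_inv_linear bij_imp_bij_inv)
  ultimately show ?thesis
    using lebesgue_affine_bij[OF assms] lebesgue_affine_bij_measurable[OF assms]
    unfolding has_jacobian_def by blast
qed

lemma has_jacobian_translation:
  fixes b :: "'a::euclidean_space"
  shows "has_jacobian (\<lambda>x. x + b) 1"
proof -
  have "bij (\<lambda>x. x + b)" by (rule bij_plus_right)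
  moreover have inv: "inv (\<lambda>x. x + b) = (\<lambda>x. x + (-b))"
    by (rule inv_equality) auto
  moreover have m: "(\<lambda>x. x + b) \<in> lebesgue \<rightarrow>\<^sub>M lebesgue" for b :: 'a
    using lebesgue_affine_bij_measurable[of id b] linear_id by simp
  moreover have "lebesgue = distr lebesgue lebesgue (\<lambda>x. x + b)"
    using lebesgue_affine_euclidean[of "\<lambda>_. 1" b] by (simp add: euclidean_representation density_1 add.commute)
  ultimately show ?thesis using m[of "-b"] by (simp add: has_jacobian_def density_1)
qed

lemma has_jacobian_image_sets:
  assumes "has_jacobian F c" "U \<in> sets lebesgue"
  shows "F ` U \<in> sets lebesgue"
proof -
  have "F ` U = inv F -` U"
    using assms by (auto simp: has_jacobian_def bij_is_inj bij_is_surj surj_f_inv_f image_iff) (metis bij_is_surj surj_f_inv_f)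
  then show ?thesis
    using measurable_sets[of "inv F" lebesgue lebesgue U] assms by (simp add: has_jacobian_def)
qed

lemma lebesgue_on_image_has_jacobian:
  assumes F: "has_jacobian F c" and U: "U \<in> sets lebesgue"
  shows "F \<in> lebesgue_on U \<rightarrow>\<^sub>M lebesgue_on (F ` U)"
    and "lebesgue_on (F ` U) = density (distr (lebesgue_on U) (lebesgue_on (F ` U)) F) (\<lambda>_. ennreal c)"
proof -
  have [measurable]: "F \<in> lebesgue \<rightarrow>\<^sub>M lebesgue" using F by (simp add: has_jacobian_def)
  have FU: "F ` U \<in> sets lebesgue" by (rule has_jacobian_image_sets[OF F U])
  show m: "F \<in> lebesgue_on U \<rightarrow>\<^sub>M lebesgue_on (F ` U)"
    by (rule measurable_restrict_space3) auto
  show "lebesgue_on (F ` U) = density (distr (lebesgue_on U) (lebesgue_on (F ` U)) F) (\<lambda>_. ennreal c)"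
  proof (rule measure_eqI)
    fix A assume A: "A \<in> sets (lebesgue_on (F ` U))"
    then have A': "A \<in> sets lebesgue" "A \<subseteq> F ` U" using FU by (auto simp: sets_restrict_space_iff)
    have "emeasure (lebesgue_on (F ` U)) A = emeasure lebesgue A"
      using A' FU by (simp add: emeasure_restrict_space)
    also have "\<dots> = emeasure (density (distr lebesgue lebesgue F) (\<lambda>_. ennreal c)) A"
      using F by (simp add: has_jacobian_def)
    also have "\<dots> = ennreal c * emeasure lebesgue (F -` A)"
      using A' by (simp add: emeasure_density nn_integral_cmult emeasure_distr)
    also have "F -` A = F -` A \<inter> space (lebesgue_on U)"
      using A' F by (auto simp: has_jacobian_def dest!: bij_is_inj dest: injD)
    also have "emeasure lebesgue \<dots> = emeasure (lebesgue_on U) \<dots>"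
      using measurable_sets[OF m A] U by (subst emeasure_restrict_space) auto
    also have "ennreal c * \<dots> = emeasure (density (distr (lebesgue_on U) (lebesgue_on (F ` U)) F) (\<lambda>_. ennreal c)) A"
      using A m by (simp add: emeasure_density nn_integral_cmult emeasure_distr)
    finally show "emeasure (lebesgue_on (F ` U)) A
      = emeasure (density (distr (lebesgue_on U) (lebesgue_on (F ` U)) F) (\<lambda>_. ennreal c)) A" .
  qed simp
qed

lemma measurable_image_has_jacobian:
  fixes f :: "'a::euclidean_space \<Rightarrow> 'b::topological_space"
  assumes F: "has_jacobian F c" and U: "U \<in> sets lebesgue"
  shows "f \<in> borel_measurable (lebesgue_on (F ` U)) \<longleftrightarrow> (\<lambda>x. f (F x)) \<in> borel_measurable (lebesgue_on U)"
proof
  note m = lebesgue_on_image_has_jacobian(1)[OF F U]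
  show "f \<in> borel_measurable (lebesgue_on (F ` U)) \<Longrightarrow> (\<lambda>x. f (F x)) \<in> borel_measurable (lebesgue_on U)"
    by (rule measurable_compose[OF m])
  assume a: "(\<lambda>x. f (F x)) \<in> borel_measurable (lebesgue_on U)"
  have FU: "F ` U \<in> sets lebesgue" by (rule has_jacobian_image_sets[OF F U])
  have bij: "bij F" using F by (simp add: has_jacobian_def)
  have "inv F \<in> lebesgue_on (F ` U) \<rightarrow>\<^sub>M lebesgue_on U"
    using F by (intro measurable_restrict_space3) (auto simp: has_jacobian_def bij_is_inj)
  from measurable_compose[OF this a] show "f \<in> borel_measurable (lebesgue_on (F ` U))"
    by (rule measurable_cong[THEN iffD1, rotated]) (simp add: bij bij_is_surj surj_f_inv_f)
qed

lemma AE_image_has_jacobian: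
  assumes F: "has_jacobian F c" and U: "U \<in> sets lebesgue"
  shows "(AE y in lebesgue_on (F ` U). P y) \<longleftrightarrow> (AE x in lebesgue_on U. P (F x))"
proof -
  note m = lebesgue_on_image_has_jacobian[OF F U]
  have FU: "F ` U \<in> sets lebesgue" by (rule has_jacobian_image_sets[OF F U])
  have c: "c > 0" and bij: "bij F" using F by (auto simp: has_jacobian_def)
  have FU2: "inv F ` F ` U = U" using bij by (simp add: bij_is_inj image_comp)
  have "(AE y in lebesgue_on (F ` U). P y) \<longleftrightarrow> (AE y in distr (lebesgue_on U) (lebesgue_on (F ` U)) F. P y)"
    by (subst m(2), subst AE_density) (use c in auto)
  also have "\<dots> \<longleftrightarrow> (AE x in lebesgue_on U. P (F x))"
  proof
    assume "AE y in distr (lebesgue_on U) (lebesgue_on (F ` U)) F. P y"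
    then show "AE x in lebesgue_on U. P (F x)" by (rule AE_distrD[OF m(1)])
  next
    \<comment> \<open>\<open>P\<close> need not be measurable, so a measurable null set
      \<open>N\<close> covering its failures is carried forward by the bijection
      \<open>F\<close>.\<close>
    assume "AE x in lebesgue_on U. P (F x)"
    then obtain N where N: "{x \<in> U. \<not> P (F x)} \<subseteq> N" "emeasure (lebesgue_on U) N = 0" "N \<in> sets (lebesgue_on U)"
      by (auto elim!: AE_E)
    have NU: "N \<in> sets lebesgue" "N \<subseteq> U" using N U by (auto simp: sets_restrict_space_iff)
    have s: "F ` N \<in> sets (lebesgue_on (F ` U))"
      using has_jacobian_image_sets[OF F NU(1)] NU FU by (auto simp: sets_restrict_space_iff)
    have "F -` F ` N \<inter> U = N" using bij NU by (auto dest!: bij_is_inj dest: injD)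
    then have z: "emeasure (distr (lebesgue_on U) (lebesgue_on (F ` U)) F) (F ` N) = 0"
      using s m(1) N by (simp add: emeasure_distr)
    show "AE y in distr (lebesgue_on U) (lebesgue_on (F ` U)) F. P y"
      by (rule AE_I[OF _ z]) (use N s in auto)
  qed
  finally show ?thesis .
qed

lemma integral_image_has_jacobian:
  fixes f :: "'a::euclidean_space \<Rightarrow> real"
  assumes F: "has_jacobian F c" and U: "U \<in> sets lebesgue"
    and f: "f \<in> borel_measurable (lebesgue_on (F ` U))"
  shows "integral\<^sup>L (lebesgue_on (F ` U)) f = c * (\<integral>x. f (F x) \<partial>lebesgue_on U)"
    and "integrable (lebesgue_on (F ` U)) f \<longleftrightarrow> integrable (lebesgue_on U) (\<lambda>x. f (F x))"
proof -
  note m = lebesgue_on_image_has_jacobian[OF F U]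
  have c: "c > 0" using F by (auto simp: has_jacobian_def)
  show "integral\<^sup>L (lebesgue_on (F ` U)) f = c * (\<integral>x. f (F x) \<partial>lebesgue_on U)"
    using f c m(1) by (subst m(2)) (simp add: integral_density integral_distr)
  show "integrable (lebesgue_on (F ` U)) f \<longleftrightarrow> integrable (lebesgue_on U) (\<lambda>x. f (F x))"
    using f c m(1) by (subst m(2)) (simp add: integrable_density integrable_distr_eq)
qed

lemma measure_image_has_jacobian:
  assumes F: "has_jacobian F c" and U: "U \<in> sets lebesgue"
  shows "measure lebesgue (F ` U) = c * measure lebesgue U"
    and "U \<in> lmeasurable \<Longrightarrow> F ` U \<in> lmeasurable"
proof -
  note m = lebesgue_on_image_has_jacobian[OF F U]
  have FU: "F ` U \<in> sets lebesgue" by (rule has_jacobian_image_sets[OF F U])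
  have c: "c > 0" and bij: "bij F" using F by (auto simp: has_jacobian_def)
  have "emeasure (lebesgue_on (F ` U)) (F ` U) = c * emeasure (lebesgue_on U) U"
  proof -
    have "F -` F ` U \<inter> U = U" by auto
    then have "emeasure (distr (lebesgue_on U) (lebesgue_on (F ` U)) F) (F ` U) = emeasure (lebesgue_on U) U"
      using m(1) by (simp add: emeasure_distr)
    moreover have "emeasure (lebesgue_on (F ` U)) (F ` U)
      = ennreal c * emeasure (distr (lebesgue_on U) (lebesgue_on (F ` U)) F) (F ` U)"
      by (subst m(2), subst emeasure_density) (simp_all add: nn_integral_cmult_indicator)
    ultimately show ?thesis by simp
  qed
  then have *: "emeasure lebesgue (F ` U) = c * emeasure lebesgue U"
    using FU U by (simp add: emeasure_restrict_space)
  then show "measure lebesgue (F ` U) = c * measure lebesgue U"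
    using c by (simp add: measure_def enn2real_mult)
  show "U \<in> lmeasurable \<Longrightarrow> F ` U \<in> lmeasurable"
    using * FU by (auto simp: fmeasurable_def ennreal_mult_less_top infinity_ennreal_def)
qed

section \<open>Lebesgue norms\<close>

text \<open>Exponents are extended reals while norms are computed with real powers; this split hands
  over the real exponent.\<close>

lemma ennreal_exponent_cases:
  assumes "1 \<le> p"
  obtains "p = \<infinity>" "recip p = 0" | r where "r \<ge> 1" "p = ennreal r" "enn2real p = r" "recip p = 1 / r" "p \<noteq> \<infinity>"
proof (cases p)
  case (real r)
  then have "r \<ge> 1" using assms by (metis ennreal_1 ennreal_le_iff)
  then show ?thesis using real that(2)[of r]
    by (simp add: recip_def inverse_ennreal inverse_eq_divide infinity_ennreal_def)
next
  case top
  then show ?thesis using that(1) by (simp add: recip_def infinity_ennreal_def)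
qed

lemma recip_bounds: "1 \<le> p \<Longrightarrow> 0 \<le> recip p \<and> recip p \<le> 1"
  by (erule ennreal_exponent_cases) auto

lemma recip_antimono:
  assumes "1 \<le> q" "q \<le> p"
  shows "recip p \<le> recip q"
proof -
  have "1 \<le> p" using assms by simp
  then show ?thesis
  proof (cases rule: ennreal_exponent_cases)
    case 1
    then show ?thesis using recip_bounds[OF assms(1)] by simp
  next
    case (2 r)
    from assms(1) show ?thesis
    proof (cases rule: ennreal_exponent_cases)
      case 1
      then show ?thesis using assms(2) 2 by (simp add: infinity_ennreal_def top_unique)
    next
      case (2 s)
      then show ?thesis using \<open>p = ennreal r\<close> \<open>recip p = 1 / r\<close> \<open>r \<ge> 1\<close> assms(2) by (simp add: frac_le)
    qed
  qed
qed

section \<open>Essentially bounded functions and their norms for every exponent\<close>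

lemma Lp_space_infinity_iff:
  "f \<in> Lp_space \<infinity> U \<longleftrightarrow> f \<in> borel_measurable (lebesgue_on U) \<and> (\<exists>c. AE x in lebesgue_on U. \<bar>f x\<bar> \<le> c)"
  by (simp add: Lp_space_def)

lemma Lp_space_infinityI:
  "f \<in> borel_measurable (lebesgue_on U) \<Longrightarrow> AE x in lebesgue_on U. \<bar>f x\<bar> \<le> c \<Longrightarrow> f \<in> Lp_space \<infinity> U"
  by (auto simp: Lp_space_infinity_iff)

lemma Lp_space_infinity_measurable: "f \<in> Lp_space \<infinity> U \<Longrightarrow> f \<in> borel_measurable (lebesgue_on U)"
  by (simp add: Lp_space_infinity_iff)

lemma Lp_space_infinity_add:
  assumes "f \<in> Lp_space \<infinity> U" "g \<in> Lp_space \<infinity> U"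
  shows "(\<lambda>x. f x + g x) \<in> Lp_space \<infinity> U"
proof -
  obtain a b where "AE x in lebesgue_on U. \<bar>f x\<bar> \<le> a" "AE x in lebesgue_on U. \<bar>g x\<bar> \<le> b"
    using assms by (auto simp: Lp_space_infinity_iff)
  then have "AE x in lebesgue_on U. \<bar>f x + g x\<bar> \<le> a + b" by eventually_elim auto
  then show ?thesis using assms by (auto simp: Lp_space_infinity_iff)
qed

lemma Lp_space_infinity_cmult:
  assumes "f \<in> Lp_space \<infinity> U"
  shows "(\<lambda>x. c * f x) \<in> Lp_space \<infinity> U"
proof -
  obtain a where "AE x in lebesgue_on U. \<bar>f x\<bar> \<le> a"
    using assms by (auto simp: Lp_space_infinity_iff)
  then have "AE x in lebesgue_on U. \<bar>c * f x\<bar> \<le> \<bar>c\<bar> * a"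
    by eventually_elim (auto simp: abs_mult intro: mult_left_mono)
  then show ?thesis using assms by (auto simp: Lp_space_infinity_iff)
qed

lemma Lp_space_infinity_const: "(\<lambda>x. c) \<in> Lp_space \<infinity> U"
  by (rule Lp_space_infinityI[of _ _ "\<bar>c\<bar>"]) auto

lemma Lp_space_infinity_sum:
  "(\<And>i. i \<in> I \<Longrightarrow> f i \<in> Lp_space \<infinity> U) \<Longrightarrow> (\<lambda>x. \<Sum>i\<in>I. f i x) \<in> Lp_space \<infinity> U"
  by (induction I rule: infinite_finite_induct)
     (auto intro: Lp_space_infinity_const Lp_space_infinity_add)

text \<open>Boundedness keeps the essential supremum below \<open>\<infinity>\<close>, so its
  conversion to a real number is still an upper bound.\<close>

lemma AE_le_Lp_norm_infinity:
  assumes "f \<in> Lp_space \<infinity> U"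
  shows "AE x in lebesgue_on U. \<bar>f x\<bar> \<le> Lp_norm \<infinity> U f"
proof -
  let ?e = "esssup (lebesgue_on U) (\<lambda>x. ereal \<bar>f x\<bar>)"
  obtain c where c: "AE x in lebesgue_on U. \<bar>f x\<bar> \<le> c" using assms by (auto simp: Lp_space_infinity_iff)
  have [measurable]: "f \<in> borel_measurable (lebesgue_on U)" using assms by (auto simp: Lp_space_infinity_iff)
  have "?e \<le> ereal c" using c by (intro esssup_I) auto
  moreover have "AE x in lebesgue_on U. ereal \<bar>f x\<bar> \<le> ?e" by (rule esssup_AE)
  ultimately show ?thesis by (cases ?e) (auto simp: Lp_norm_def)
qed

lemma Lp_norm_infinity_le:
  assumes [measurable]: "f \<in> borel_measurable (lebesgue_on U)" and "AE x in lebesgue_on U. \<bar>f x\<bar> \<le> c" "c \<ge> 0"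
  shows "Lp_norm \<infinity> U f \<le> c"
proof -
  let ?e = "esssup (lebesgue_on U) (\<lambda>x. ereal \<bar>f x\<bar>)"
  have "?e \<le> ereal c" using assms by (intro esssup_I) auto
  then show ?thesis using assms(3) by (cases ?e) (auto simp: Lp_norm_def)
qed

text \<open>A negative essential supremum can only be \<open>-\<infinity>\<close>, on a null space,
  and a non-measurable function gets \<open>\<infinity>\<close>; \<open>real_of_ereal\<close> sends
  both to 0.\<close>

lemma Lp_norm_nonneg: "Lp_norm p U f \<ge> 0"
proof (cases "p = \<infinity>")
  case True
  let ?e = "esssup (lebesgue_on U) (\<lambda>x. ereal \<bar>f x\<bar>)"
  have "?e < 0 \<Longrightarrow> ?e = -\<infinity>"
  proof -
    assume e: "?e < 0"
    have "AE x in lebesgue_on U. ereal \<bar>f x\<bar> \<le> ?e" by (rule esssup_AE)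
    then have "AE x in lebesgue_on U. False"
      by eventually_elim (use e in \<open>metis abs_ge_zero ereal_less_eq(5) leD order_trans\<close>)
    moreover have "(\<lambda>x. ereal \<bar>f x\<bar>) \<in> borel_measurable (lebesgue_on U)"
      using e esssup_non_measurable[of "\<lambda>x. ereal \<bar>f x\<bar>" "lebesgue_on U"] by fastforce
    ultimately have "?e \<le> -\<infinity>" by (intro esssup_I) auto
    then show ?thesis by simp
  qed
  then show ?thesis using True by (cases ?e) (force simp: Lp_norm_def)+
qed (simp add: Lp_norm_def)

lemma Lp_norm_finite:
  assumes "r \<ge> 1"
  shows "Lp_norm (ennreal r) U f = (\<integral>x. \<bar>f x\<bar> powr r \<partial>lebesgue_on U) powr (1 / r)"
  using assms by (simp add: Lp_norm_def recip_def inverse_ennreal inverse_eq_divide infinity_ennreal_def)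

text \<open>On a set of finite measure essential boundedness gives membership in every L^p, so later
  norm facts carry this one integrability hypothesis for all exponents.\<close>

lemma integrable_powr_Lp_space_infinity:
  assumes "f \<in> Lp_space \<infinity> U" "U \<in> lmeasurable" "r \<ge> 0"
  shows "integrable (lebesgue_on U) (\<lambda>x. \<bar>f x\<bar> powr r)"
proof -
  interpret finite_measure "lebesgue_on U" using assms(2) by (rule finite_measure_lebesgue_on)
  obtain c where c: "AE x in lebesgue_on U. \<bar>f x\<bar> \<le> c" using assms by (auto simp: Lp_space_infinity_iff)
  have [measurable]: "f \<in> borel_measurable (lebesgue_on U)" using assms by (auto simp: Lp_space_infinity_iff)
  show ?thesis
  proof (rule integrable_const_bound[of _ "c powr r"])
    show "AE x in lebesgue_on U. norm (\<bar>f x\<bar> powr r) \<le> c powr r"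
      using c by eventually_elim (use assms(3) in \<open>auto intro: powr_mono2\<close>)
  qed measurable
qed

lemma Lp_norm_AE_mono:
  assumes f: "f \<in> borel_measurable (lebesgue_on U)" and g: "g \<in> Lp_space \<infinity> U"
    and U: "U \<in> lmeasurable" and p: "1 \<le> p" and le: "AE x in lebesgue_on U. \<bar>f x\<bar> \<le> \<bar>g x\<bar>"
  shows "Lp_norm p U f \<le> Lp_norm p U g"
  using p
proof (cases rule: ennreal_exponent_cases)
  case 1
  have "AE x in lebesgue_on U. \<bar>f x\<bar> \<le> Lp_norm \<infinity> U g"
    using AE_le_Lp_norm_infinity[OF g] le by eventually_elim auto
  then show ?thesis using f 1 by (auto intro: Lp_norm_infinity_le Lp_norm_nonneg)
next
  case (2 r)
  have "(\<integral>x. \<bar>f x\<bar> powr r \<partial>lebesgue_on U) \<le> (\<integral>x. \<bar>g x\<bar> powr r \<partial>lebesgue_on U)"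
  proof (rule integral_mono_AE')
    show "integrable (lebesgue_on U) (\<lambda>x. \<bar>g x\<bar> powr r)"
      using g U 2 by (intro integrable_powr_Lp_space_infinity) auto
    show "AE x in lebesgue_on U. \<bar>f x\<bar> powr r \<le> \<bar>g x\<bar> powr r"
      using le by eventually_elim (use 2 in \<open>auto intro: powr_mono2\<close>)
  qed auto
  then show ?thesis using 2 by (auto simp: Lp_norm_finite intro!: powr_mono2 integral_nonneg_AE)
qed

lemma Lp_space_infinity_AE_cong:
  assumes "f \<in> Lp_space \<infinity> U" "g \<in> borel_measurable (lebesgue_on U)" "AE x in lebesgue_on U. f x = g x"
  shows "g \<in> Lp_space \<infinity> U"
proof -
  obtain c where "AE x in lebesgue_on U. \<bar>f x\<bar> \<le> c" using assms by (auto simp: Lp_space_infinity_iff)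
  then have "AE x in lebesgue_on U. \<bar>g x\<bar> \<le> c" using assms(3) by eventually_elim auto
  then show ?thesis using assms by (auto simp: Lp_space_infinity_iff)
qed

lemma Lp_norm_AE_cong:
  assumes f: "f \<in> Lp_space \<infinity> U" and g: "g \<in> borel_measurable (lebesgue_on U)"
    and U: "U \<in> lmeasurable" and p: "1 \<le> p" and eq: "AE x in lebesgue_on U. f x = g x"
  shows "Lp_norm p U f = Lp_norm p U g"
proof (rule antisym)
  have "AE x in lebesgue_on U. \<bar>f x\<bar> \<le> \<bar>g x\<bar>" "AE x in lebesgue_on U. \<bar>g x\<bar> \<le> \<bar>f x\<bar>"
    using eq by (eventually_elim, simp)+
  then show "Lp_norm p U f \<le> Lp_norm p U g" "Lp_norm p U g \<le> Lp_norm p U f"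
    using f g U p eq by (auto intro!: Lp_norm_AE_mono intro: Lp_space_infinity_measurable Lp_space_infinity_AE_cong)
qed

lemma Lp_norm_cmult_le:
  assumes f: "f \<in> Lp_space \<infinity> U" and p: "1 \<le> p"
  shows "Lp_norm p U (\<lambda>x. c * f x) \<le> \<bar>c\<bar> * Lp_norm p U f"
  using p
proof (cases rule: ennreal_exponent_cases)
  case 1
  have "AE x in lebesgue_on U. \<bar>c * f x\<bar> \<le> \<bar>c\<bar> * Lp_norm \<infinity> U f"
    using AE_le_Lp_norm_infinity[OF f] by eventually_elim (auto simp: abs_mult intro: mult_left_mono)
  then show ?thesis
    using f 1 by (auto intro!: Lp_norm_infinity_le mult_nonneg_nonneg Lp_norm_nonneg simp: Lp_space_infinity_iff)
next
  case (2 r)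
  have "(\<integral>x. \<bar>c * f x\<bar> powr r \<partial>lebesgue_on U) = \<bar>c\<bar> powr r * (\<integral>x. \<bar>f x\<bar> powr r \<partial>lebesgue_on U)"
    by (simp add: abs_mult powr_mult)
  then show ?thesis using 2 by (simp add: Lp_norm_finite powr_mult powr_powr integral_nonneg_AE)
qed

lemma Lp_norm_cmult:
  assumes f: "f \<in> Lp_space \<infinity> U" and p: "1 \<le> p"
  shows "Lp_norm p U (\<lambda>x. c * f x) = \<bar>c\<bar> * Lp_norm p U f"
proof (cases "c = 0")
  case True
  then show ?thesis using Lp_norm_cmult_le[OF f p, of c] Lp_norm_nonneg[of p U "\<lambda>x. c * f x"] by auto
next
  case False
  \<comment> \<open>The reverse inequality is the same bound for the scalar
    \<open>1/c\<close>.\<close>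
  have "Lp_norm p U (\<lambda>x. (1/c) * (c * f x)) \<le> \<bar>1/c\<bar> * Lp_norm p U (\<lambda>x. c * f x)"
    by (intro Lp_norm_cmult_le Lp_space_infinity_cmult f p)
  then have "\<bar>c\<bar> * Lp_norm p U f \<le> Lp_norm p U (\<lambda>x. c * f x)"
    using False by (simp add: field_simps)
  then show ?thesis using Lp_norm_cmult_le[OF f p, of c] by auto
qed

text \<open>Convexity of \<open>t \<mapsto> t\<^sup>r\<close> applied to \<open>a/A\<close> and \<open>b/B\<close> with the weights \<open>A/(A+B)\<close> and \<open>B/(A+B)\<close>.\<close>

lemma powr_add_le_weighted:
  fixes a b A B r :: real
  assumes "a \<ge> 0" "b \<ge> 0" "A > 0" "B > 0" "r \<ge> 1"
  shows "(a + b) powr r \<le> (A + B) powr r * (A / (A+B) * (a / A) powr r + B / (A+B) * (b / B) powr r)"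
proof -
  have conv: "(s * x + t * y) powr r \<le> s * x powr r + t * y powr r"
    if "x \<ge> 0" "y \<ge> 0" "s > 0" "t > 0" "s + t = 1" for x y s t :: real
  proof (cases "x = 0 \<or> y = 0")
    case True
    have *: "s powr r \<le> s" if "0 < s" "s \<le> 1" for s
      using powr_mono'[of 1 r s] that assms by simp
    from True that show ?thesis
      using *[of s] *[of t] assms by (auto simp: powr_mult intro!: mult_right_mono)
  next
    case False
    have s: "s = 1 - t" "t \<le> 1" using that by auto
    show ?thesis
      unfolding s(1) using convex_onD[OF powr_convex[OF assms(5)], of t x y] that(1,2,4) s(2) False by simp
  qed
  have AB: "A + B > 0" using assms by simp
  have eq: "A / (A+B) * (a / A) + B / (A+B) * (b / B) = (a + b) / (A+B)"
    using assms by (simp add: add_divide_distrib)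
  have one: "A / (A+B) + B / (A+B) = 1" using AB by (simp only: add_divide_distrib[symmetric] divide_self)
  have "(a + b) powr r = ((A + B) * ((a + b) / (A+B))) powr r"
    using AB by simp
  also have "\<dots> = (A + B) powr r * (A / (A+B) * (a / A) + B / (A+B) * (b / B)) powr r"
    unfolding eq using AB assms by (intro powr_mult)
  also have "\<dots> \<le> (A + B) powr r * (A / (A+B) * (a / A) powr r + B / (A+B) * (b / B) powr r)"
    using assms one by (intro mult_left_mono conv) auto
  finally show ?thesis .
qed

text \<open>Minkowski by convexity rather than by Hoelder duality: the weighted inequality is
  integrated with numbers \<open>A\<close> and \<open>B\<close> strictly above the two norms.
  Strictness keeps them positive, so a vanishing norm causes no division by 0, and letting them tend
  to the norms finishes the proof.\<close>

lemma Lp_norm_triangle: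
  assumes f: "f \<in> Lp_space \<infinity> U" and g: "g \<in> Lp_space \<infinity> U" and U: "U \<in> lmeasurable" and p: "1 \<le> p"
  shows "Lp_norm p U (\<lambda>x. f x + g x) \<le> Lp_norm p U f + Lp_norm p U g"
  using p
proof (cases rule: ennreal_exponent_cases)
  case 1
  have "AE x in lebesgue_on U. \<bar>f x + g x\<bar> \<le> Lp_norm \<infinity> U f + Lp_norm \<infinity> U g"
    using AE_le_Lp_norm_infinity[OF f] AE_le_Lp_norm_infinity[OF g] by eventually_elim auto
  then show ?thesis
    using f g 1 by (auto intro!: Lp_norm_infinity_le add_nonneg_nonneg Lp_norm_nonneg simp: Lp_space_infinity_iff)
next
  case (2 r)
  let ?I = "\<lambda>f. \<integral>x. \<bar>f x\<bar> powr r \<partial>lebesgue_on U"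
  have int: "integrable (lebesgue_on U) (\<lambda>x. \<bar>h x\<bar> powr r)" if "h \<in> Lp_space \<infinity> U" for h
    using that U 2 by (intro integrable_powr_Lp_space_infinity) auto
  have I0: "?I h \<ge> 0" for h by (rule integral_nonneg_AE) auto
  have "Lp_norm p U (\<lambda>x. f x + g x) \<le> A + B" if A: "A > Lp_norm p U f" and B: "B > Lp_norm p U g" for A B
  proof -
    have pos: "A > 0" "B > 0" using A B Lp_norm_nonneg[of p U] by (auto intro: le_less_trans)
    have le1: "?I h \<le> C powr r" if "Lp_norm p U h < C" for h C
    proof -
      have "?I h = (Lp_norm p U h) powr r" using 2 I0 by (simp add: Lp_norm_finite powr_powr)
      also have "\<dots> \<le> C powr r" using 2 that Lp_norm_nonneg by (intro powr_mono2) auto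
      finally show ?thesis .
    qed
    have "?I (\<lambda>x. f x + g x) \<le>
        (\<integral>x. (A+B) powr r * (A / (A+B) * (\<bar>f x\<bar> powr r / A powr r) + B / (A+B) * (\<bar>g x\<bar> powr r / B powr r)) \<partial>lebesgue_on U)"
    proof (rule integral_mono_AE)
      have "\<bar>f x + g x\<bar> powr r \<le> (A+B) powr r * (A / (A+B) * (\<bar>f x\<bar> powr r / A powr r) + B / (A+B) * (\<bar>g x\<bar> powr r / B powr r))" for x
      proof -
        have "\<bar>f x + g x\<bar> powr r \<le> (\<bar>f x\<bar> + \<bar>g x\<bar>) powr r" using 2 by (intro powr_mono2) auto
        also have "\<dots> \<le> (A+B) powr r * (A / (A+B) * (\<bar>f x\<bar> / A) powr r + B / (A+B) * (\<bar>g x\<bar> / B) powr r)"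
          using pos 2 by (intro powr_add_le_weighted) auto
        finally show ?thesis using pos by (simp add: powr_divide)
      qed
      then show "AE x in lebesgue_on U. \<bar>f x + g x\<bar> powr r \<le> (A+B) powr r * (A / (A+B) * (\<bar>f x\<bar> powr r / A powr r) + B / (A+B) * (\<bar>g x\<bar> powr r / B powr r))"
        by simp
    qed (use f g int in \<open>auto intro!: Lp_space_infinity_add\<close>)
    also have "\<dots> = (A+B) powr r * (A / (A+B) * (?I f / A powr r) + B / (A+B) * (?I g / B powr r))"
      using int[OF f] int[OF g] by simp
    also have "\<dots> \<le> (A+B) powr r * (A / (A+B) * 1 + B / (A+B) * 1)"
      using pos le1[OF A] le1[OF B] by (intro mult_left_mono add_mono) (auto simp: divide_le_eq_1)
    also have "\<dots> = (A+B) powr r"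
      using add_pos_pos[OF pos] by (simp only: mult_1_right add_divide_distrib[symmetric]) simp
    finally have "?I (\<lambda>x. f x + g x) powr (1/r) \<le> ((A+B) powr r) powr (1/r)"
      using 2 I0 by (intro powr_mono2) auto
    then show ?thesis using 2 pos by (simp add: Lp_norm_finite powr_powr)
  qed
  note * = this
  show ?thesis
  proof (rule field_le_epsilon)
    fix e :: real assume "e > 0"
    then show "Lp_norm p U (\<lambda>x. f x + g x) \<le> Lp_norm p U f + Lp_norm p U g + e"
      using *[of "Lp_norm p U f + e/2" "Lp_norm p U g + e/2"] by simp
  qed
qed

lemma Lp_norm_zero [simp]: "1 \<le> p \<Longrightarrow> Lp_norm p U (\<lambda>x. 0) = 0"
  using Lp_norm_cmult[of "\<lambda>x. 0" U p 0] by (simp add: Lp_space_infinity_const)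

lemma Lp_norm_sum:
  assumes "\<And>i. i \<in> I \<Longrightarrow> f i \<in> Lp_space \<infinity> U" "U \<in> lmeasurable" "1 \<le> p"
  shows "Lp_norm p U (\<lambda>x. \<Sum>i\<in>I. f i x) \<le> (\<Sum>i\<in>I. Lp_norm p U (f i))"
  using assms(1)
proof (induction I rule: infinite_finite_induct)
  case (insert i I)
  have "Lp_norm p U (\<lambda>x. f i x + (\<Sum>i\<in>I. f i x)) \<le> Lp_norm p U (f i) + Lp_norm p U (\<lambda>x. \<Sum>i\<in>I. f i x)"
    using insert assms by (intro Lp_norm_triangle Lp_space_infinity_sum) auto
  also have "\<dots> \<le> Lp_norm p U (f i) + (\<Sum>i\<in>I. Lp_norm p U (f i))" using insert by auto
  finally show ?case using insert by simp
qed (use assms in auto)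

lemma Lp_norm_eq_0_iff:
  assumes f: "f \<in> Lp_space \<infinity> U" and U: "U \<in> lmeasurable" and p: "1 \<le> p"
  shows "Lp_norm p U f = 0 \<longleftrightarrow> (AE x in lebesgue_on U. f x = 0)"
proof
  assume "AE x in lebesgue_on U. f x = 0"
  then show "Lp_norm p U f = 0"
    using Lp_norm_AE_cong[OF f _ U p, of "\<lambda>_. 0"] p by auto
next
  assume 0: "Lp_norm p U f = 0"
  show "AE x in lebesgue_on U. f x = 0"
    using p
  proof (cases rule: ennreal_exponent_cases)
    case 1
    then show ?thesis using AE_le_Lp_norm_infinity[OF f] 0 by auto
  next
    case (2 r)
    then have "(\<integral>x. \<bar>f x\<bar> powr r \<partial>lebesgue_on U) = 0" using 0 by (simp add: Lp_norm_finite)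
    then have "AE x in lebesgue_on U. \<bar>f x\<bar> powr r = 0"
      using f U 2 integrable_powr_Lp_space_infinity[OF f U, of r]
      by (subst (asm) integral_nonneg_eq_0_iff_AE) auto
    then show ?thesis by simp
  qed
qed

text \<open>Since \<open>recip \<infinity> = 0\<close>, the factor is 1 for the sup norm and both
  cases share one formula. Quotients of two such factors later produce the exponent d(1/p -
  1/q).\<close>

lemma Lp_norm_image_has_jacobian:
  assumes F: "has_jacobian F c" and U: "U \<in> sets lebesgue" and p: "1 \<le> p"
    and f: "f \<in> Lp_space \<infinity> (F ` U)"
  shows "Lp_norm p (F ` U) f = c powr recip p * Lp_norm p U (\<lambda>x. f (F x))"
  using p
proof (cases rule: ennreal_exponent_cases)
  case 1
  have c: "c > 0" using F by (simp add: has_jacobian_def)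
  have fm: "f \<in> borel_measurable (lebesgue_on (F ` U))" using f by (rule Lp_space_infinity_measurable)
  have fm': "(\<lambda>x. f (F x)) \<in> borel_measurable (lebesgue_on U)"
    using fm measurable_image_has_jacobian[OF F U] by blast
  have a: "AE x in lebesgue_on U. \<bar>f (F x)\<bar> \<le> Lp_norm \<infinity> (F ` U) f"
    using AE_le_Lp_norm_infinity[OF f] AE_image_has_jacobian[OF F U, of "\<lambda>y. \<bar>f y\<bar> \<le> Lp_norm \<infinity> (F ` U) f"] by simp
  then have "AE x in lebesgue_on U. \<bar>f (F x)\<bar> \<le> Lp_norm \<infinity> U (\<lambda>x. f (F x))"
    using fm' by (intro AE_le_Lp_norm_infinity) (auto intro: Lp_space_infinityI)
  then have "AE y in lebesgue_on (F ` U). \<bar>f y\<bar> \<le> Lp_norm \<infinity> U (\<lambda>x. f (F x))"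
    using AE_image_has_jacobian[OF F U, of "\<lambda>y. \<bar>f y\<bar> \<le> Lp_norm \<infinity> U (\<lambda>x. f (F x))"] by simp
  then have "Lp_norm \<infinity> (F ` U) f \<le> Lp_norm \<infinity> U (\<lambda>x. f (F x))"
    using fm by (intro Lp_norm_infinity_le Lp_norm_nonneg)
  moreover have "Lp_norm \<infinity> U (\<lambda>x. f (F x)) \<le> Lp_norm \<infinity> (F ` U) f"
    using fm' a by (intro Lp_norm_infinity_le Lp_norm_nonneg)
  ultimately show ?thesis using 1 c by simp
next
  case (2 r)
  have c: "c > 0" using F by (simp add: has_jacobian_def)
  have "f \<in> borel_measurable (lebesgue_on (F ` U))" using f by (rule Lp_space_infinity_measurable)
  then have "(\<integral>x. \<bar>f x\<bar> powr r \<partial>lebesgue_on (F ` U)) = c * (\<integral>x. \<bar>f (F x)\<bar> powr r \<partial>lebesgue_on U)"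
    by (intro integral_image_has_jacobian(1)[OF F U]) measurable
  then show ?thesis using 2 c by (simp add: Lp_norm_finite powr_mult integral_nonneg_AE)
qed

lemma Lp_space_infinity_image_has_jacobian:
  assumes F: "has_jacobian F c" and U: "U \<in> sets lebesgue"
  shows "f \<in> Lp_space \<infinity> (F ` U) \<longleftrightarrow> (\<lambda>x. f (F x)) \<in> Lp_space \<infinity> U"
  by (simp add: Lp_space_infinity_iff measurable_image_has_jacobian[OF assms] AE_image_has_jacobian[OF assms])

text \<open>For real exponents \<open>s \<le> r\<close> the factor
  \<open>\<bar>f x\<bar> powr (r - s)\<close> is bounded by \<open>M powr (r - s)\<close>, which
  leaves the integral of the s-th power. Finiteness of \<open>q\<close> keeps the denominator
  \<open>recip q\<close> away from 0.\<close>

lemma Lp_norm_interpolation: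
  assumes f: "f \<in> Lp_space \<infinity> U" and U: "U \<in> lmeasurable" and q: "1 \<le> q" "q \<le> p" "q \<noteq> \<infinity>"
    and M: "AE x in lebesgue_on U. \<bar>f x\<bar> \<le> M" "M \<ge> 0"
  shows "Lp_norm p U f \<le> M powr (1 - recip p / recip q) * Lp_norm q U f powr (recip p / recip q)"
proof -
  have p: "1 \<le> p" using q by auto
  obtain s where s: "s \<ge> 1" "q = ennreal s" "recip q = 1/s"
    using q by (auto elim: ennreal_exponent_cases)
  show ?thesis using p
  proof (cases rule: ennreal_exponent_cases)
    case 1
    show ?thesis
    \<comment> \<open>For \<open>p = \<infinity>\<close> the q-norm carries the exponent 0. As
      \<open>0 powr 0 = 0\<close>, the right side vanishes together with that norm, and the left
      side must be shown to vanish as well.\<close>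
    proof (cases "Lp_norm q U f = 0")
      case True
      then have "Lp_norm p U f = 0" using Lp_norm_eq_0_iff[OF f U] p q by blast
      then show ?thesis by simp
    next
      case False
      have "Lp_norm \<infinity> U f \<le> M" using f M by (intro Lp_norm_infinity_le Lp_space_infinity_measurable)
      then show ?thesis using 1 False M(2) by simp
    qed
  next
    case (2 r)
    have sr: "s \<le> r" using q 2 s by simp
    have pq: "recip p / recip q = s / r" using 2(4) s(3) by simp
    let ?I = "\<integral>x. \<bar>f x\<bar> powr s \<partial>lebesgue_on U"
    have I0: "?I \<ge> 0" by (rule integral_nonneg_AE) auto
    have "(\<integral>x. \<bar>f x\<bar> powr r \<partial>lebesgue_on U) \<le> (\<integral>x. M powr (r - s) * \<bar>f x\<bar> powr s \<partial>lebesgue_on U)"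
    proof (rule integral_mono_AE)
      show "AE x in lebesgue_on U. \<bar>f x\<bar> powr r \<le> M powr (r - s) * \<bar>f x\<bar> powr s"
        using M(1)
      proof eventually_elim
        case (elim x)
        have "\<bar>f x\<bar> powr r = \<bar>f x\<bar> powr (r - s) * \<bar>f x\<bar> powr s" by (simp flip: powr_add)
        also have "\<dots> \<le> M powr (r - s) * \<bar>f x\<bar> powr s" using elim sr by (intro mult_right_mono powr_mono2) auto
        finally show ?case .
      qed
    qed (use f U 2 s in \<open>auto intro!: integrable_powr_Lp_space_infinity\<close>)
    also have "\<dots> = M powr (r - s) * ?I" by simp
    finally have "(\<integral>x. \<bar>f x\<bar> powr r \<partial>lebesgue_on U) powr (1/r) \<le> (M powr (r - s) * ?I) powr (1/r)"
      using 2 by (intro powr_mono2) (auto intro: integral_nonneg_AE)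
    also have "\<dots> = M powr ((r - s)/r) * ?I powr (1/r)"
      using I0 by (simp add: powr_mult powr_powr)
    also have "(r - s)/r = 1 - recip p / recip q" using 2 using s(3) by (simp add: diff_divide_distrib)
    also have "?I powr (1/r) = Lp_norm q U f powr (recip p / recip q)"
      using 2 s by (simp add: Lp_norm_finite powr_powr pq)
    finally show ?thesis using 2 by (simp add: Lp_norm_finite)
  qed
qed

section \<open>Smooth functions and test functions\<close>

lemma iter_partial_append: "iter_partial (xs @ ys) f = iter_partial xs (iter_partial ys f)"
  by (induction xs) auto

text \<open>Smoothness is the largest class of differentiable functions stable under partial
  derivatives, so it suffices to exhibit some stable class containing \<open>f\<close>.\<close>

lemma smooth_coinduct:
  assumes "f \<in> S" "\<And>g. g \<in> S \<Longrightarrow> g differentiable_on UNIV" "\<And>g i. g \<in> S \<Longrightarrow> partial_deriv i g \<in> S"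
  shows "smooth f"
proof -
  have "iter_partial is f \<in> S" for "is" by (induction "is") (auto intro: assms)
  then show ?thesis by (auto simp: smooth_def intro: assms(2))
qed

lemma smooth_iter_partial: "smooth f \<Longrightarrow> smooth (iter_partial is f)"
  unfolding smooth_def by (metis iter_partial_append)

lemma smooth_partial_deriv: "smooth f \<Longrightarrow> smooth (partial_deriv i f)"
  using smooth_iter_partial[of f "[i]"] by simp

lemma smooth_differentiable: "smooth f \<Longrightarrow> f differentiable (at x)"
  unfolding smooth_def differentiable_on_def by (metis UNIV_I iter_partial.simps(1))

lemma smooth_continuous_on: "smooth f \<Longrightarrow> continuous_on A f"
  by (meson continuous_at_imp_continuous_on differentiable_imp_continuous_within smooth_differentiable)

lemma smooth_borel_measurable: "smooth f \<Longrightarrow> f \<in> borel_measurable borel"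
  by (intro borel_measurable_continuous_onI smooth_continuous_on)

lemma partial_deriv_eq: "(f has_derivative D) (at x) \<Longrightarrow> partial_deriv i f x = D (axis i 1)"
  by (simp add: partial_deriv_def frechet_derivative_at[symmetric])

lemma has_derivative_partial_deriv:
  fixes f :: "real ^ 'd::finite \<Rightarrow> real"
  assumes "f differentiable (at x)"
  shows "(f has_derivative (\<lambda>h. \<Sum>i\<in>UNIV. h $ i * partial_deriv i f x)) (at x)"
proof -
  let ?D = "frechet_derivative f (at x)"
  have D: "(f has_derivative ?D) (at x)" using assms by (simp add: frechet_derivative_works)
  then have lin: "linear ?D" by (rule has_derivative_linear)
  have "?D h = (\<Sum>i\<in>UNIV. h $ i * partial_deriv i f x)" for h
  proof -
    have "?D (\<Sum>i\<in>UNIV. h $ i *\<^sub>R axis i 1) = (\<Sum>i\<in>UNIV. h $ i *\<^sub>R ?D (axis i 1))"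
      by (simp add: linear_sum[OF lin] linear_cmul[OF lin])
    then show ?thesis
      using basis_expansion[of h] by (simp add: scalar_mult_eq_scaleR partial_deriv_def)
  qed
  then have "?D = (\<lambda>h. \<Sum>i\<in>UNIV. h $ i * partial_deriv i f x)" by (rule ext)
  with D show ?thesis by simp
qed

lemma partial_deriv_line:
  fixes f :: "real ^ 'd::finite \<Rightarrow> real"
  assumes "\<And>x. f differentiable (at x)"
  shows "((\<lambda>s. f (x + s *\<^sub>R axis i 1)) has_real_derivative partial_deriv i f (x + s *\<^sub>R axis i 1)) (at s)"
proof -
  let ?D = "frechet_derivative f (at (x + s *\<^sub>R axis i 1))"
  have "(f has_derivative ?D) (at (x + s *\<^sub>R axis i 1))"
    using assms by (simp add: frechet_derivative_works[symmetric])
  moreover have "((\<lambda>s. x + s *\<^sub>R axis i 1) has_derivative (\<lambda>h. h *\<^sub>R axis i 1)) (at s)"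
    by (auto intro!: derivative_eq_intros)
  ultimately have "((\<lambda>s. f (x + s *\<^sub>R axis i 1)) has_derivative (\<lambda>h. ?D (h *\<^sub>R axis i 1))) (at s)"
    using has_derivative_compose by blast
  moreover have "(\<lambda>h. ?D (h *\<^sub>R axis i 1)) = (\<lambda>h. h * partial_deriv i f (x + s *\<^sub>R axis i 1))"
    using linear_cmul[OF has_derivative_linear[OF \<open>(f has_derivative ?D) _\<close>]]
    by (simp add: partial_deriv_def fun_eq_iff)
  ultimately show ?thesis by (simp add: has_field_derivative_def mult_commute_abs)
qed

lemma partial_deriv_add:
  assumes "f differentiable (at x)" "g differentiable (at x)"
  shows "partial_deriv i (\<lambda>x. f x + g x) x = partial_deriv i f x + partial_deriv i g x"
  using has_derivative_add[OF assms[unfolded frechet_derivative_works]]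
  by (simp add: partial_deriv_eq) (simp add: partial_deriv_def)

lemma partial_deriv_mult:
  fixes f g :: "real ^ 'd::finite \<Rightarrow> real"
  assumes "f differentiable (at x)" "g differentiable (at x)"
  shows "partial_deriv i (\<lambda>x. f x * g x) x = partial_deriv i f x * g x + f x * partial_deriv i g x"
  using has_derivative_mult[OF assms[unfolded frechet_derivative_works]]
  by (simp add: partial_deriv_eq) (simp add: partial_deriv_def)

lemma partial_deriv_const [simp]: "partial_deriv i (\<lambda>x. c) x = 0"
  by (rule partial_deriv_eq[of _ "\<lambda>_. 0", simplified]) auto

lemma partial_deriv_cmult:
  fixes f :: "real ^ 'd::finite \<Rightarrow> real"
  assumes "f differentiable (at x)"
  shows "partial_deriv i (\<lambda>x. c * f x) x = c * partial_deriv i f x"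
  using partial_deriv_mult[of "\<lambda>_. c" x f i] assms by simp

lemma partial_deriv_affine:
  fixes f :: "real ^ 'd::finite \<Rightarrow> real"
  assumes "f differentiable (at (affine_map J b x))"
  shows "(\<lambda>x. f (affine_map J b x)) differentiable (at x)"
    and "partial_deriv i (\<lambda>x. f (affine_map J b x)) x
     = (\<Sum>j\<in>UNIV. J $ j $ i * partial_deriv j f (affine_map J b x))"
proof -
  have "(affine_map J b has_derivative (\<lambda>h. J *v h)) (at x)"
    unfolding affine_map_def by (auto intro!: derivative_eq_intros bounded_linear_imp_has_derivative)
  from has_derivative_compose[OF this has_derivative_partial_deriv[OF assms]]
  have *: "((\<lambda>x. f (affine_map J b x)) has_derivative
     (\<lambda>h. \<Sum>j\<in>UNIV. (J *v h) $ j * partial_deriv j f (affine_map J b x))) (at x)" .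
  then show "(\<lambda>x. f (affine_map J b x)) differentiable (at x)" by (auto simp: differentiable_def)
  show "partial_deriv i (\<lambda>x. f (affine_map J b x)) x
     = (\<Sum>j\<in>UNIV. J $ j $ i * partial_deriv j f (affine_map J b x))"
    by (simp add: partial_deriv_eq[OF *] matrix_vector_mul_component inner_axis)
qed

text \<open>The chain rule turns a derivative of a pullback into a combination of pullbacks, not
  into a single one; closing under sums makes the class stable, as coinduction requires.\<close>

inductive_set affine_pullbacks :: "real ^ 'd ^ 'd \<Rightarrow> real ^ 'd \<Rightarrow> (real ^ 'd::finite \<Rightarrow> real) set" for J b where
  "smooth f \<Longrightarrow> (\<lambda>x. c * f (affine_map J b x)) \<in> affine_pullbacks J b"
| "f \<in> affine_pullbacks J b \<Longrightarrow> g \<in> affine_pullbacks J b \<Longrightarrow> (\<lambda>x. f x + g x) \<in> affine_pullbacks J b"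

lemma smooth_affine:
  fixes f :: "real ^ 'd::finite \<Rightarrow> real"
  assumes "smooth f"
  shows "smooth (\<lambda>x. f (affine_map J b x))"
proof (rule smooth_coinduct[of _ "affine_pullbacks J b"])
  show "(\<lambda>x. f (affine_map J b x)) \<in> affine_pullbacks J b"
    using affine_pullbacks.intros(1)[OF assms, of 1] by simp
  have sum: "(\<lambda>x. \<Sum>i\<in>I. g i x) \<in> affine_pullbacks J b"
    if "\<And>i. i \<in> I \<Longrightarrow> g i \<in> affine_pullbacks J b" "finite I" for I :: "'d set" and g
    using that(2,1)
  proof (induction I)
    case empty
    then show ?case using affine_pullbacks.intros(1)[OF assms, of 0] by simp
  next
    case (insert i I)
    then show ?case using affine_pullbacks.intros(2)[of "g i" J b "\<lambda>x. \<Sum>i\<in>I. g i x"] by simp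
  qed
  have dif: "g differentiable (at x)" if "g \<in> affine_pullbacks J b" for g x
    using that
  proof (induction arbitrary: x)
    case (1 f c)
    then show ?case by (intro differentiable_mult differentiable_const partial_deriv_affine(1) smooth_differentiable)
  qed (rule differentiable_add)
  show "g differentiable_on UNIV" if "g \<in> affine_pullbacks J b" for g
    using dif[OF that] by (simp add: differentiable_on_def)
  show "partial_deriv i g \<in> affine_pullbacks J b" if "g \<in> affine_pullbacks J b" for g i
    using that
  proof induction
    case (1 f c)
    have "partial_deriv i (\<lambda>x. c * f (affine_map J b x))
       = (\<lambda>x. \<Sum>j\<in>UNIV. (c * J $ j $ i) * partial_deriv j f (affine_map J b x))"
      using 1 by (auto simp: fun_eq_iff partial_deriv_cmult partial_deriv_affine smooth_differentiable
        sum_distrib_left mult.assoc)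
    also have "\<dots> \<in> affine_pullbacks J b"
      by (intro sum affine_pullbacks.intros(1) smooth_partial_deriv 1) auto
    finally show ?case .
  next
    case (2 f g)
    have "partial_deriv i (\<lambda>x. f x + g x) = (\<lambda>x. partial_deriv i f x + partial_deriv i g x)"
      using 2 dif by (auto simp: fun_eq_iff partial_deriv_add)
    then show ?case using 2 by (auto intro: affine_pullbacks.intros(2))
  qed
qed

text \<open>Both mixed second difference quotients below agree with a mixed derivative at a nearby point.\<close>

lemma smooth_mixed_difference:
  fixes f :: "real ^ 'd::finite \<Rightarrow> real"
  assumes f: "smooth f" and h: "h > 0"
  shows "\<exists>y. dist y x \<le> 2 * h \<and>
    f (x + h *\<^sub>R axis i 1 + h *\<^sub>R axis j 1) - f (x + h *\<^sub>R axis i 1) - (f (x + h *\<^sub>R axis j 1) - f x)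
      = h * h * partial_deriv j (partial_deriv i f) y"
proof -
  let ?u = "\<lambda>s. f (x + h *\<^sub>R axis j 1 + s *\<^sub>R axis i 1) - f (x + s *\<^sub>R axis i 1)"
  have "\<exists>s. 0 < s \<and> s < h \<and> ?u h - ?u 0 = (h - 0) * (partial_deriv i f (x + h *\<^sub>R axis j 1 + s *\<^sub>R axis i 1)
      - partial_deriv i f (x + s *\<^sub>R axis i 1))"
    using h by (intro MVT2) (auto intro!: DERIV_diff partial_deriv_line smooth_differentiable f)
  then obtain s where s: "0 < s" "s < h" "?u h - ?u 0 = h * (partial_deriv i f (x + h *\<^sub>R axis j 1 + s *\<^sub>R axis i 1)
      - partial_deriv i f (x + s *\<^sub>R axis i 1))" by auto
  let ?z = "x + s *\<^sub>R axis i 1"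
  have "\<exists>t. 0 < t \<and> t < h \<and> partial_deriv i f (?z + h *\<^sub>R axis j 1) - partial_deriv i f (?z + 0 *\<^sub>R axis j 1)
     = (h - 0) * partial_deriv j (partial_deriv i f) (?z + t *\<^sub>R axis j 1)"
    using h by (intro MVT2) (auto intro!: partial_deriv_line smooth_differentiable smooth_partial_deriv f)
  then obtain t where t: "0 < t" "t < h" "partial_deriv i f (?z + h *\<^sub>R axis j 1) - partial_deriv i f ?z
     = h * partial_deriv j (partial_deriv i f) (?z + t *\<^sub>R axis j 1)" by auto
  have "norm (s *\<^sub>R axis i 1 + t *\<^sub>R axis j 1 :: real ^ 'd) \<le> \<bar>s\<bar> + \<bar>t\<bar>"
    by (rule order_trans[OF norm_triangle_ineq]) (simp add: norm_axis_1)
  then have "dist (?z + t *\<^sub>R axis j 1) x \<le> 2 * h"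
    using s t by (simp add: dist_norm add.assoc)
  moreover have "f (x + h *\<^sub>R axis i 1 + h *\<^sub>R axis j 1) - f (x + h *\<^sub>R axis i 1) - (f (x + h *\<^sub>R axis j 1) - f x)
      = h * h * partial_deriv j (partial_deriv i f) (?z + t *\<^sub>R axis j 1)"
    using s(3) t(3) by (simp add: add_ac)
  ultimately show ?thesis by blast
qed

lemma smooth_partial_deriv_commute:
  fixes f :: "real ^ 'd::finite \<Rightarrow> real"
  assumes f: "smooth f"
  shows "partial_deriv i (partial_deriv j f) = partial_deriv j (partial_deriv i f)"
proof
  fix x
  define h where "h n = 1 / real (Suc n)" for n
  have h: "h n > 0" for n by (simp add: h_def)
  have h0: "h \<longlonglongrightarrow> 0"
    using LIMSEQ_inverse_real_of_nat by (simp add: h_def[abs_def] inverse_eq_divide)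
  have "\<forall>n. \<exists>y. dist y x \<le> 2 * h n \<and>
     f (x + h n *\<^sub>R axis i 1 + h n *\<^sub>R axis j 1) - f (x + h n *\<^sub>R axis i 1) - (f (x + h n *\<^sub>R axis j 1) - f x)
      = h n * h n * partial_deriv j (partial_deriv i f) y"
    by (intro allI smooth_mixed_difference f h)
  from choice[OF this] obtain y where y: "\<And>n. dist (y n) x \<le> 2 * h n"
    "\<And>n. f (x + h n *\<^sub>R axis i 1 + h n *\<^sub>R axis j 1) - f (x + h n *\<^sub>R axis i 1) - (f (x + h n *\<^sub>R axis j 1) - f x)
      = h n * h n * partial_deriv j (partial_deriv i f) (y n)"
    by blast
  have "\<forall>n. \<exists>z. dist z x \<le> 2 * h n \<and>
     f (x + h n *\<^sub>R axis j 1 + h n *\<^sub>R axis i 1) - f (x + h n *\<^sub>R axis j 1) - (f (x + h n *\<^sub>R axis i 1) - f x)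
      = h n * h n * partial_deriv i (partial_deriv j f) z"
    by (intro allI smooth_mixed_difference f h)
  from choice[OF this] obtain z where z: "\<And>n. dist (z n) x \<le> 2 * h n"
    "\<And>n. f (x + h n *\<^sub>R axis j 1 + h n *\<^sub>R axis i 1) - f (x + h n *\<^sub>R axis j 1) - (f (x + h n *\<^sub>R axis i 1) - f x)
      = h n * h n * partial_deriv i (partial_deriv j f) (z n)"
    by blast
  have h2: "(\<lambda>n. 2 * h n) \<longlonglongrightarrow> 0" using tendsto_mult_right_zero[OF h0] .
  have lim: "w \<longlonglongrightarrow> x" if "\<And>n. dist (w n) x \<le> 2 * h n" for w
    unfolding tendsto_dist_iff[of w] using that by (intro tendsto_sandwich[OF _ _ tendsto_const h2]) auto
  have cont: "(\<lambda>n. g (w n)) \<longlonglongrightarrow> g x" if "smooth g" "w \<longlonglongrightarrow> x" for g :: "real ^ 'd \<Rightarrow> real" and w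
    by (rule isCont_tendsto_compose[OF differentiable_imp_continuous_within[OF smooth_differentiable[OF that(1)]] that(2)])
  have eq: "partial_deriv j (partial_deriv i f) (y n) = partial_deriv i (partial_deriv j f) (z n)" for n
  proof -
    \<comment> \<open>The mixed difference does not change when \<open>i\<close> and
      \<open>j\<close> are exchanged, so both mixed derivatives take the same value at their
      respective nearby points.\<close>
    have "f (x + h n *\<^sub>R axis j 1 + h n *\<^sub>R axis i 1) = f (x + h n *\<^sub>R axis i 1 + h n *\<^sub>R axis j 1)"
      by (simp add: add_ac)
    then have "h n * h n * partial_deriv j (partial_deriv i f) (y n)
      = h n * h n * partial_deriv i (partial_deriv j f) (z n)"
      using y(2)[of n] z(2)[of n] by linarith
    then show ?thesis using h[of n] by simp
  qed
  have "(\<lambda>n. partial_deriv j (partial_deriv i f) (y n)) \<longlonglongrightarrow> partial_deriv j (partial_deriv i f) x"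
    by (intro cont lim y smooth_partial_deriv f)
  moreover have "(\<lambda>n. partial_deriv i (partial_deriv j f) (z n)) \<longlonglongrightarrow> partial_deriv i (partial_deriv j f) x"
    by (intro cont lim z smooth_partial_deriv f)
  ultimately show "partial_deriv i (partial_deriv j f) x = partial_deriv j (partial_deriv i f) x"
    unfolding eq using LIMSEQ_unique by blast
qed

lemma iter_partial_partial_deriv:
  assumes "smooth f"
  shows "iter_partial is (partial_deriv i f) = partial_deriv i (iter_partial is f)"
proof (induction "is")
  case (Cons j js)
  then show ?case
    using smooth_partial_deriv_commute[OF smooth_iter_partial[OF assms, of js], of j i] by simp
qed simp

section \<open>Stability of test functions under derivatives and affine maps\<close>

lemma test_functionD:
  assumes "\<phi> \<in> test_functions U"
  shows "smooth \<phi>" "\<exists>K. compact K \<and> K \<subseteq> U \<and> (\<forall>x. x \<notin> K \<longrightarrow> \<phi> x = 0)" "\<exists>B. \<forall>x. \<bar>\<phi> x\<bar> \<le> B"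
proof -
  let ?K = "closure {x. \<phi> x \<noteq> 0}"
  show s: "smooth \<phi>" using assms by (simp add: test_functions_def)
  have K: "compact ?K" "?K \<subseteq> U" using assms by (auto simp: test_functions_def)
  moreover have z: "\<forall>x. x \<notin> ?K \<longrightarrow> \<phi> x = 0" using closure_subset[of "{x. \<phi> x \<noteq> 0}"] by auto
  ultimately show "\<exists>K. compact K \<and> K \<subseteq> U \<and> (\<forall>x. x \<notin> K \<longrightarrow> \<phi> x = 0)" by blast
  have "bounded (\<phi> ` ?K)"
    by (intro compact_imp_bounded compact_continuous_image smooth_continuous_on s K)
  then obtain B where B: "\<And>x. x \<in> ?K \<Longrightarrow> \<bar>\<phi> x\<bar> \<le> B" by (auto simp: bounded_iff)
  have "\<bar>\<phi> x\<bar> \<le> max B 0" for x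
  proof (cases "x \<in> ?K")
    case True
    from B[OF this] show ?thesis by (rule max.coboundedI1)
  next
    case False
    then have "\<phi> x = 0" using z by blast
    then show ?thesis by simp
  qed
  then show "\<exists>B. \<forall>x. \<bar>\<phi> x\<bar> \<le> B" by blast
qed

lemma test_function_partial_deriv:
  assumes "\<phi> \<in> test_functions U"
  shows "partial_deriv i \<phi> \<in> test_functions U"
proof -
  let ?K = "closure {x. \<phi> x \<noteq> 0}"
  have "partial_deriv i \<phi> x = 0" if "x \<notin> ?K" for x
  proof -
    have "(\<phi> has_derivative (\<lambda>h. 0)) (at x)"
    proof (rule has_derivative_transform_within_open[of "\<lambda>_. 0"])
      show "x \<in> - ?K" "open (- ?K)" using that by auto
      show "0 = \<phi> y" if "y \<in> - ?K" for y using that closure_subset[of "{x. \<phi> x \<noteq> 0}"] by auto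
    qed simp
    then show ?thesis by (simp add: partial_deriv_eq)
  qed
  then have "closure {x. partial_deriv i \<phi> x \<noteq> 0} \<subseteq> ?K" by (intro closure_minimal) auto
  moreover have "compact ?K" "?K \<subseteq> U" "smooth \<phi>" using assms by (auto simp: test_functions_def)
  moreover from calculation have "compact (closure {x. partial_deriv i \<phi> x \<noteq> 0})"
    by (meson bounded_subset closed_closure compact_eq_bounded_closed)
  ultimately show ?thesis
    by (auto simp: test_functions_def smooth_partial_deriv)
qed

lemma test_function_iter_partial: "\<phi> \<in> test_functions U \<Longrightarrow> iter_partial is \<phi> \<in> test_functions U"
  by (induction "is") (auto intro: test_function_partial_deriv)

lemma matrix_inv_mult:
  assumes "invertible A"
  shows "A ** matrix_inv A = mat 1" "matrix_inv A ** A = mat 1"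
  using someI_ex[OF assms[unfolded invertible_def]] by (auto simp: matrix_inv_def)

lemma matrix_inv_vector_mult:
  fixes J :: "real ^ 'd ^ 'd"
  assumes "invertible J"
  shows "matrix_inv J *v (J *v x) = x" "J *v (matrix_inv J *v x) = x"
  using matrix_inv_mult[OF assms] by (simp_all add: matrix_vector_mul_assoc)

lemma affine_map_bij:
  fixes J :: "real ^ 'd ^ 'd"
  assumes "invertible J"
  shows "bij (affine_map J b)" "inv (affine_map J b) = (\<lambda>y. matrix_inv J *v (y - b))"
proof -
  note JJ = matrix_inv_vector_mult[OF assms]
  show "inv (affine_map J b) = (\<lambda>y. matrix_inv J *v (y - b))"
    by (rule inv_equality) (auto simp: affine_map_def JJ)
  show "bij (affine_map J b)"
    by (rule bij_betw_byWitness[where f'="\<lambda>y. matrix_inv J *v (y - b)"]) (auto simp: affine_map_def JJ)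
qed

lemma test_function_affine:
  fixes \<phi> :: "real ^ 'd::finite \<Rightarrow> real"
  assumes J: "invertible J" and \<phi>: "\<phi> \<in> test_functions (affine_map J b ` U)"
  shows "(\<lambda>x. \<phi> (affine_map J b x)) \<in> test_functions U"
proof -
  let ?F = "affine_map J b"
  let ?K = "closure {x. \<phi> x \<noteq> 0}"
  have K: "compact ?K" "?K \<subseteq> ?F ` U" "smooth \<phi>" using \<phi> by (auto simp: test_functions_def)
  have bij: "bij ?F" by (rule affine_map_bij[OF J])
  have img: "?F -` ?K = inv ?F ` ?K" using bij by (simp add: bij_vimage_eq_inv_image)
  have "continuous_on ?K (inv ?F)"
    unfolding affine_map_bij(2)[OF J] by (intro continuous_intros matrix_vector_mult_linear_continuous_on
        linear_continuous_on_compose[OF _ matrix_vector_mul_linear])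
  then have c: "compact (?F -` ?K)" unfolding img by (rule compact_continuous_image[OF _ K(1)])
  have "{x. \<phi> (?F x) \<noteq> 0} \<subseteq> ?F -` ?K"
    using closure_subset[of "{x. \<phi> x \<noteq> 0}"] by auto
  then have cl: "closure {x. \<phi> (?F x) \<noteq> 0} \<subseteq> ?F -` ?K"
    using c by (intro closure_minimal compact_imp_closed)
  have "?F -` ?K \<subseteq> U" using K(2) bij by (auto dest!: bij_is_inj dest: injD)
  moreover have "compact (closure {x. \<phi> (?F x) \<noteq> 0})"
    using cl c by (meson bounded_subset closed_closure compact_eq_bounded_closed)
  ultimately show ?thesis using cl K(3) by (auto simp: test_functions_def smooth_affine)
qed

section \<open>Explicit test functions supported on boxes\<close>

definition bump :: "real poly \<Rightarrow> real \<Rightarrow> real" where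
  "bump p t = (if t > 0 then poly p (1 / t) * exp (- (1 / t)) else 0)"

lemma tendsto_poly_times_exp_minus: "((\<lambda>x. poly p x * exp (- x)) \<longlongrightarrow> (0::real)) at_top"
proof -
  have "((\<lambda>x. \<Sum>i\<le>degree p. coeff p i * (x ^ i / exp x)) \<longlongrightarrow> (\<Sum>i\<le>degree p. coeff p i * 0)) at_top"
    by (intro tendsto_sum tendsto_mult tendsto_const tendsto_power_div_exp_0)
  moreover have "poly p x * exp (- x) = (\<Sum>i\<le>degree p. coeff p i * (x ^ i / exp x))" for x
    by (simp add: poly_altdef sum_distrib_right exp_minus divide_inverse mult.assoc)
  ultimately show ?thesis by simp
qed

text \<open>\<open>[:0, 0, 1:]\<close> is the polynomial X^2. Differentiating
  \<open>p(1/t) exp(-1/t)\<close> gives \<open>(1/t)^2 (p - p')(1/t) exp(-1/t)\<close>, so carrying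
  a polynomial parameter in \<open>bump\<close> makes the family closed under
  differentiation.\<close>

lemma has_derivative_bump:
  "(bump p has_real_derivative bump ([:0, 0, 1:] * (p - pderiv p)) t) (at t)"
proof -
  consider "t > 0" | "t < 0" | "t = 0" by linarith
  then show ?thesis
  proof cases
    case 1
    have "((\<lambda>t. poly p (1 / t) * exp (- (1 / t))) has_real_derivative
        bump ([:0, 0, 1:] * (p - pderiv p)) t) (at t)"
      using 1 by (auto intro!: derivative_eq_intros DERIV_chain2[OF poly_DERIV]
        simp: bump_def field_simps power2_eq_square)
    then show ?thesis
      by (rule has_field_derivative_transform_within_open[of _ _ _ "{0<..}"]) (use 1 in \<open>auto simp: bump_def\<close>)
  next
    case 2
    have "((\<lambda>t. 0) has_real_derivative bump ([:0, 0, 1:] * (p - pderiv p)) t) (at t)"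
      using 2 by (simp add: bump_def)
    then show ?thesis
      by (rule has_field_derivative_transform_within_open[of _ _ _ "{..<0}"]) (use 2 in \<open>auto simp: bump_def\<close>)
  next
    case 3
    have "((\<lambda>y. bump p y / y) \<longlongrightarrow> 0) (at 0)"
    proof (rule filterlim_split_at)
      show "((\<lambda>y. bump p y / y) \<longlongrightarrow> 0) (at_left 0)"
        by (rule tendsto_eventually) (auto simp: eventually_at_filter bump_def)
      \<comment> \<open>The extra \<open>1/y\<close> of the difference quotient is absorbed into the
        polynomial \<open>pCons 0 p\<close>, and exponential decay beats every polynomial in
        \<open>1/y\<close>.\<close>
      have "((\<lambda>y. poly (pCons 0 p) (inverse y) * exp (- inverse y)) \<longlongrightarrow> 0) (at_right 0)"
        by (rule filterlim_compose[OF tendsto_poly_times_exp_minus filterlim_inverse_at_top_right])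
      then show "((\<lambda>y. bump p y / y) \<longlongrightarrow> 0) (at_right 0)"
        by (rule Lim_transform_eventually)
          (auto simp: eventually_at_filter bump_def divide_inverse mult_ac)
    qed
    then show ?thesis using 3 by (simp add: has_field_derivative_iff bump_def)
  qed
qed

text \<open>The algebra generated by one-dimensional bumps in affine functions of single
  coordinates. It is stable under partial derivatives, so products over all coordinates are smooth
  by coinduction.\<close>

inductive_set bump_functions :: "(real ^ 'd::finite \<Rightarrow> real) set" where
  bump: "(\<lambda>x. bump p (a * x $ i + c)) \<in> bump_functions"
| const: "(\<lambda>x. c) \<in> bump_functions"
| add: "f \<in> bump_functions \<Longrightarrow> g \<in> bump_functions \<Longrightarrow> (\<lambda>x. f x + g x) \<in> bump_functions"
| mult: "f \<in> bump_functions \<Longrightarrow> g \<in> bump_functions \<Longrightarrow> (\<lambda>x. f x * g x) \<in> bump_functions"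

lemma has_derivative_bump_coordinate:
  "((\<lambda>x. bump p (a * x $ i + c)) has_derivative
    (\<lambda>h. h $ i * (a * bump ([:0, 0, 1:] * (p - pderiv p)) (a * x $ i + c)))) (at x)"
proof -
  have "((\<lambda>x. a * x $ i + c) has_derivative (\<lambda>h. a * h $ i)) (at x)"
    by (auto intro!: derivative_eq_intros bounded_linear_imp_has_derivative bounded_linear_vec_nth)
  from has_derivative_compose[OF this has_derivative_bump[unfolded has_field_derivative_def]]
  show ?thesis by (simp add: mult_ac)
qed

lemma smooth_bump_functions:
  assumes "f \<in> bump_functions"
  shows "smooth f"
proof (rule smooth_coinduct[OF assms])
  have dif: "g differentiable (at x)" if "g \<in> bump_functions" for g :: "real ^ 'a \<Rightarrow> real" and x
    using that
  proof (induction arbitrary: x)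
    case (bump p a i c)
    show ?case using has_derivative_bump_coordinate unfolding differentiable_def by blast
  qed (auto intro: derivative_intros)
  show "g differentiable_on UNIV" if "g \<in> bump_functions" for g :: "real ^ 'a \<Rightarrow> real"
    using dif[OF that] by (simp add: differentiable_on_def)
  show "partial_deriv j g \<in> bump_functions" if "g \<in> bump_functions" for g :: "real ^ 'a \<Rightarrow> real" and j
    using that
  proof induction
    case (bump p a i c)
    let ?q = "[:0, 0, 1:] * (p - pderiv p)"
    have "partial_deriv j (\<lambda>x::real ^ 'a. bump p (a * x $ i + c))
       = (\<lambda>x. (if i = j then a else 0) * bump ?q (a * x $ i + c))"
      by (rule ext, subst partial_deriv_eq[OF has_derivative_bump_coordinate]) (auto simp: axis_def)
    also have "\<dots> \<in> bump_functions"
      by (intro bump_functions.intros)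
    finally show ?case .
  next
    case (const c)
    then show ?case using bump_functions.const[of 0] by (simp add: partial_deriv_const[abs_def])
  next
    case (add f g)
    have "partial_deriv j (\<lambda>x. f x + g x) = (\<lambda>x. partial_deriv j f x + partial_deriv j g x)"
      using add dif by (auto simp: fun_eq_iff partial_deriv_add)
    then show ?case using add by (auto intro: bump_functions.intros)
  next
    case (mult f g)
    have "partial_deriv j (\<lambda>x. f x * g x) = (\<lambda>x. partial_deriv j f x * g x + f x * partial_deriv j g x)"
      using mult dif by (auto simp: fun_eq_iff partial_deriv_mult)
    then show ?case using mult by (auto intro: bump_functions.intros)
  qed
qed

text \<open>For every positive \<open>n\<close> the nonzero set is the open box; a larger
  \<open>n\<close> only steepens the edges, because \<open>exp(-1/(n t))\<close> tends to 1 for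
  \<open>t > 0\<close>.\<close>

definition box_bump :: "real ^ 'd \<Rightarrow> real ^ 'd \<Rightarrow> nat \<Rightarrow> real ^ 'd::finite \<Rightarrow> real" where
  "box_bump a b n x = (\<Prod>i\<in>UNIV. bump 1 (real n * (x $ i - a $ i)) * bump 1 (real n * (b $ i - x $ i)))"

lemma bump_1_bounds: "0 \<le> bump 1 t" "bump 1 t \<le> 1" "bump 1 t = 0 \<longleftrightarrow> t \<le> 0"
  by (auto simp: bump_def)

lemma box_bump_bounds: "0 \<le> box_bump a b n x" "box_bump a b n x \<le> 1"
  unfolding box_bump_def
  by (auto intro!: prod_nonneg prod_le_1 mult_nonneg_nonneg mult_le_one simp: bump_1_bounds)

lemma box_bump_eq_0_iff: "n > 0 \<Longrightarrow> box_bump a b n x = 0 \<longleftrightarrow> x \<notin> box a b"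
  by (auto simp: box_bump_def bump_1_bounds mem_box_cart mult_le_0_iff not_less)

lemma box_bump_test_function:
  fixes a b :: "real ^ 'd::finite"
  assumes "cbox a b \<subseteq> U" "n > 0"
  shows "box_bump a b n \<in> test_functions U"
proof -
  have "(\<lambda>x. \<Prod>i\<in>I. bump 1 (s * x $ i + c i) * bump 1 (t * x $ i + e i)) \<in> bump_functions"
    if "finite I" for I :: "'d set" and s t c e
    using that
  proof (induction I)
    case (insert i I)
    have "(\<lambda>x. (bump 1 (s * x $ i + c i) * bump 1 (t * x $ i + e i))
        * (\<Prod>i\<in>I. bump 1 (s * x $ i + c i) * bump 1 (t * x $ i + e i))) \<in> bump_functions"
      by (intro bump_functions.mult bump_functions.bump insert.IH)
    then show ?case using insert.hyps by simp
  qed (simp add: bump_functions.const)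
  from this[of UNIV "real n" "\<lambda>i. - real n * a $ i" "- real n" "\<lambda>i. real n * b $ i"] have "box_bump a b n \<in> bump_functions"
    by (simp add: box_bump_def[abs_def] algebra_simps)
  then have "smooth (box_bump a b n)" by (rule smooth_bump_functions)
  moreover have "{x. box_bump a b n x \<noteq> 0} = box a b" using assms by (auto simp: box_bump_eq_0_iff)
  moreover have "closure (box a b) \<subseteq> cbox a b" by (rule closure_minimal) (auto simp: box_subset_cbox)
  moreover from this have "compact (closure (box a b))"
    by (meson bounded_box bounded_closure closed_closure compact_eq_bounded_closed)
  ultimately show ?thesis using assms by (auto simp: test_functions_def)
qed

lemma box_bump_tendsto: "(\<lambda>n. box_bump a b (Suc n) x) \<longlonglongrightarrow> indicator (box a b) x"
proof (cases "x \<in> box a b")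
  case True
  have *: "(\<lambda>n. bump 1 (real (Suc n) * t)) \<longlonglongrightarrow> 1" if "t > 0" for t
  proof -
    have "(\<lambda>n. exp (- (inverse (real (Suc n)) * (1 / t)))) \<longlonglongrightarrow> exp (- (0 * (1/t)))"
      by (intro tendsto_exp tendsto_minus tendsto_mult_right LIMSEQ_inverse_real_of_nat)
    moreover have "bump 1 (real (Suc n) * t) = exp (- (inverse (real (Suc n)) * (1 / t)))" for n
    proof -
      have "0 < real (Suc n) * t" using that by (intro mult_pos_pos) auto
      then show ?thesis by (simp add: bump_def inverse_eq_divide del: of_nat_Suc)
    qed
    ultimately show ?thesis by simp
  qed
  have "(\<lambda>n. box_bump a b (Suc n) x) \<longlonglongrightarrow> (\<Prod>i\<in>(UNIV :: 'a set). 1 * 1)"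
    unfolding box_bump_def using True by (intro tendsto_prod tendsto_mult *) (auto simp: mem_box_cart)
  then show ?thesis using True by simp
next
  case False
  then have "box_bump a b (Suc n) x = 0" for n by (simp add: box_bump_eq_0_iff)
  then show ?thesis using False by simp
qed

section \<open>The fundamental lemma of the calculus of variations\<close>

lemma integral_lebesgue_on_supported:
  fixes f \<phi> :: "'a::euclidean_space \<Rightarrow> real"
  assumes "K \<subseteq> U" "U \<in> sets lebesgue" "\<And>x. x \<notin> K \<Longrightarrow> \<phi> x = 0"
  shows "(\<integral>x. f x * \<phi> x \<partial>lebesgue_on U) = (\<integral>x. indicator K x * f x * \<phi> x \<partial>lebesgue)"
proof -
  have "(\<integral>x. f x * \<phi> x \<partial>lebesgue_on U) = (\<integral>x. indicator U x *\<^sub>R (f x * \<phi> x) \<partial>lebesgue)"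
    using assms by (intro integral_restrict_space) auto
  also have "(\<lambda>x. indicator U x *\<^sub>R (f x * \<phi> x)) = (\<lambda>x. indicator K x * f x * \<phi> x)"
    using assms by (auto simp: fun_eq_iff indicator_def)
  finally show ?thesis .
qed

lemma absolutely_integrable_indicator:
  "f absolutely_integrable_on K \<longleftrightarrow> integrable lebesgue (\<lambda>x. indicator K x * f x :: real)"
  by (simp add: set_integrable_def)

text \<open>Open boxes are an intersection-stable generator of the Borel sets, so vanishing
  integrals extend to all Borel sets, and these determine a density.\<close>

lemma AE_zero_if_box_integrals_zero:
  fixes w :: "'a::euclidean_space \<Rightarrow> real"
  assumes w: "integrable lebesgue w" and zero: "\<And>a b. (\<integral>x. indicator (box a b) x * w x \<partial>lebesgue) = 0"
  shows "AE x in lebesgue. w x = 0"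
proof -
  let ?P = "\<lambda>A. (\<integral>x. indicator A x * w x \<partial>lebesgue) = 0"
  have int: "integrable lebesgue (\<lambda>x. indicator A x * w x)" if "A \<in> sets borel" for A
    using integrable_mult_indicator[OF _ w, of A] that by simp
  \<comment> \<open>\<open>w\<close> may change sign, so passing to increasing unions is dominated
    convergence with bound \<open>\<bar>w\<bar>\<close> instead of monotone convergence.\<close>
  have lim: "?P (\<Union>(range A))" if A: "\<And>n. A n \<in> sets borel" "incseq A" "\<And>n. ?P (A n)" for A :: "nat \<Rightarrow> 'a set"
  proof -
    have "(\<lambda>n. \<integral>x. indicator (A n) x * w x \<partial>lebesgue) \<longlonglongrightarrow> (\<integral>x. indicator (\<Union>(range A)) x * w x \<partial>lebesgue)"
    proof (rule integral_dominated_convergence[where w="\<lambda>x. \<bar>w x\<bar>"])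
      show "AE x in lebesgue. (\<lambda>n. indicator (A n) x * w x) \<longlonglongrightarrow> indicator (\<Union> (range A)) x * w x"
        using LIMSEQ_indicator_incseq[OF A(2)] by (intro AE_I2 tendsto_mult tendsto_const) auto
      show "AE x in lebesgue. norm (indicator (A n) x * w x) \<le> \<bar>w x\<bar>" for n
        by (auto simp: indicator_def)
    qed (use A w int sets.countable_UN[of A UNIV borel] in auto)
    then show ?thesis using A(3) by (simp add: LIMSEQ_const_iff)
  qed
  have univ: "?P UNIV"
  proof -
    let ?A = "\<lambda>n::nat. box (- (real n *\<^sub>R One)) (real n *\<^sub>R One) :: 'a set"
    have "incseq ?A"
      by (rule incseq_SucI) (auto simp: box_def inner_simps)
    then have "?P (\<Union>(range ?A))" using zero by (intro lim) auto
    then show ?thesis unfolding UN_box_eq_UNIV .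
  qed
  have P: "?P A" if "A \<in> sets borel" for A
  proof -
    let ?E = "range (\<lambda>(a, b). box a b::'a set)"
    have "Int_stable ?E" "?E \<subseteq> Pow UNIV" by (auto simp: Int_stable_def box_Int_box)
    moreover have "A \<in> sigma_sets UNIV ?E" using that by (simp add: borel_eq_box)
    ultimately show ?thesis
    proof (induction rule: sigma_sets_induct_disjoint)
      case (basic A)
      then show ?case using zero by auto
    next
      case empty
      then show ?case by simp
    next
      case (compl A)
      have A: "A \<in> sets borel" using compl by (simp add: borel_eq_box)
      have "(\<lambda>x. indicator (UNIV - A) x * w x) = (\<lambda>x. indicator UNIV x * w x - indicator A x * w x)"
        by (auto simp: fun_eq_iff indicator_def)
      then show ?case using compl univ int[OF A] int[of UNIV] by simp
    next
      case (union A)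
      have A: "A n \<in> sets borel" for n using union by (auto simp: borel_eq_box)
      have "(\<integral>x. indicator (\<Union>n<N. A n) x * w x \<partial>lebesgue) = 0" for N
      proof (induction N)
        case (Suc N)
        have "A N \<inter> A n = {}" if "n < N" for n
          using union(1) that unfolding disjoint_family_on_def by (metis UNIV_I less_irrefl)
        then have "A N \<inter> (\<Union>n<N. A n) = {}" by blast
        then have eq: "(\<lambda>x. indicator (\<Union>n<Suc N. A n) x * w x) = (\<lambda>x. indicator (A N) x * w x + indicator (\<Union>n<N. A n) x * w x)"
          by (auto simp: fun_eq_iff indicator_def lessThan_Suc)
        have "(\<Union>n<N. A n) \<in> sets borel" using A by auto
        from int[OF this] int[OF A[of N]] show ?case
          unfolding eq using Suc union(3)[of N] by (simp only: Bochner_Integration.integral_add)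
      qed simp
      moreover have "incseq (\<lambda>N. \<Union>n<N. A n)"
        unfolding incseq_def by (intro allI impI UN_mono) auto
      ultimately have "?P (\<Union>N. \<Union>n<N. A n)" using A by (intro lim) auto
      moreover have "(\<Union>N. \<Union>n<N. A n) = \<Union>(range A)" by blast
      ultimately show ?case by simp
    qed
  qed
  \<comment> \<open>\<open>w\<close> is only Lebesgue measurable; uniqueness of densities is applied
    to a Borel version of it.\<close>
  obtain v where v: "v \<in> borel_measurable lborel" "AE x in lborel. w x = v x"
    using w completion_ex_borel_measurable_real[of w lborel] by auto
  have AE: "AE x in lebesgue. w x = v x" using v(2) by (rule AE_completion)
  have vl: "v \<in> borel_measurable lebesgue" using v(1) by (rule measurable_completion)
  have intv: "integrable lborel v"
    using w AE v vl integrable_cong_AE[of w lebesgue v] integrable_completion[of v lborel] by auto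
  have "AE x in lborel. v x = 0"
  proof (rule density_unique_real[OF intv])
    fix A :: "'a set" assume A: "A \<in> sets lborel"
    have "(\<integral>x. indicator A x * v x \<partial>lborel) = (\<integral>x. indicator A x * v x \<partial>lebesgue)"
      using A v(1) by (intro integral_completion[symmetric]) auto
    also have "\<dots> = (\<integral>x. indicator A x * w x \<partial>lebesgue)"
      using A vl borel_measurable_integrable[OF w] AE
      by (intro integral_cong_AE borel_measurable_times borel_measurable_indicator) auto
    also have "\<dots> = 0" using P A by simp
    finally show "(LINT x:A|lborel. v x) = (LINT x:A|lborel. 0)" by (simp add: set_lebesgue_integral_def)
  qed simp
  then have "AE x in lebesgue. v x = 0" by (rule AE_completion)
  with AE show ?thesis by eventually_elim simp
qed

text \<open>Box bumps tend to the indicator of a box whose closed version lies in \<open>U\<close>,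
  which makes the integrals over such boxes vanish; countably many of them exhaust
  \<open>U\<close>.\<close>

lemma AE_zero_if_test_integrals_zero:
  fixes w :: "real ^ 'd::finite \<Rightarrow> real"
  assumes U: "open U" and w: "\<And>K. compact K \<Longrightarrow> K \<subseteq> U \<Longrightarrow> w absolutely_integrable_on K"
    and zero: "\<And>\<phi>. \<phi> \<in> test_functions U \<Longrightarrow> (\<integral>x. w x * \<phi> x \<partial>lebesgue_on U) = 0"
  shows "AE x in lebesgue_on U. w x = 0"
proof -
  have Us: "U \<in> sets lebesgue" using U by auto
  have box0: "(\<integral>x. indicator (box a b) x * w x \<partial>lebesgue) = 0" if ab: "cbox a b \<subseteq> U" for a b
  proof -
    have int: "integrable lebesgue (\<lambda>x. indicator (cbox a b) x * w x)"
      using w[of "cbox a b"] ab by (simp add: absolutely_integrable_indicator)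
    have "(\<lambda>n. \<integral>x. indicator (cbox a b) x * w x * box_bump a b (Suc n) x \<partial>lebesgue)
       \<longlonglongrightarrow> (\<integral>x. indicator (cbox a b) x * w x * indicator (box a b) x \<partial>lebesgue)"
    proof (rule integral_dominated_convergence[where w="\<lambda>x. \<bar>indicator (cbox a b) x * w x\<bar>"])
      show "AE x in lebesgue. (\<lambda>n. indicator (cbox a b) x * w x * box_bump a b (Suc n) x)
          \<longlonglongrightarrow> indicator (cbox a b) x * w x * indicator (box a b) x"
        by (intro AE_I2 tendsto_mult tendsto_const box_bump_tendsto)
      show "AE x in lebesgue. norm (indicator (cbox a b) x * w x * box_bump a b (Suc n) x) \<le> \<bar>indicator (cbox a b) x * w x\<bar>" for n
        using box_bump_bounds[of a b "Suc n"] by (intro AE_I2) (simp add: abs_mult mult_left_le)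
      have "box_bump a b (Suc n) \<in> borel_measurable borel" for n
        using box_bump_test_function[OF ab, of "Suc n"] by (auto dest: test_functionD(1) intro: smooth_borel_measurable)
      then have "box_bump a b (Suc n) \<in> borel_measurable lebesgue" for n
        by (simp add: measurable_completion)
      then show "(\<lambda>x. indicator (cbox a b) x * w x * box_bump a b (Suc n) x) \<in> borel_measurable lebesgue" for n
        using int by (intro borel_measurable_times[OF borel_measurable_integrable[OF int]])
      show "(\<lambda>x. indicator (cbox a b) x * w x * indicator (box a b) x) \<in> borel_measurable lebesgue"
        by (intro borel_measurable_times[OF borel_measurable_integrable[OF int]] borel_measurable_indicator) auto
    qed (use int in auto)
    moreover have "(\<integral>x. indicator (cbox a b) x * w x * box_bump a b (Suc n) x \<partial>lebesgue) = 0" for n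
    proof -
      have "box_bump a b (Suc n) x = 0" if "x \<notin> cbox a b" for x
        using that box_subset_cbox[of a b] by (subst box_bump_eq_0_iff) auto
      then show ?thesis
        using zero[OF box_bump_test_function[OF ab, of "Suc n"]] integral_lebesgue_on_supported[OF ab Us] by auto
    qed
    ultimately have "(\<integral>x. indicator (cbox a b) x * w x * indicator (box a b) x \<partial>lebesgue) = 0"
      by (simp add: LIMSEQ_const_iff)
    moreover have "indicator (cbox a b) x * w x * indicator (box a b) x = indicator (box a b) x * w x" for x
      using box_subset_cbox[of a b] by (auto simp: indicator_def)
    ultimately show ?thesis by simp
  qed
  have AE_box: "AE x in lebesgue. x \<in> box a b \<longrightarrow> w x = 0" if ab: "cbox a b \<subseteq> U" for a b
  proof -
    have "AE x in lebesgue. indicator (box a b) x * w x = 0"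
    proof (rule AE_zero_if_box_integrals_zero)
      have "integrable lebesgue (\<lambda>x. indicator (box a b) x *\<^sub>R (indicator (cbox a b) x * w x))"
        using w[of "cbox a b"] ab by (intro integrable_mult_indicator) (auto simp: absolutely_integrable_indicator)
      moreover have "(\<lambda>x. indicator (box a b) x *\<^sub>R (indicator (cbox a b) x * w x)) = (\<lambda>x. indicator (box a b) x * w x)"
        using box_subset_cbox[of a b] by (auto simp: fun_eq_iff indicator_def)
      ultimately show "integrable lebesgue (\<lambda>x. indicator (box a b) x * w x)" by simp
      fix c d :: "real ^ 'd"
      obtain a' b' where e: "box c d \<inter> box a b = box a' b'"
        using box_Int_box[of c d a b] by blast
      have "(\<integral>x. indicator (box a' b') x * w x \<partial>lebesgue) = 0"
      \<comment> \<open>An empty open box says nothing about \<open>cbox a' b'\<close>, which need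
        not stay in \<open>U\<close>, so this case is separated.\<close>
      proof (cases "box a' b' = {}")
        case False
        have "box a' b' \<subseteq> cbox a b" using e box_subset_cbox[of a b] by blast
        then have "cbox a' b' \<subseteq> cbox a b"
          using False closure_minimal[of "box a' b'" "cbox a b"] by (simp add: closure_box closed_cbox)
        then show ?thesis using ab by (intro box0) auto
      qed simp
      moreover have "(\<lambda>x. indicator (box c d) x * (indicator (box a b) x * w x)) = (\<lambda>x. indicator (box a' b') x * w x)"
        unfolding e[symmetric] by (auto simp: fun_eq_iff indicator_def)
      ultimately show "(\<integral>x. indicator (box c d) x * (indicator (box a b) x * w x) \<partial>lebesgue) = 0"
        by (simp only:)
    qed
    then show ?thesis by eventually_elim (auto simp: indicator_def split: if_splits)
  qed
  obtain D where D: "countable D" "D \<subseteq> Pow U" "\<And>X. X \<in> D \<Longrightarrow> \<exists>a b. X = cbox a b" "\<Union>D = U"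
    using open_countable_Union_open_cbox[OF U] by blast
  have "AE x in lebesgue. x \<in> X \<longrightarrow> w x = 0" if X: "X \<in> D" for X
  proof -
    obtain a b where ab: "X = cbox a b" using D(3)[OF X] by blast
    \<comment> \<open>The previous step only reaches the open box; the faces of the closed one form
      a null set.\<close>
    have "AE x in lebesgue. x \<notin> cbox a b - box a b"
      by (intro AE_not_in) (simp add: negligible_frontier_interval flip: negligible_iff_null_sets)
    moreover have "AE x in lebesgue. x \<in> box a b \<longrightarrow> w x = 0" using X D(2) ab by (intro AE_box) auto
    ultimately show ?thesis by eventually_elim (auto simp: ab)
  qed
  then have "AE x in lebesgue. \<forall>X\<in>D. x \<in> X \<longrightarrow> w x = 0"
    by (subst AE_ball_countable[OF D(1)]) blast
  then have "AE x in lebesgue. x \<in> U \<longrightarrow> w x = 0"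
    by (rule eventually_mono) (use D(4) in blast)
  then show ?thesis using Us by (simp add: AE_restrict_space_iff)
qed

section \<open>Weak derivatives\<close>

lemma absolutely_integrable_iff_lebesgue_on:
  "K \<in> sets lebesgue \<Longrightarrow> f absolutely_integrable_on K \<longleftrightarrow> integrable (lebesgue_on K) (f :: 'a::euclidean_space \<Rightarrow> real)"
  by (simp add: set_integrable_def integrable_restrict_space)

text \<open>A weak derivative is only known to be integrable on compact subsets. Cutting it off
  along a compact exhaustion of \<open>U\<close> gives measurable functions that converge to it
  pointwise.\<close>

lemma locally_integrable_measurable:
  fixes w :: "'a::euclidean_space \<Rightarrow> real"
  assumes U: "open U" and w: "\<And>K. compact K \<Longrightarrow> K \<subseteq> U \<Longrightarrow> w absolutely_integrable_on K"
  shows "w \<in> borel_measurable (lebesgue_on U)"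
proof -
  obtain C where C: "\<And>n. compact (C n)" "\<And>n. C n \<subseteq> U" "\<And>n. C n \<subseteq> interior (C (Suc n))" "\<Union>(range C) = U"
    by (rule open_Union_compact_subsets[OF U]) blast
  have "incseq C" using C(3) interior_subset by (intro incseq_SucI) blast
  show ?thesis
  proof (rule borel_measurable_LIMSEQ_real[where u="\<lambda>n x. indicator (C n) x * w x"])
    fix x assume "x \<in> space (lebesgue_on U)"
    then have "x \<in> \<Union>(range C)" using C(4) by simp
    moreover have "(\<lambda>n. indicat_real (C n) x) \<longlonglongrightarrow> indicator (\<Union>(range C)) x"
      by (rule LIMSEQ_indicator_incseq[OF \<open>incseq C\<close>])
    ultimately have "(\<lambda>n. indicat_real (C n) x * w x) \<longlonglongrightarrow> 1 * w x"
      by (intro tendsto_mult tendsto_const) simp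
    then show "(\<lambda>n. indicat_real (C n) x * w x) \<longlonglongrightarrow> w x" by simp
  next
    fix n
    have "integrable lebesgue (\<lambda>x. indicator (C n) x * w x)"
      using w[OF C(1,2)] by (simp add: absolutely_integrable_indicator)
    then show "(\<lambda>x. indicator (C n) x * w x) \<in> borel_measurable (lebesgue_on U)"
      by (intro measurable_restrict_space1) auto
  qed
qed

lemma weak_derivD:
  assumes "weak_deriv U \<alpha> u w"
  shows "\<And>K. compact K \<Longrightarrow> K \<subseteq> U \<Longrightarrow> u absolutely_integrable_on K"
    and "\<And>K. compact K \<Longrightarrow> K \<subseteq> U \<Longrightarrow> w absolutely_integrable_on K"
    and "\<And>\<phi> is. \<phi> \<in> test_functions U \<Longrightarrow> count_list is = \<alpha> \<Longrightarrow>
       (\<integral>x. u x * iter_partial is \<phi> x \<partial>lebesgue_on U) =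
       (-1) ^ mi_order \<alpha> * (\<integral>x. w x * \<phi> x \<partial>lebesgue_on U)"
  using assms by (auto simp: weak_deriv_def)

lemma integrable_times_test_function:
  fixes w :: "real ^ 'd::finite \<Rightarrow> real"
  assumes U: "open U" and w: "\<And>K. compact K \<Longrightarrow> K \<subseteq> U \<Longrightarrow> w absolutely_integrable_on K"
    and \<phi>: "\<phi> \<in> test_functions U"
  shows "integrable (lebesgue_on U) (\<lambda>x. w x * \<phi> x)"
proof -
  obtain K where K: "compact K" "K \<subseteq> U" "\<And>x. x \<notin> K \<Longrightarrow> \<phi> x = 0" using test_functionD(2)[OF \<phi>] by auto
  obtain B where B: "\<And>x. \<bar>\<phi> x\<bar> \<le> B" using test_functionD(3)[OF \<phi>] by auto
  have int: "integrable lebesgue (\<lambda>x. indicator K x * w x)"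
    using w[OF K(1,2)] by (simp add: absolutely_integrable_indicator)
  have "\<phi> \<in> borel_measurable borel" using test_functionD(1)[OF \<phi>] by (rule smooth_borel_measurable)
  then have m: "\<phi> \<in> borel_measurable lebesgue" by (simp add: measurable_completion)
  have "integrable lebesgue (\<lambda>x. (indicator K x * w x) * \<phi> x)"
  proof (rule Bochner_Integration.integrable_bound)
    show "integrable lebesgue (\<lambda>x. B * (indicator K x * w x))" using int by simp
    show "(\<lambda>x. indicator K x * w x * \<phi> x) \<in> borel_measurable lebesgue"
      by (rule borel_measurable_times[OF borel_measurable_integrable[OF int] m])
    have "B \<ge> 0" using B[of undefined] by linarith
    then show "AE x in lebesgue. norm (indicator K x * w x * \<phi> x) \<le> norm (B * (indicator K x * w x))"
      using B by (intro AE_I2) (auto simp: abs_mult mult.commute[of _ "\<phi> _"] intro!: mult_right_mono)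
  qed
  moreover have "(\<lambda>x. (indicator K x * w x) * \<phi> x) = (\<lambda>x. indicator U x *\<^sub>R (w x * \<phi> x))"
    using K by (auto simp: fun_eq_iff indicator_def)
  ultimately show ?thesis using U by (simp add: integrable_restrict_space)
qed

text \<open>Makes the quantifier over lists in \<open>weak_deriv\<close> non-vacuous and lets
  inductions over lists reach every multi-index.\<close>

lemma exists_list_with_counts: "\<exists>is. count_list is = (\<alpha> :: 'd::finite \<Rightarrow> nat)"
proof (induction "mi_order \<alpha>" arbitrary: \<alpha>)
  case 0
  then have "\<alpha> = (\<lambda>_. 0)" by (auto simp: mi_order_def)
  then show ?case by (intro exI[of _ "[]"]) auto
next
  case (Suc n)
  then obtain i where i: "\<alpha> i > 0"
    by (metis mi_order_def Zero_not_Suc gr0I sum.neutral)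
  have "mi_order \<alpha> = \<alpha> i + (\<Sum>j\<in>UNIV - {i}. \<alpha> j)"
    unfolding mi_order_def by (rule sum.remove) auto
  moreover have "mi_order (\<alpha>(i := \<alpha> i - 1)) = (\<alpha> i - 1) + (\<Sum>j\<in>UNIV - {i}. \<alpha> j)"
    unfolding mi_order_def by (subst sum.remove[of _ i]) auto
  ultimately have "n = mi_order (\<alpha>(i := \<alpha> i - 1))" using Suc(2) i by linarith
  from Suc(1)[OF this] obtain "is" where "count_list is = \<alpha>(i := \<alpha> i - 1)" by blast
  then have "count_list (i # is) = \<alpha>" using i by (auto simp: fun_eq_iff)
  then show ?case by blast
qed

lemma mi_order_count_list: "mi_order (count_list is) = length (is :: 'd::finite list)"
  unfolding mi_order_def by (rule sum_count_set) auto

text \<open>Testing leaves the integral of a null function, so the fundamental lemma applies.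
  Besides uniqueness, this supplies the kernel condition for bounding a derivative by the function
  itself in finite dimension.\<close>

lemma weak_deriv_AE_zero:
  fixes U :: "(real ^ 'd::finite) set"
  assumes U: "open U" and wd: "weak_deriv U \<alpha> u w" and 0: "AE x in lebesgue_on U. u x = 0"
  shows "AE x in lebesgue_on U. w x = 0"
proof (rule AE_zero_if_test_integrals_zero[OF U])
  show "w absolutely_integrable_on K" if "compact K" "K \<subseteq> U" for K
    using weak_derivD(2)[OF wd] that .
  fix \<phi> assume \<phi>: "\<phi> \<in> test_functions U"
  obtain "is" where i: "count_list is = \<alpha>" using exists_list_with_counts by blast
  have "(\<integral>x. u x * iter_partial is \<phi> x \<partial>lebesgue_on U) = 0"
    using 0 by (intro integral_eq_zero_AE) auto
  then show "(\<integral>x. w x * \<phi> x \<partial>lebesgue_on U) = 0" using weak_derivD(3)[OF wd \<phi> i] by simp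
qed

lemma weak_deriv_cmult:
  assumes "weak_deriv U \<alpha> u w"
  shows "weak_deriv U \<alpha> (\<lambda>x. c * u x) (\<lambda>x. c * w x)"
  using assms by (auto simp: weak_deriv_def mult.assoc intro: set_integrable_mult_right)

lemma weak_deriv_add:
  assumes U: "open U" and 1: "weak_deriv U \<alpha> u w" and 2: "weak_deriv U \<alpha> u' w'"
  shows "weak_deriv U \<alpha> (\<lambda>x. u x + u' x) (\<lambda>x. w x + w' x)"
  unfolding weak_deriv_def
proof (intro conjI ballI allI impI, goal_cases)
  case (3 \<phi> "is")
  note int = integrable_times_test_function[OF U]
  have t: "iter_partial is \<phi> \<in> test_functions U" using 3 by (intro test_function_iter_partial)
  show ?case
    using weak_derivD(3)[OF 1 3] weak_derivD(3)[OF 2 3]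
      int[OF weak_derivD(1)[OF 1] t] int[OF weak_derivD(1)[OF 2] t]
      int[OF weak_derivD(2)[OF 1] 3(1)] int[OF weak_derivD(2)[OF 2] 3(1)]
    by (simp add: distrib_right distrib_left)
qed (use weak_derivD[OF 1] weak_derivD[OF 2] in \<open>auto intro!: set_integral_add\<close>)

lemma weak_deriv_zero: "weak_deriv U \<alpha> (\<lambda>x. 0) (\<lambda>x. 0)"
  by (simp add: weak_deriv_def set_integrable_def)

lemma weak_deriv_sum:
  assumes "open U" "\<And>i. i \<in> I \<Longrightarrow> weak_deriv U \<alpha> (u i) (w i)"
  shows "weak_deriv U \<alpha> (\<lambda>x. \<Sum>i\<in>I. u i x) (\<lambda>x. \<Sum>i\<in>I. w i x)"
  using assms by (induction I rule: infinite_finite_induct) (auto intro: weak_deriv_add weak_deriv_zero)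

lemma weak_deriv_unique:
  fixes U :: "(real ^ 'd::finite) set"
  assumes U: "open U" and 1: "weak_deriv U \<alpha> u w" and 2: "weak_deriv U \<alpha> u w'"
  shows "AE x in lebesgue_on U. w x = w' x"
proof -
  have "weak_deriv U \<alpha> (\<lambda>x. u x + (-1) * u x) (\<lambda>x. w x + (-1) * w' x)"
    by (intro weak_deriv_add U 1 weak_deriv_cmult 2)
  then have "AE x in lebesgue_on U. w x + (-1) * w' x = 0" by (rule weak_deriv_AE_zero[OF U]) simp
  then show ?thesis by eventually_elim simp
qed

lemma weak_deriv_wderiv: "weak_deriv U \<alpha> u w \<Longrightarrow> weak_deriv U \<alpha> u (wderiv U \<alpha> u)"
  using someI[of "weak_deriv U \<alpha> u" w] by (simp add: wderiv_def)

lemma weak_deriv_cong: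
  assumes "weak_deriv U \<alpha> u w" "U \<in> sets lebesgue" "\<And>x. x \<in> U \<Longrightarrow> u x = u' x" "\<And>x. x \<in> U \<Longrightarrow> w x = w' x"
  shows "weak_deriv U \<alpha> u' w'"
proof -
  have 1: "u absolutely_integrable_on K \<longleftrightarrow> u' absolutely_integrable_on K"
    "w absolutely_integrable_on K \<longleftrightarrow> w' absolutely_integrable_on K" if "K \<subseteq> U" for K
    by (rule set_integrable_cong[OF refl refl], use that assms(3,4) in blast)+
  have 2: "(\<integral>x. u x * \<phi> x \<partial>lebesgue_on U) = (\<integral>x. u' x * \<phi> x \<partial>lebesgue_on U)"
    "(\<integral>x. w x * \<phi> x \<partial>lebesgue_on U) = (\<integral>x. w' x * \<phi> x \<partial>lebesgue_on U)" for \<phi>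
    using assms(3,4) by (auto intro!: Bochner_Integration.integral_cong)
  show ?thesis using assms(1) by (simp add: weak_deriv_def 1 2 cong: conj_cong)
qed

text \<open>A list with the counts of \<open>i # is\<close> may contain \<open>i\<close> at any
  position. Symmetry of mixed derivatives moves that entry next to the test function, which is then
  differentiated in direction \<open>i\<close> first.\<close>

lemma weak_deriv_Cons:
  fixes U :: "(real ^ 'd::finite) set"
  assumes 1: "weak_deriv U (count_list is) u w" and 2: "weak_deriv U (count_list [i]) w w'"
  shows "weak_deriv U (count_list (i # is)) u w'"
  unfolding weak_deriv_def
proof (intro conjI ballI allI impI, goal_cases)
  case (3 \<phi> js)
  have "i \<in> set js" using fun_cong[OF 3(2), of i] by (metis count_list_0_iff count_list.simps(2) add_is_0 one_neq_zero)
  then obtain xs ys where js: "js = xs @ i # ys" by (meson split_list)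
  have sm: "smooth \<phi>" using 3(1) by (rule test_functionD)
  have cnt: "count_list (xs @ ys) = count_list is"
  proof
    fix j show "count_list (xs @ ys) j = count_list is j"
      using fun_cong[OF 3(2), of j] by (simp add: js split: if_splits)
  qed
  have "iter_partial js \<phi> = iter_partial (xs @ ys) (partial_deriv i \<phi>)"
    by (simp add: js iter_partial_append flip: iter_partial_partial_deriv[OF sm])
  then have "(\<integral>x. u x * iter_partial js \<phi> x \<partial>lebesgue_on U)
    = (-1) ^ length is * (\<integral>x. w x * partial_deriv i \<phi> x \<partial>lebesgue_on U)"
    using weak_derivD(3)[OF 1 test_function_partial_deriv[OF 3(1)] cnt] by (simp add: mi_order_count_list)
  also have "(\<integral>x. w x * partial_deriv i \<phi> x \<partial>lebesgue_on U) = - (\<integral>x. w' x * \<phi> x \<partial>lebesgue_on U)"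
    using weak_derivD(3)[OF 2 3(1) refl] by (simp add: mi_order_count_list del: count_list.simps)
  finally show ?case by (simp add: mi_order_count_list del: count_list.simps)
qed (use weak_derivD[OF 1] weak_derivD[OF 2] in auto)

text \<open>Testing \<open>u\<close> with the list \<open>is @ [i]\<close> reads in two ways: as the
  full derivative against \<open>\<phi>\<close>, or as the derivative \<open>is\<close> against
  \<open>partial_deriv i \<phi>\<close>. This links the weak derivatives that membership in a
  Sobolev space provides separately for each multi-index.\<close>

lemma weak_deriv_Cons_imp:
  fixes U :: "(real ^ 'd::finite) set"
  assumes 1: "weak_deriv U (count_list is) u w" and 2: "weak_deriv U (count_list (i # is)) u w'"
  shows "weak_deriv U (count_list [i]) w w'"
  unfolding weak_deriv_def
proof (intro conjI ballI allI impI, goal_cases)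
  case (3 \<phi> js)
  have "length js = 1" using mi_order_count_list[of js] mi_order_count_list[of "[i]"] 3(2) by simp
  then obtain j where j: "js = [j]" by (auto simp: length_Suc_conv)
  then have js: "js = [i]" using fun_cong[OF 3(2), of i] by (auto split: if_splits)
  have "(\<integral>x. u x * iter_partial (is @ [i]) \<phi> x \<partial>lebesgue_on U)
     = - ((-1) ^ length is * (\<integral>x. w' x * \<phi> x \<partial>lebesgue_on U))"
    using weak_derivD(3)[OF 2 3(1), of "is @ [i]"]
    by (simp add: mi_order_count_list fun_eq_iff del: iter_partial.simps)
  moreover have "(\<integral>x. u x * iter_partial (is @ [i]) \<phi> x \<partial>lebesgue_on U)
     = (-1) ^ length is * (\<integral>x. w x * partial_deriv i \<phi> x \<partial>lebesgue_on U)"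
    using weak_derivD(3)[OF 1 test_function_partial_deriv[OF 3(1)] refl]
    by (simp add: mi_order_count_list iter_partial_append)
  ultimately have "(-1) ^ length is * (\<integral>x. w x * partial_deriv i \<phi> x \<partial>lebesgue_on U)
     = (-1) ^ length is * (- (\<integral>x. w' x * \<phi> x \<partial>lebesgue_on U))"
    by linarith
  then have "(\<integral>x. w x * partial_deriv i \<phi> x \<partial>lebesgue_on U) = - (\<integral>x. w' x * \<phi> x \<partial>lebesgue_on U)"
    by (rule mult_left_cancel[THEN iffD1, rotated]) simp
  then show ?case by (simp add: js mi_order_count_list del: count_list.simps)
qed (use weak_derivD[OF 1] weak_derivD[OF 2] in auto)

lemma weak_deriv_singletonI:
  fixes U :: "(real ^ 'd::finite) set"
  assumes "\<And>K. compact K \<Longrightarrow> K \<subseteq> U \<Longrightarrow> u absolutely_integrable_on K"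
    "\<And>K. compact K \<Longrightarrow> K \<subseteq> U \<Longrightarrow> w absolutely_integrable_on K"
    "\<And>\<phi>. \<phi> \<in> test_functions U \<Longrightarrow> (\<integral>x. u x * partial_deriv i \<phi> x \<partial>lebesgue_on U) = - (\<integral>x. w x * \<phi> x \<partial>lebesgue_on U)"
  shows "weak_deriv U (count_list [i]) u w"
  unfolding weak_deriv_def
proof (intro conjI ballI allI impI, goal_cases)
  case (3 \<phi> js)
  have "length js = 1" using mi_order_count_list[of js] mi_order_count_list[of "[i]"] 3(2) by simp
  then obtain j where j: "js = [j]" by (auto simp: length_Suc_conv)
  then have js: "js = [i]" using fun_cong[OF 3(2), of i] by (auto split: if_splits)
  then show ?case using assms(3)[OF 3(1)] by (simp add: mi_order_count_list del: count_list.simps)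
qed (use assms in auto)

text \<open>A weak derivative of order 0 is a change of representative, which gives chains of
  first-order derivatives a common starting point.\<close>

lemma weak_deriv_NilI:
  fixes U :: "(real ^ 'd::finite) set"
  assumes "\<And>K. compact K \<Longrightarrow> K \<subseteq> U \<Longrightarrow> u absolutely_integrable_on K"
    "\<And>K. compact K \<Longrightarrow> K \<subseteq> U \<Longrightarrow> w absolutely_integrable_on K"
    "\<And>\<phi>. \<phi> \<in> test_functions U \<Longrightarrow> (\<integral>x. u x * \<phi> x \<partial>lebesgue_on U) = (\<integral>x. w x * \<phi> x \<partial>lebesgue_on U)"
  shows "weak_deriv U (count_list []) u w"
  unfolding weak_deriv_def
proof (intro conjI ballI allI impI, goal_cases)
  case (3 \<phi> js)
  have "length js = length ([] :: 'd list)"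
    by (simp only: mi_order_count_list[symmetric] 3(2))
  then show ?case using assms(3)[OF 3(1)] by (simp add: mi_order_count_list del: count_list.simps)
qed (use assms in auto)

section \<open>Weak derivatives under affine maps\<close>

lemma affine_map_has_jacobian:
  fixes J :: "real ^ 'd::finite ^ 'd"
  assumes "invertible J"
  obtains c where "has_jacobian (affine_map J b) c"
proof -
  have "bij (\<lambda>x. J *v x)" using affine_map_bij(1)[OF assms, of 0] by (simp add: affine_map_def[abs_def])
  from has_jacobian_affine[OF matrix_vector_mul_linear this, of b] show ?thesis
    using that by (auto simp: affine_map_def[abs_def])
qed

lemma continuous_on_affine_map: "continuous_on A (affine_map J b)"
  unfolding affine_map_def by (intro continuous_intros linear_continuous_on_compose[OF _ matrix_vector_mul_linear])

lemma continuous_on_inv_affine_map: "invertible J \<Longrightarrow> continuous_on A (inv (affine_map J b))"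
  unfolding affine_map_bij(2) by (intro continuous_intros linear_continuous_on_compose[OF _ matrix_vector_mul_linear])

lemma open_image_affine_map:
  assumes "invertible J" "open U"
  shows "open (affine_map J b ` U)"
proof -
  have "affine_map J b ` U = inv (affine_map J b) -` U"
    using bij_vimage_eq_inv_image[OF bij_imp_bij_inv[OF affine_map_bij(1)[OF assms(1)]], of b U]
      inv_inv_eq[OF affine_map_bij(1)[OF assms(1), of b]] by simp
  then show ?thesis
    using open_vimage[OF assms(2) continuous_on_inv_affine_map[OF assms(1)]] by simp
qed

lemma locally_integrable_affine:
  fixes J :: "real ^ 'd::finite ^ 'd" and u :: "real ^ 'd \<Rightarrow> real"
  assumes J: "invertible J" and u: "\<And>K. compact K \<Longrightarrow> K \<subseteq> U \<Longrightarrow> u absolutely_integrable_on K"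
    and K: "compact K" "K \<subseteq> affine_map J b ` U"
  shows "(\<lambda>y. u (inv (affine_map J b) y)) absolutely_integrable_on K"
proof -
  let ?F = "affine_map J b"
  obtain c where c: "has_jacobian ?F c" using affine_map_has_jacobian[OF J] .
  have bij: "bij ?F" by (rule affine_map_bij(1)[OF J])
  let ?L = "inv ?F ` K"
  have FL: "?F ` ?L = K" using bij by (simp add: image_image bij_is_surj surj_f_inv_f)
  have L: "compact ?L" "?L \<subseteq> U"
    using K bij by (auto intro!: compact_continuous_image continuous_on_inv_affine_map J simp: bij_is_inj)
  have Ls: "?L \<in> sets lebesgue" using L(1) by (simp add: lmeasurable_compact fmeasurableD)
  have int: "integrable (lebesgue_on ?L) u"
    by (rule absolutely_integrable_iff_lebesgue_on[OF Ls, THEN iffD1, OF u[OF L]])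
  let ?v = "\<lambda>y. u (inv ?F y)"
  have eq: "(\<lambda>x. ?v (?F x)) = u" using inv_f_f[OF bij_is_inj[OF bij]] by (simp only:)
  have "?v \<in> borel_measurable (lebesgue_on (?F ` ?L))"
    by (rule measurable_image_has_jacobian[OF c Ls, THEN iffD2])
      (simp only: eq borel_measurable_integrable[OF int])
  from integral_image_has_jacobian(2)[OF c Ls this, THEN iffD2]
  have "integrable (lebesgue_on K) ?v" using int by (simp only: eq FL)
  then show ?thesis
    using K(1) by (subst absolutely_integrable_iff_lebesgue_on) (auto intro: lmeasurable_compact fmeasurableD)
qed

lemma integral_affine:
  fixes J :: "real ^ 'd::finite ^ 'd"
  assumes c: "has_jacobian (affine_map J b) c" and J: "invertible J" and U: "open U"
    and u: "\<And>K. compact K \<Longrightarrow> K \<subseteq> U \<Longrightarrow> u absolutely_integrable_on K"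
    and \<phi>: "\<phi> \<in> test_functions (affine_map J b ` U)"
  shows "(\<integral>y. u (inv (affine_map J b) y) * \<phi> y \<partial>lebesgue_on (affine_map J b ` U))
    = c * (\<integral>x. u x * \<phi> (affine_map J b x) \<partial>lebesgue_on U)"
proof -
  let ?F = "affine_map J b"
  have bij: "bij ?F" by (rule affine_map_bij(1)[OF J])
  have "integrable (lebesgue_on (?F ` U)) (\<lambda>y. u (inv ?F y) * \<phi> y)"
    by (intro integrable_times_test_function open_image_affine_map locally_integrable_affine[OF J u] J U \<phi>)
  then have "(\<integral>y. u (inv ?F y) * \<phi> y \<partial>lebesgue_on (?F ` U)) = c * (\<integral>x. u (inv ?F (?F x)) * \<phi> (?F x) \<partial>lebesgue_on U)"
    using U by (intro integral_image_has_jacobian(1)[OF c]) auto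
  then show ?thesis using bij by (simp add: bij_is_inj)
qed

lemma weak_deriv_Nil_affine:
  fixes J :: "real ^ 'd::finite ^ 'd"
  assumes J: "invertible J" and U: "open U" and wd: "weak_deriv U (count_list []) u w"
  shows "weak_deriv (affine_map J b ` U) (count_list [])
    (\<lambda>y. u (inv (affine_map J b) y)) (\<lambda>y. w (inv (affine_map J b) y))"
proof (rule weak_deriv_NilI)
  let ?F = "affine_map J b"
  show "(\<lambda>y. u (inv ?F y)) absolutely_integrable_on K" "(\<lambda>y. w (inv ?F y)) absolutely_integrable_on K"
    if "compact K" "K \<subseteq> ?F ` U" for K
    using that by (auto intro!: locally_integrable_affine[OF J] weak_derivD[OF wd])
  fix \<phi> assume \<phi>: "\<phi> \<in> test_functions (?F ` U)"
  obtain c where c: "has_jacobian ?F c" using affine_map_has_jacobian[OF J] .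
  show "(\<integral>y. u (inv ?F y) * \<phi> y \<partial>lebesgue_on (?F ` U)) = (\<integral>y. w (inv ?F y) * \<phi> y \<partial>lebesgue_on (?F ` U))"
    using weak_derivD(3)[OF wd test_function_affine[OF J \<phi>], of "[]"]
      integral_affine[OF c J U weak_derivD(1)[OF wd] \<phi>] integral_affine[OF c J U weak_derivD(2)[OF wd] \<phi>]
    by (simp add: mi_order_def)
qed

text \<open>The derivative sits on the test function, which is smooth, so the classical chain rule
  for \<open>\<phi>\<close> composed with the affine map suffices.\<close>

lemma weak_deriv_affine:
  fixes J :: "real ^ 'd::finite ^ 'd"
  assumes J: "invertible J" and U: "open U" and wd: "\<And>j. weak_deriv U (count_list [j]) u (g j)"
  shows "weak_deriv (affine_map J b ` U) (count_list [i]) (\<lambda>y. u (inv (affine_map J b) y))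
    (\<lambda>y. \<Sum>j\<in>UNIV. matrix_inv J $ j $ i * g j (inv (affine_map J b) y))"
proof (rule weak_deriv_singletonI)
  let ?F = "affine_map J b"
  let ?A = "matrix_inv J"
  obtain c where c: "has_jacobian ?F c" using affine_map_has_jacobian[OF J] .
  show "(\<lambda>y. u (inv ?F y)) absolutely_integrable_on K"
    if "compact K" "K \<subseteq> ?F ` U" for K
    using that by (auto intro!: locally_integrable_affine[OF J] weak_derivD[OF wd])
  have lin: "(\<lambda>x. \<Sum>j\<in>UNIV. ?A $ j $ i * g j x) absolutely_integrable_on K" if "compact K" "K \<subseteq> U" for K
    using weak_derivD(2)[OF wd that] by (intro absolutely_integrable_sum) (auto intro: set_integrable_mult_right)
  show "(\<lambda>y. \<Sum>j\<in>UNIV. ?A $ j $ i * g j (inv ?F y)) absolutely_integrable_on K"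
    if "compact K" "K \<subseteq> ?F ` U" for K
    using that by (intro locally_integrable_affine[OF J lin])
  fix \<phi> assume \<phi>: "\<phi> \<in> test_functions (?F ` U)"
  let ?\<psi> = "\<lambda>x. \<phi> (?F x)"
  have \<psi>: "?\<psi> \<in> test_functions U" by (rule test_function_affine[OF J \<phi>])
  have d\<phi>: "partial_deriv i \<phi> \<in> test_functions (?F ` U)" by (rule test_function_partial_deriv[OF \<phi>])
  \<comment> \<open>The chain rule expresses derivatives of the pullback through those of
    \<open>\<phi>\<close>; multiplying by the inverse matrix solves for the latter, since
    \<open>J ** matrix_inv J\<close> is the identity.\<close>
  have chain: "partial_deriv i \<phi> (?F x) = (\<Sum>j\<in>UNIV. ?A $ j $ i * partial_deriv j ?\<psi> x)" for x
  proof -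
    have "(\<Sum>j\<in>UNIV. ?A $ j $ i * partial_deriv j ?\<psi> x)
      = (\<Sum>j\<in>UNIV. \<Sum>k\<in>UNIV. (J $ k $ j * ?A $ j $ i) * partial_deriv k \<phi> (?F x))"
      using test_functionD(1)[OF \<phi>]
      by (simp add: partial_deriv_affine smooth_differentiable sum_distrib_left mult_ac)
    also have "\<dots> = (\<Sum>k\<in>UNIV. (\<Sum>j\<in>UNIV. J $ k $ j * ?A $ j $ i) * partial_deriv k \<phi> (?F x))"
      by (subst sum.swap) (simp add: sum_distrib_right)
    also have "\<dots> = (\<Sum>k\<in>UNIV. (J ** ?A) $ k $ i * partial_deriv k \<phi> (?F x))"
      by (simp add: matrix_matrix_mult_def)
    also have "\<dots> = (\<Sum>k\<in>UNIV. if k = i then partial_deriv k \<phi> (?F x) else 0)"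
      by (intro sum.cong) (auto simp: matrix_inv_mult[OF J] mat_def)
    finally show ?thesis by simp
  qed
  have int1: "integrable (lebesgue_on U) (\<lambda>x. u x * partial_deriv j ?\<psi> x)" for j
    by (intro integrable_times_test_function[OF U] weak_derivD[OF wd] test_function_partial_deriv \<psi>)
  have int2: "integrable (lebesgue_on U) (\<lambda>x. g j x * ?\<psi> x)" for j
    by (intro integrable_times_test_function[OF U] weak_derivD[OF wd] \<psi>)
  have "(\<integral>y. u (inv ?F y) * partial_deriv i \<phi> y \<partial>lebesgue_on (?F ` U))
    = c * (\<integral>x. u x * partial_deriv i \<phi> (?F x) \<partial>lebesgue_on U)"
    by (rule integral_affine[OF c J U weak_derivD(1)[OF wd] d\<phi>])
  also have "(\<integral>x. u x * partial_deriv i \<phi> (?F x) \<partial>lebesgue_on U)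
     = (\<integral>x. (\<Sum>j\<in>UNIV. ?A $ j $ i * (u x * partial_deriv j ?\<psi> x)) \<partial>lebesgue_on U)"
    by (simp add: chain sum_distrib_left mult_ac)
  also have "\<dots> = (\<Sum>j\<in>UNIV. ?A $ j $ i * (\<integral>x. u x * partial_deriv j ?\<psi> x \<partial>lebesgue_on U))"
    using int1 by (subst Bochner_Integration.integral_sum) auto
  also have "\<dots> = (\<Sum>j\<in>UNIV. ?A $ j $ i * (- (\<integral>x. g j x * ?\<psi> x \<partial>lebesgue_on U)))"
    using weak_derivD(3)[OF wd \<psi> refl] by (simp add: mi_order_count_list del: count_list.simps)
  also have "\<dots> = - (\<integral>x. (\<Sum>j\<in>UNIV. ?A $ j $ i * (g j x * ?\<psi> x)) \<partial>lebesgue_on U)"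
    using int2 by (subst Bochner_Integration.integral_sum) (auto simp: sum_negf)
  also have "(\<integral>x. (\<Sum>j\<in>UNIV. ?A $ j $ i * (g j x * ?\<psi> x)) \<partial>lebesgue_on U)
     = (\<integral>x. (\<Sum>j\<in>UNIV. ?A $ j $ i * g j x) * ?\<psi> x \<partial>lebesgue_on U)"
    by (simp add: sum_distrib_right mult.assoc)
  also have "c * - \<dots> = - (\<integral>y. (\<Sum>j\<in>UNIV. ?A $ j $ i * g j (inv ?F y)) * \<phi> y \<partial>lebesgue_on (?F ` U))"
    using integral_affine[OF c J U lin \<phi>] by simp
  finally show "(\<integral>y. u (inv ?F y) * partial_deriv i \<phi> y \<partial>lebesgue_on (?F ` U))
    = - (\<integral>y. (\<Sum>j\<in>UNIV. ?A $ j $ i * g j (inv ?F y)) * \<phi> y \<partial>lebesgue_on (?F ` U))" .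
qed

text \<open>By translation invariance every difference quotient of \<open>g\<close> integrates to 0,
  and dominated convergence passes this on to the derivative.\<close>

lemma integral_partial_deriv_eq_0:
  fixes g :: "real ^ 'd::finite \<Rightarrow> real"
  assumes diff: "\<And>x. g differentiable (at x)" and cont: "continuous_on UNIV (partial_deriv i g)"
    and K: "compact K" "\<And>x. x \<notin> K \<Longrightarrow> g x = 0"
  shows "(\<integral>x. partial_deriv i g x \<partial>lebesgue) = 0"
proof -
  let ?e = "axis i 1 :: real ^ 'd"
  obtain r where r: "r > 0" "K \<subseteq> cball 0 r"
    
  proof -
    obtain a where "\<forall>x\<in>K. norm x \<le> a" using compact_imp_bounded[OF K(1)] by (auto simp: bounded_iff)
    then show ?thesis by (intro that[of "max a 1"]) (auto simp: subset_iff)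
  qed
  have g0: "g x = 0" if "norm x > r" for x using K(2) r(2) that by (force simp: subset_iff)
  \<comment> \<open>Steps are at most 1, so the quotients vanish outside radius
    \<open>r + 1\<close>, and the mean value theorem evaluates the derivative within radius
    \<open>r + 2\<close>.\<close>
  have "bounded (partial_deriv i g ` cball 0 (r + 2))"
    by (intro compact_imp_bounded compact_continuous_image continuous_on_subset[OF cont]) auto
  then obtain B where "\<forall>x\<in>cball 0 (r + 2). \<bar>partial_deriv i g x\<bar> \<le> B" by (auto simp: bounded_iff)
  then have B: "\<bar>partial_deriv i g x\<bar> \<le> B" if "norm x \<le> r + 2" for x using that by simp
  have gc: "continuous_on UNIV g"
    using diff by (meson continuous_at_imp_continuous_on differentiable_imp_continuous_within)
  have gm: "g \<in> borel_measurable lebesgue"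
    using borel_measurable_continuous_onI[OF gc] by (simp add: measurable_completion)
  define h where "h n = 1 / real (Suc n)" for n
  have h: "0 < h n" "h n \<le> 1" for n by (auto simp: h_def)
  have h0: "h \<longlonglongrightarrow> 0"
    using LIMSEQ_inverse_real_of_nat by (simp add: h_def[abs_def] inverse_eq_divide)
  define q where "q n x = (g (x + h n *\<^sub>R ?e) - g x) / h n" for n x
  have intg: "integrable lebesgue g"
  proof -
    have "integrable lborel (\<lambda>x. indicator (cball 0 r) x *\<^sub>R g x)"
      by (intro borel_integrable_compact continuous_on_subset[OF gc]) auto
    moreover have "(\<lambda>x. indicator (cball 0 r) x *\<^sub>R g x) = g"
      using g0 by (auto simp: fun_eq_iff indicator_def not_le)
    ultimately have "integrable lborel g" by (simp only:)
    then show ?thesis by (simp add: integrable_completion)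
  qed
  have shift: "integrable lebesgue (\<lambda>x. g (x + a))" "(\<integral>x. g (x + a) \<partial>lebesgue) = (\<integral>x. g x \<partial>lebesgue)" for a
    using integral_image_has_jacobian[OF has_jacobian_translation, of UNIV g a] gm intg
    by (simp_all add: lebesgue_on_UNIV_eq)
  have 0: "(\<integral>x. q n x \<partial>lebesgue) = 0" for n
    using shift intg by (simp add: q_def)
  have zero_deriv: "q n x = 0" if "norm x > r + 1" for n x
  proof -
    have "norm x \<le> norm (x + h n *\<^sub>R ?e) + norm (h n *\<^sub>R ?e)" by (metis add_diff_cancel_right' norm_triangle_ineq4)
    then have "norm (x + h n *\<^sub>R ?e) > r" using that h[of n] by (simp add: norm_axis_1)
    then show ?thesis using g0 that by (simp add: q_def)
  qed
  have bound: "\<bar>q n x\<bar> \<le> B * indicator (cball 0 (r + 1)) x" for n x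
  proof (cases "norm x \<le> r + 1")
    case True
    have "\<exists>s. 0 < s \<and> s < h n \<and> g (x + h n *\<^sub>R ?e) - g (x + 0 *\<^sub>R ?e) = (h n - 0) * partial_deriv i g (x + s *\<^sub>R ?e)"
      using h by (intro MVT2 partial_deriv_line diff) auto
    then obtain s where s: "0 < s" "s < h n" "g (x + h n *\<^sub>R ?e) - g x = h n * partial_deriv i g (x + s *\<^sub>R ?e)"
      by auto
    have "norm (x + s *\<^sub>R ?e) \<le> norm x + norm (s *\<^sub>R ?e)" by (rule norm_triangle_ineq)
    then have "norm (x + s *\<^sub>R ?e) \<le> r + 2" using s h[of n] True by (simp add: norm_axis_1)
    from B[OF this] show ?thesis using s h[of n] True by (simp add: q_def)
  next
    case False
    then show ?thesis using zero_deriv[of x n] by simp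
  qed
  have lim: "(\<lambda>n. q n x) \<longlonglongrightarrow> partial_deriv i g x" for x
  proof -
    have "((\<lambda>s. g (x + s *\<^sub>R ?e)) has_real_derivative partial_deriv i g (x + 0 *\<^sub>R ?e)) (at 0)"
      by (rule partial_deriv_line[OF diff])
    then have "((\<lambda>s. (g (x + s *\<^sub>R ?e) - g x) / s) \<longlongrightarrow> partial_deriv i g x) (at 0)"
      by (simp add: has_field_derivative_iff)
    moreover have "filterlim h (at 0) sequentially"
      using h0 h(1) by (intro filterlim_atI) (auto intro!: always_eventually simp: less_imp_neq[symmetric])
    ultimately show ?thesis unfolding q_def by (rule filterlim_compose)
  qed
  have "(\<lambda>n. \<integral>x. q n x \<partial>lebesgue) \<longlonglongrightarrow> (\<integral>x. partial_deriv i g x \<partial>lebesgue)"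
  proof (rule integral_dominated_convergence[where w="\<lambda>x. B * indicator (cball 0 (r + 1)) x"])
    show "partial_deriv i g \<in> borel_measurable lebesgue"
      using borel_measurable_continuous_onI[OF cont] by (simp add: measurable_completion)
    show "q n \<in> borel_measurable lebesgue" for n
      using shift(1)[of "h n *\<^sub>R ?e"] gm unfolding q_def by (intro borel_measurable_divide borel_measurable_diff) auto
    have "integrable lebesgue (indicator (cball 0 (r + 1)) :: real ^ 'd \<Rightarrow> real)"
      by (intro integrable_real_indicator) (auto simp: emeasure_lborel_cball_finite emeasure_compact_finite)
    then show "integrable lebesgue (\<lambda>x::real ^ 'd. B * indicator (cball 0 (r + 1)) x)" by simp
    show "AE x in lebesgue. (\<lambda>n. q n x) \<longlonglongrightarrow> partial_deriv i g x" using lim by simp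
    show "AE x in lebesgue. norm (q n x) \<le> B * indicator (cball 0 (r + 1)) x" for n using bound by simp
  qed
  then show ?thesis by (simp add: 0 LIMSEQ_const_iff)
qed

lemma continuous_absolutely_integrable_on_compact:
  fixes f :: "'a::euclidean_space \<Rightarrow> real"
  assumes "continuous_on UNIV f" "compact K"
  shows "f absolutely_integrable_on K"
proof -
  have "integrable lborel (\<lambda>x. indicator K x *\<^sub>R f x)"
    using assms by (intro borel_integrable_compact continuous_on_subset[OF assms(1)]) auto
  then show ?thesis by (simp add: set_integrable_def integrable_completion)
qed

text \<open>Integration by parts: the product of \<open>f\<close> with a test function has compact
  support, so its derivative integrates to 0.\<close>

lemma weak_deriv_classical:
  fixes f :: "real ^ 'd::finite \<Rightarrow> real"
  assumes U: "open U" and diff: "\<And>x. f differentiable (at x)" and cont: "continuous_on UNIV (partial_deriv i f)"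
  shows "weak_deriv U (count_list [i]) f (partial_deriv i f)"
proof (rule weak_deriv_singletonI)
  have fc: "continuous_on UNIV f"
    using diff by (meson continuous_at_imp_continuous_on differentiable_imp_continuous_within)
  show li: "f absolutely_integrable_on K" "partial_deriv i f absolutely_integrable_on K" if "compact K" for K
    using that fc cont by (auto intro: continuous_absolutely_integrable_on_compact)
  fix \<phi> assume \<phi>: "\<phi> \<in> test_functions U"
  have sm: "smooth \<phi>" by (rule test_functionD(1)[OF \<phi>])
  obtain K where K: "compact K" "K \<subseteq> U" "\<And>x. x \<notin> K \<Longrightarrow> \<phi> x = 0" using test_functionD(2)[OF \<phi>] by auto
  have d: "partial_deriv i (\<lambda>x. f x * \<phi> x) = (\<lambda>x. partial_deriv i f x * \<phi> x + f x * partial_deriv i \<phi> x)"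
    by (rule ext, intro partial_deriv_mult diff smooth_differentiable sm)
  have "(\<integral>x. partial_deriv i (\<lambda>x. f x * \<phi> x) x \<partial>lebesgue) = 0"
  proof (rule integral_partial_deriv_eq_0[OF _ _ K(1)])
    show "(\<lambda>x. f x * \<phi> x) differentiable (at x)" for x
      by (intro differentiable_mult diff smooth_differentiable sm)
    show "continuous_on UNIV (partial_deriv i (\<lambda>x. f x * \<phi> x))"
      unfolding d by (intro continuous_on_add continuous_on_mult cont fc smooth_continuous_on smooth_partial_deriv sm)
  qed (simp add: K)
  moreover have "(\<lambda>x. partial_deriv i (\<lambda>x. f x * \<phi> x) x)
     = (\<lambda>x. indicator U x *\<^sub>R (partial_deriv i f x * \<phi> x + f x * partial_deriv i \<phi> x))"
  proof
    fix x
    have "\<phi> x = 0" "partial_deriv i \<phi> x = 0" if "x \<notin> U"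
      using that test_functionD(2)[OF \<phi>] test_functionD(2)[OF test_function_partial_deriv[OF \<phi>]] by blast+
    then show "partial_deriv i (\<lambda>x. f x * \<phi> x) x = indicator U x *\<^sub>R (partial_deriv i f x * \<phi> x + f x * partial_deriv i \<phi> x)"
      unfolding d by (cases "x \<in> U") auto
  qed
  ultimately have "(\<integral>x. partial_deriv i f x * \<phi> x + f x * partial_deriv i \<phi> x \<partial>lebesgue_on U) = 0"
    using U by (simp add: integral_restrict_space)
  moreover have "integrable (lebesgue_on U) (\<lambda>x. partial_deriv i f x * \<phi> x)"
    "integrable (lebesgue_on U) (\<lambda>x. f x * partial_deriv i \<phi> x)"
    by (intro integrable_times_test_function[OF U] li test_function_partial_deriv \<phi>; assumption)+
  ultimately show "(\<integral>x. f x * partial_deriv i \<phi> x \<partial>lebesgue_on U) = - (\<integral>x. partial_deriv i f x * \<phi> x \<partial>lebesgue_on U)"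
    by simp
qed

section \<open>Seminorms on finite-dimensional spaces\<close>

text \<open>Seminorms act on coefficients instead of functions: a spanning set may be dependent and
  norms ignore null sets, so a nonzero coefficient vector can represent a null function.\<close>

definition coefficient_seminorm :: "(('i \<Rightarrow> real) \<Rightarrow> real) \<Rightarrow> bool" where
  "coefficient_seminorm N \<longleftrightarrow> (\<forall>c d. N (\<lambda>i. c i + d i) \<le> N c + N d) \<and> (\<forall>a c. N (\<lambda>i. a * c i) = \<bar>a\<bar> * N c)"

lemma coefficient_seminormD:
  assumes "coefficient_seminorm N"
  shows "N (\<lambda>i. c i + d i) \<le> N c + N d" "N (\<lambda>i. a * c i) = \<bar>a\<bar> * N c"
  using assms by (simp_all add: coefficient_seminorm_def)

lemma coefficient_seminorm_nonneg:
  assumes "coefficient_seminorm N"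
  shows "N c \<ge> 0"
proof -
  have "N (\<lambda>i. 0 * c i) = \<bar>0\<bar> * N c" "N (\<lambda>i. (-1) * c i) = \<bar>-1\<bar> * N c" 
    by (rule coefficient_seminormD(2)[OF assms])+
  moreover have "N (\<lambda>i. c i + (-1) * c i) \<le> N c + N (\<lambda>i. (-1) * c i)"
    by (rule coefficient_seminormD(1)[OF assms])
  ultimately show ?thesis by simp
qed

lemma coefficient_seminorm_le:
  fixes N :: "('i \<Rightarrow> real) \<Rightarrow> real"
  assumes N: "coefficient_seminorm N" and I: "finite I" "\<And>i. i \<notin> I \<Longrightarrow> c i = 0"
  shows "N c \<le> (\<Sum>i\<in>I. \<bar>c i\<bar> * N (\<lambda>j. of_bool (j = i)))"
proof -
  have "N (\<lambda>i. 0 * c i) = \<bar>0\<bar> * N c" by (rule coefficient_seminormD(2)[OF N])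
  then have 0: "N (\<lambda>_. 0) = 0" by simp
  have "N (\<lambda>j. \<Sum>i\<in>I. c i * of_bool (j = i)) \<le> (\<Sum>i\<in>I. \<bar>c i\<bar> * N (\<lambda>j. of_bool (j = i)))"
    using I(1)
  proof (induction I)
    case (insert i I)
    have "N (\<lambda>j. c i * of_bool (j = i) + (\<Sum>i\<in>I. c i * of_bool (j = i)))
      \<le> N (\<lambda>j. c i * of_bool (j = i)) + N (\<lambda>j. \<Sum>i\<in>I. c i * of_bool (j = i))"
      by (rule coefficient_seminormD(1)[OF N])
    also have "N (\<lambda>j. c i * of_bool (j = i)) = \<bar>c i\<bar> * N (\<lambda>j. of_bool (j = i))"
      by (rule coefficient_seminormD(2)[OF N])
    finally show ?case unfolding sum.insert[OF insert.hyps] using insert.IH by linarith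
  qed (simp add: 0)
  also have "(\<lambda>j. \<Sum>i\<in>I. c i * of_bool (j = i)) = c"
    using I by (auto simp: fun_eq_iff of_bool_def if_distrib sum.delta cong: if_cong)
  finally show ?thesis .
qed

text \<open>Coefficient vectors carry the product topology, the one in which the unit sphere of the
  maximum norm is later shown to be compact.\<close>

lemma coefficient_seminorm_continuous:
  fixes N :: "('i \<Rightarrow> real) \<Rightarrow> real"
  assumes N: "coefficient_seminorm N" and I: "finite I"
  shows "continuous_on {c. \<forall>i. i \<notin> I \<longrightarrow> c i = 0} N"
  unfolding continuous_on_def
proof
  fix c assume c: "c \<in> {c. \<forall>i. i \<notin> I \<longrightarrow> c i = (0::real)}"
  let ?S = "{c. \<forall>i. i \<notin> I \<longrightarrow> c i = (0::real)}"
  let ?B = "\<lambda>d. \<Sum>i\<in>I. \<bar>d i - c i\<bar> * N (\<lambda>j. of_bool (j = i))"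
  have "continuous_on UNIV ?B"
    by (intro continuous_on_sum continuous_on_mult_right continuous_on_rabs continuous_on_diff
        continuous_on_const continuous_on_product_coordinates)
  then have "(?B \<longlongrightarrow> ?B c) (at c within ?S)"
    using c continuous_on_subset[of UNIV ?B ?S] unfolding continuous_on_def by blast
  then have B: "(?B \<longlongrightarrow> 0) (at c within ?S)" by simp
  have le: "\<bar>N d - N c\<bar> \<le> ?B d" if d: "d \<in> ?S" for d
  proof -
    have "N (\<lambda>i. d i - c i) \<le> ?B d"
      using coefficient_seminorm_le[OF N I, of "\<lambda>i. d i - c i"] c d by simp
    moreover have "N (\<lambda>i. (d i - c i) + c i) \<le> N (\<lambda>i. d i - c i) + N c"
      by (rule coefficient_seminormD(1)[OF N])
    moreover have "N (\<lambda>i. (-1) * (d i - c i) + d i) \<le> N (\<lambda>i. (-1) * (d i - c i)) + N d"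
      by (rule coefficient_seminormD(1)[OF N])
    moreover have "N (\<lambda>i. (-1) * (d i - c i)) = \<bar>-1\<bar> * N (\<lambda>i. d i - c i)"
      by (rule coefficient_seminormD(2)[OF N])
    ultimately show ?thesis by simp
  qed
  show "(N \<longlongrightarrow> N c) (at c within ?S)"
    unfolding tendsto_dist_iff[of N]
    by (rule tendsto_sandwich[OF _ _ tendsto_const B])
      (use le in \<open>auto simp: dist_real_def eventually_at_filter\<close>)
qed

text \<open>If \<open>N2\<close> vanishes somewhere on the unit sphere \<open>K\<close> of the
  maximum norm, that vector serves to eliminate one coordinate and the induction hypothesis applies.
  Otherwise \<open>N2\<close> has a positive minimum on the compact set \<open>K\<close>.\<close>

lemma coefficient_seminorm_bound:
  fixes N1 N2 :: "('i \<Rightarrow> real) \<Rightarrow> real"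
  assumes N1: "coefficient_seminorm N1" and N2: "coefficient_seminorm N2" and I: "finite I"
    and ker: "\<And>c. N2 c = 0 \<Longrightarrow> N1 c = 0"
  shows "\<exists>C\<ge>0. \<forall>c. (\<forall>i. i \<notin> I \<longrightarrow> c i = 0) \<longrightarrow> N1 c \<le> C * N2 c"
  using I
proof (induction "card I" arbitrary: I)
  case 0
  have "N1 (\<lambda>i. 0 * 0) = \<bar>0\<bar> * N1 (\<lambda>i. 0)"
      by (rule coefficient_seminormD(2)[OF N1])
  moreover have "c = (\<lambda>i. 0)" if "\<forall>i. i \<notin> I \<longrightarrow> c i = 0" for c :: "'i \<Rightarrow> real"
    using that 0 by auto
  ultimately show ?case by (intro exI[of _ 0]) auto
next
  case (Suc n)
  define S where "S = {c :: 'i \<Rightarrow> real. \<forall>i. i \<notin> I \<longrightarrow> c i = 0}"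
  define K where "K = {c \<in> S. (\<forall>i\<in>I. \<bar>c i\<bar> \<le> 1) \<and> (\<exists>i\<in>I. \<bar>c i\<bar> = 1)}"
  note add = coefficient_seminormD(1) and mul = coefficient_seminormD(2)
  show ?case
  proof (cases "\<exists>c\<in>K. N2 c = 0")
    case True
    then obtain c0 i where c0: "c0 \<in> S" "N2 c0 = 0" "i \<in> I" "\<bar>c0 i\<bar> = 1" by (auto simp: K_def)
    have "card (I - {i}) = n" "finite (I - {i})" using Suc c0 by auto
    then obtain C where C: "C \<ge> 0" "\<And>c. (\<forall>j. j \<notin> I - {i} \<longrightarrow> c j = 0) \<Longrightarrow> N1 c \<le> C * N2 c"
      using Suc(1)[of "I - {i}"] by blast
    have "N1 c \<le> C * N2 c" if c: "\<forall>j. j \<notin> I \<longrightarrow> c j = 0" for c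
    proof -
      \<comment> \<open>The multiple of \<open>c0\<close> that cancels coordinate \<open>i\<close>.
        By \<open>ker\<close>, \<open>c0\<close> lies in both kernels, so neither seminorm
        changes.\<close>
      let ?t = "- c i / c0 i"
      let ?d = "\<lambda>j. c j + ?t * c0 j"
      have red: "N ?d = N c" if N: "coefficient_seminorm N" and z: "N c0 = 0" for N
      proof -
        have "N ?d \<le> N c + N (\<lambda>j. ?t * c0 j)" by (rule add[OF N])
        moreover have "N (\<lambda>j. ?d j + (- ?t) * c0 j) \<le> N ?d + N (\<lambda>j. (- ?t) * c0 j)" by (rule add[OF N])
        ultimately show ?thesis by (simp only: mul[OF N] z) simp
      qed
      have "c0 i \<noteq> 0" using c0 by auto
      then have "N1 ?d \<le> C * N2 ?d" using c c0 by (intro C(2)) (auto simp: S_def)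
      then show ?thesis using red[OF N1 ker[OF c0(2)]] red[OF N2 c0(2)] by simp
    qed
    then show ?thesis using C(1) by blast
  next
    case False
    have comp: "compact K"
    proof -
      have "compactin (product_topology (\<lambda>_. euclidean) UNIV) (PiE UNIV (\<lambda>i. if i \<in> I then {-1..1::real} else {0}))"
        by (subst compactin_PiE) auto
      then have "compact (PiE UNIV (\<lambda>i. if i \<in> I then {-1..1::real} else {0}))"
        by (simp add: euclidean_product_topology)
      moreover have "closed (\<Union>i\<in>I. {c :: 'i \<Rightarrow> real. \<bar>c i\<bar> = 1})"
        by (intro closed_UN Suc ballI closed_Collect_eq continuous_intros continuous_on_product_coordinates)
      ultimately have "compact (PiE UNIV (\<lambda>i. if i \<in> I then {-1..1::real} else {0}) \<inter> (\<Union>i\<in>I. {c. \<bar>c i\<bar> = 1}))"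
        by (rule compact_Int_closed)
      also have "PiE UNIV (\<lambda>i. if i \<in> I then {-1..1::real} else {0}) \<inter> (\<Union>i\<in>I. {c. \<bar>c i\<bar> = 1}) = K"
      proof -
        have "c \<in> PiE UNIV (\<lambda>i. if i \<in> I then {-1..1::real} else {0})
           \<longleftrightarrow> (\<forall>i. (i \<in> I \<longrightarrow> \<bar>c i\<bar> \<le> 1) \<and> (i \<notin> I \<longrightarrow> c i = 0))" for c
          unfolding PiE_iff abs_le_iff by (simp add: extensional_def) (metis atLeastAtMost_iff minus_le_iff singleton_iff)
        then show ?thesis unfolding K_def S_def by blast
      qed
      finally show ?thesis .
    qed
    have "\<exists>c0\<in>K. \<forall>c\<in>K. N2 c0 \<le> N2 c"
    proof (rule continuous_attains_inf[OF comp])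
      obtain i where "i \<in> I" using Suc by (metis card.empty ex_in_conv nat.simps(3))
      then have "(\<lambda>j. of_bool (j = i)) \<in> K" by (auto simp: K_def S_def)
      then show "K \<noteq> {}" by blast
      show "continuous_on K N2"
        by (rule continuous_on_subset[OF coefficient_seminorm_continuous[OF N2]]) (use Suc in \<open>auto simp: K_def S_def\<close>)
    qed
    then obtain c0 where c0: "c0 \<in> K" "\<And>c. c \<in> K \<Longrightarrow> N2 c0 \<le> N2 c" by blast
    have pos: "N2 c0 > 0" using False c0(1) coefficient_seminorm_nonneg[OF N2, of c0] by (auto simp: less_le)
    \<comment> \<open>\<open>?M\<close> bounds \<open>N1\<close> on the sphere \<open>K\<close>, and
      \<open>N2 c0\<close> is the minimum of \<open>N2\<close> there; homogeneity does the
      rest.\<close>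
    let ?M = "\<Sum>i\<in>I. N1 (\<lambda>j. of_bool (j = i))"
    have M: "?M \<ge> 0" by (intro sum_nonneg coefficient_seminorm_nonneg[OF N1])
    have "N1 c \<le> ?M / N2 c0 * N2 c" if c: "\<forall>i. i \<notin> I \<longrightarrow> c i = 0" for c
    proof (cases "\<exists>i\<in>I. c i \<noteq> 0")
      case True
      define m where "m = Max ((\<lambda>i. \<bar>c i\<bar>) ` I)"
      have fin: "finite ((\<lambda>i. \<bar>c i\<bar>) ` I)" "(\<lambda>i. \<bar>c i\<bar>) ` I \<noteq> {}" using Suc True by auto
      have mI: "\<bar>c i\<bar> \<le> m" if "i \<in> I" for i unfolding m_def using fin that by (intro Max_ge) auto
      have "m > 0" using True mI by force
      obtain i where i: "i \<in> I" "m = \<bar>c i\<bar>" using Max_in[OF fin] unfolding m_def by blast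
      have "\<bar>c j\<bar> \<le> m" for j using mI[of j] c \<open>m > 0\<close> by (cases "j \<in> I") auto
      then have "(\<lambda>j. (1/m) * c j) \<in> K"
        using c i \<open>m > 0\<close> by (auto simp: K_def S_def abs_mult intro!: bexI[of _ i])
      from c0(2)[OF this] have "m * N2 c0 \<le> N2 c"
        using \<open>m > 0\<close> unfolding mul[OF N2] by (simp add: field_simps)
      then have "m \<le> N2 c / N2 c0" using pos by (simp add: field_simps)
      have "N1 c \<le> (\<Sum>i\<in>I. \<bar>c i\<bar> * N1 (\<lambda>j. of_bool (j = i)))"
        using c Suc by (intro coefficient_seminorm_le N1) auto
      also have "\<dots> \<le> (\<Sum>i\<in>I. m * N1 (\<lambda>j. of_bool (j = i)))"
        by (intro sum_mono mult_right_mono mI coefficient_seminorm_nonneg[OF N1])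
      also have "\<dots> = m * ?M" by (simp add: sum_distrib_left)
      also have "\<dots> \<le> N2 c / N2 c0 * ?M" by (intro mult_right_mono M) fact
      finally show ?thesis by (simp add: field_simps)
    next
      case False
      then have "c = (\<lambda>i. 0 * 0)" using c by auto
      then have "N1 c = 0" using mul[OF N1, of 0 "\<lambda>_. 0"] by simp
      then show ?thesis using M pos coefficient_seminorm_nonneg[OF N2, of c] by simp
    qed
    moreover have "?M / N2 c0 \<ge> 0" using M pos by simp
    ultimately show ?thesis by blast
  qed
qed

section \<open>Markov's inequality\<close>

fun chebyshev :: "nat \<Rightarrow> real poly" where
  "chebyshev 0 = 1"
| "chebyshev (Suc 0) = [:0, 1:]"
| "chebyshev (Suc (Suc n)) = [:0, 2:] * chebyshev (Suc n) - chebyshev n"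

lemma chebyshev_cos: "poly (chebyshev n) (cos t) = cos (real n * t)"
proof (induction n rule: chebyshev.induct)
  case (3 n)
  have "cos (real (Suc n) * t + t) + cos (real (Suc n) * t - t) = 2 * cos t * cos (real (Suc n) * t)"
    by (simp add: cos_add cos_diff)
  moreover have "real (Suc n) * t + t = real (Suc (Suc n)) * t" "real (Suc n) * t - t = real n * t"
    by (simp_all add: algebra_simps)
  ultimately show ?case using 3 by (simp add: algebra_simps)
qed auto

lemma degree_chebyshev: "degree (chebyshev n) \<le> n"
proof (induction n rule: chebyshev.induct)
  case (3 n)
  have "degree ([:0, 2:] * chebyshev (Suc n)) \<le> Suc (Suc n)"
    using degree_mult_le[of "[:0, 2:]" "chebyshev (Suc n)"] 3 by simp
  then show ?case using 3 by (auto intro: degree_diff_le simp del: mult_pCons_left)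
qed auto

lemma pderiv_chebyshev_1: "poly (pderiv (chebyshev n)) 1 = (real n)\<^sup>2"
proof (induction n rule: chebyshev.induct)
  case (3 n)
  have "poly (chebyshev m) 1 = 1" for m using chebyshev_cos[of m 0] by simp
  with 3 show ?case by (simp add: pderiv_mult pderiv_diff pderiv_smult pderiv_pCons power2_eq_square algebra_simps del: mult_pCons_left)
qed (auto simp: pderiv_pCons)

definition lagrange_basis :: "(nat \<Rightarrow> real) \<Rightarrow> nat \<Rightarrow> nat \<Rightarrow> real poly" where
  "lagrange_basis x k r = (\<Prod>s\<in>{..k} - {r}. smult (1 / (x r - x s)) [:- x s, 1:])"

lemma poly_lagrange_basis:
  "poly (lagrange_basis x k r) t = (\<Prod>s\<in>{..k} - {r}. (t - x s) / (x r - x s))"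
  unfolding lagrange_basis_def poly_prod by (intro prod.cong) (auto simp: field_simps diff_divide_distrib)

lemma lagrange_interpolation:
  assumes inj: "inj_on x {..k}" and deg: "degree p \<le> k"
  shows "p = (\<Sum>r\<le>k. smult (poly p (x r)) (lagrange_basis x k r))"
proof (rule poly_eqI_degree[of "x ` {..k}"])
  have card: "card (x ` {..k}) = Suc k" using inj by (simp add: card_image)
  then show "degree p < card (x ` {..k})" using deg by simp
  have "degree (lagrange_basis x k r) \<le> k" if "r \<le> k" for r
  proof -
    have "degree (lagrange_basis x k r) \<le> (\<Sum>s\<in>{..k} - {r}. degree (smult (1 / (x r - x s)) [:- x s, 1:]))"
      unfolding lagrange_basis_def by (rule order_trans[OF degree_prod_sum_le]) (auto simp: o_def)
    also have "\<dots> \<le> (\<Sum>s\<in>{..k} - {r}. 1)" by (intro sum_mono) (auto intro: order_trans[OF degree_smult_le])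
    also have "\<dots> = k" using that by simp
    finally show ?thesis .
  qed
  then have "degree (\<Sum>r\<le>k. smult (poly p (x r)) (lagrange_basis x k r)) \<le> k"
    by (intro degree_sum_le) (auto intro: order_trans[OF degree_smult_le])
  then show "degree (\<Sum>r\<le>k. smult (poly p (x r)) (lagrange_basis x k r)) < card (x ` {..k})"
    using card by simp
  fix t assume "t \<in> x ` {..k}"
  then obtain j where j: "j \<le> k" "t = x j" by auto
  have "poly (lagrange_basis x k r) (x j) = (if r = j then 1 else 0)" if "r \<le> k" for r
  proof (cases "r = j")
    case True
    have "x j - x s \<noteq> 0" if "s \<in> {..k} - {r}" for s
      using inj_onD[OF inj, of j s] j that True by auto
    then show ?thesis using True by (auto simp: poly_lagrange_basis intro!: prod.neutral)
  next
    case False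
    then show ?thesis using j unfolding poly_lagrange_basis by (auto intro!: prod_zero)
  qed
  then have "(\<Sum>r\<le>k. poly p (x r) * poly (lagrange_basis x k r) (x j)) = (\<Sum>r\<le>k. if r = j then poly p (x r) else 0)"
    by (intro sum.cong refl) simp
  then show "poly p t = poly (\<Sum>r\<le>k. smult (poly p (x r)) (lagrange_basis x k r)) t"
    using j by (simp add: poly_sum)
qed

lemma pderiv_sum: "pderiv (\<Sum>i\<in>A. f i) = (\<Sum>i\<in>A. pderiv (f i))"
  by (induction A rule: infinite_finite_induct) (auto simp: pderiv_add)

text \<open>The derivative at \<open>1\<close> is a combination of the values at the Chebyshev extrema whose coefficients
  alternate in sign, so that the Chebyshev polynomial itself attains the total weight \<open>k\<^sup>2\<close>.\<close>

lemma markov_quadrature: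
  assumes "k \<ge> 1"
  shows "\<exists>c x. (\<forall>r\<le>k. \<bar>x r\<bar> \<le> 1) \<and> (\<Sum>r\<le>k. \<bar>c r\<bar>) = (real k)\<^sup>2 \<and>
    (\<forall>p :: real poly. degree p \<le> k \<longrightarrow> poly (pderiv p) 1 = (\<Sum>r\<le>k. c r * poly p (x r)))"
proof -
  define x where "x r = cos (real r * pi / real k)" for r
  define c where "c r = poly (pderiv (lagrange_basis x k r)) 1" for r
  have x0: "x 0 = 1" by (simp add: x_def)
  have xle: "x r \<le> 1" for r by (simp add: x_def)
  have less: "x s < x r" if "r < s" "s \<le> k" for r s
    unfolding x_def using that assms
    by (intro cos_monotone_0_pi) (auto simp: field_simps)
  have inj: "inj_on x {..k}"
    by (rule inj_onI) (metis atMost_iff less less_irrefl linorder_neqE_nat)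
  have form: "poly (pderiv p) 1 = (\<Sum>r\<le>k. c r * poly p (x r))" if "degree p \<le> k" for p
    by (subst lagrange_interpolation[OF inj that])
      (simp add: pderiv_sum pderiv_smult poly_sum c_def mult.commute)
  have c_eq: "c r = (\<Sum>a\<in>{..k} - {r}. (\<Prod>s\<in>{..k} - {r} - {a}. (1 - x s) / (x r - x s)) * (1 / (x r - x a)))" for r
    unfolding c_def lagrange_basis_def
    by (simp add: pderiv_prod poly_sum poly_prod pderiv_smult pderiv_pCons diff_divide_distrib)
  have sign: "(-1) ^ r * c r \<ge> 0" if r: "r \<le> k" for r
  proof (cases "r = 0")
    case True
    have nn: "(1 - x s) / (x r - x s) \<ge> 0" "1 / (x r - x s) \<ge> 0" for s
      using xle[of s] by (simp_all only: True x0) simp_all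
    have "c r \<ge> 0" unfolding c_eq by (intro sum_nonneg mult_nonneg_nonneg prod_nonneg nn)
    then show ?thesis by (simp add: True)
  next
    case False
    \<comment> \<open>The node \<open>x 0 = 1\<close> is the evaluation point, so for
      \<open>r \<noteq> 0\<close> the factor with \<open>s = 0\<close> vanishes unless it is the
      differentiated one; \<open>g 0 = 1\<close> is the derivative of its numerator.\<close>
    define g where "g s = (if s = 0 then 1 else 1 - x s)" for s
    have g: "g s \<ge> 0" for s using xle by (simp add: g_def)
    have "c r = (\<Sum>a\<in>{0}. (\<Prod>s\<in>{..k} - {r} - {a}. (1 - x s) / (x r - x s)) * (1 / (x r - x a)))"
      unfolding c_eq
    proof (rule sum.mono_neutral_right)
      show "\<forall>a\<in>{..k} - {r} - {0}. (\<Prod>s\<in>{..k} - {r} - {a}. (1 - x s) / (x r - x s)) * (1 / (x r - x a)) = 0"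
      proof
        fix a assume "a \<in> {..k} - {r} - {0}"
        then have "(\<Prod>s\<in>{..k} - {r} - {a}. (1 - x s) / (x r - x s)) = 0"
          using False x0 by (intro prod_zero bexI[of _ 0]) auto
        then show "(\<Prod>s\<in>{..k} - {r} - {a}. (1 - x s) / (x r - x s)) * (1 / (x r - x a)) = 0" by simp
      qed
    qed (use False in auto)
    also have "\<dots> = (\<Prod>s\<in>{..k} - {r} - {0}. g s / (x r - x s)) * (g 0 / (x r - x 0))"
      by (simp add: g_def cong: prod.cong_simp)
    also have "\<dots> = (\<Prod>s\<in>{..k} - {r}. g s / (x r - x s))"
      using False by (subst (2) prod.remove[of _ 0]) (auto simp: mult.commute)
    \<comment> \<open>The nodes decrease, so exactly the \<open>r\<close> factors with
      \<open>s < r\<close> have a negative denominator, which produces the sign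
      \<open>(-1) ^ r\<close>.\<close>
    also have "{..k} - {r} = {..<r} \<union> {r<..k}" using r by auto
    also have "(\<Prod>s\<in>{..<r} \<union> {r<..k}. g s / (x r - x s))
       = (\<Prod>s<r. (-1) * (g s / (x s - x r))) * (\<Prod>s\<in>{r<..k}. g s / (x r - x s))"
    proof -
      have "g s / (x r - x s) = (-1) * (g s / (x s - x r))" for s
        using minus_divide_right[of "g s" "x s - x r"] by simp
      then have "(\<Prod>s<r. g s / (x r - x s)) = (\<Prod>s<r. (-1) * (g s / (x s - x r)))"
        by (intro prod.cong refl)
      moreover have "{..<r} \<inter> {r<..k} = {}" by auto
      ultimately show ?thesis by (simp only: prod.union_disjoint finite_lessThan finite_greaterThanAtMost)
    qed
    also have "(\<Prod>s<r. (-1) * (g s / (x s - x r))) = (-1) ^ r * (\<Prod>s<r. g s / (x s - x r))"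
      unfolding prod.distrib by simp
    finally have "(-1) ^ r * c r = ((-1) ^ r * (-1) ^ r) * (\<Prod>s<r. g s / (x s - x r)) * (\<Prod>s\<in>{r<..k}. g s / (x r - x s))"
      by (simp only: mult.assoc)
    also have "(-1) ^ r * (-1) ^ r = (1::real)" by (simp flip: power_mult_distrib)
    finally have "(-1) ^ r * c r = (\<Prod>s<r. g s / (x s - x r)) * (\<Prod>s\<in>{r<..k}. g s / (x r - x s))" by simp
    also have "\<dots> \<ge> 0"
      using less r g by (intro mult_nonneg_nonneg prod_nonneg divide_nonneg_nonneg) (auto intro: less_imp_le)
    finally show ?thesis .
  qed
  have "(\<Sum>r\<le>k. \<bar>c r\<bar>) = (\<Sum>r\<le>k. c r * poly (chebyshev k) (x r))"
  proof (intro sum.cong refl)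
    fix r assume "r \<in> {..k}"
    \<comment> \<open>At its extrema the Chebyshev polynomial takes the values 1 and -1 with the
      signs of the weights, so its derivative at 1 adds up their absolute values.\<close>
    have "poly (chebyshev k) (x r) = (-1) ^ r"
      using assms by (simp add: x_def chebyshev_cos)
    moreover have "\<bar>c r\<bar> = (-1) ^ r * c r"
    proof -
      have "\<bar>(-1) ^ r * c r\<bar> = \<bar>c r\<bar>" by (simp add: abs_mult power_abs)
      then show ?thesis using abs_of_nonneg[OF sign[of r]] \<open>r \<in> {..k}\<close> by simp
    qed
    ultimately show "\<bar>c r\<bar> = c r * poly (chebyshev k) (x r)" by simp
  qed
  also have "\<dots> = (real k)\<^sup>2" using form[OF degree_chebyshev] pderiv_chebyshev_1 by simp
  finally have "(\<Sum>r\<le>k. \<bar>c r\<bar>) = (real k)\<^sup>2" .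
  moreover have "\<forall>r\<le>k. \<bar>x r\<bar> \<le> 1" by (simp add: x_def)
  ultimately show ?thesis using form by blast
qed

section \<open>Polynomials of bounded degree in each variable\<close>

inductive_set tensor_polys :: "nat \<Rightarrow> (real ^ 'd::finite \<Rightarrow> real) set" for k where
  monomial: "(\<And>i. \<alpha> i \<le> k) \<Longrightarrow> (\<lambda>x. a * (\<Prod>i\<in>UNIV. (x $ i) ^ \<alpha> i)) \<in> tensor_polys k"
| add: "f \<in> tensor_polys k \<Longrightarrow> g \<in> tensor_polys k \<Longrightarrow> (\<lambda>x. f x + g x) \<in> tensor_polys k"

lemma tensor_polys_cmult: "f \<in> tensor_polys k \<Longrightarrow> (\<lambda>x. c * f x) \<in> tensor_polys k"
proof (induction rule: tensor_polys.induct)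
  case (monomial \<alpha> a)
  then have "(\<lambda>x. (c * a) * (\<Prod>i\<in>UNIV. (x $ i) ^ \<alpha> i)) \<in> tensor_polys k"
    by (rule tensor_polys.monomial)
  then show ?case by (simp only: mult.assoc)
qed (auto simp: distrib_left intro: tensor_polys.add)

lemma tensor_polys_zero: "(\<lambda>x. 0) \<in> tensor_polys k"
  using tensor_polys.monomial[of "\<lambda>_. 0" k 0] by simp

text \<open>Members of \<open>Q_space\<close> are cut off outside the cube. A polynomial on the
  whole space is needed for classical derivatives to exist up to the boundary.\<close>

lemma Q_space_tensor_polys:
  assumes "f \<in> Q_space k S"
  shows "\<exists>g\<in>tensor_polys k. \<forall>x\<in>S. f x = g x"
  using assms unfolding Q_space_def
proof (induction rule: fun_space.span_induct_alt)
  case base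
  then show ?case using tensor_polys_zero[of k] by (intro bexI[of _ "\<lambda>x. 0"]) (auto simp: zero_fun_def)
next
  case (step c m f)
  then obtain \<alpha> where \<alpha>: "m = (\<lambda>x. indicat_real S x * (\<Prod>i\<in>UNIV. (x $ i) ^ \<alpha> i))" "\<forall>i. \<alpha> i \<le> k" by blast
  from step obtain g where g: "g \<in> tensor_polys k" "\<forall>x\<in>S. f x = g x" by blast
  have "(\<lambda>x. c * (\<Prod>i\<in>UNIV. (x $ i) ^ \<alpha> i) + g x) \<in> tensor_polys k"
    using \<alpha>(2) g(1) by (intro tensor_polys.intros) auto
  then show ?case
    by (rule bexI[rotated]) (auto simp: \<alpha>(1) g(2) plus_fun_def)
qed

lemma has_derivative_monomial:
  fixes \<alpha> :: "'d::finite \<Rightarrow> nat"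
  shows "((\<lambda>x :: real ^ 'd. \<Prod>i\<in>UNIV. (x $ i) ^ \<alpha> i) has_derivative
    (\<lambda>h. \<Sum>i\<in>UNIV. (h $ i * (real (\<alpha> i) * (x $ i) ^ (\<alpha> i - 1))) * (\<Prod>j\<in>UNIV - {i}. (x $ j) ^ \<alpha> j))) (at x)"
proof -
  have "((\<lambda>x :: real ^ 'd. (x $ i) ^ \<alpha> i) has_derivative (\<lambda>h. h $ i * (real (\<alpha> i) * (x $ i) ^ (\<alpha> i - 1)))) (at x)" for i
    using has_derivative_power[where n="\<alpha> i", OF bounded_linear_imp_has_derivative[OF bounded_linear_vec_nth[of i], of "at x"]]
    by (simp only: mult_ac)
  then show ?thesis by (intro has_derivative_prod)
qed

lemma tensor_polys_derivative:
  fixes f :: "real ^ 'd::finite \<Rightarrow> real"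
  assumes "f \<in> tensor_polys k"
  shows "f differentiable (at x)" and "partial_deriv i f \<in> tensor_polys k"
proof -
  have d: "f differentiable (at x)" if "f \<in> tensor_polys k" for f :: "real ^ 'd \<Rightarrow> real" and x
    using that
  proof (induction)
    case (monomial \<alpha> a)
    have "(\<lambda>x :: real ^ 'd. \<Prod>i\<in>UNIV. (x $ i) ^ \<alpha> i) differentiable (at x)"
      using has_derivative_monomial unfolding differentiable_def by blast
    then show ?case by (intro differentiable_mult) auto
  qed (auto intro: differentiable_add)
  then show "f differentiable (at x)" using assms .
  show "partial_deriv i f \<in> tensor_polys k"
    using assms
  proof induction
    case (monomial \<alpha> a)
    let ?m = "\<lambda>x :: real ^ 'd. \<Prod>i\<in>UNIV. (x $ i) ^ \<alpha> i"
    \<comment> \<open>For \<open>\<alpha> i = 0\<close> truncated subtraction leaves the exponent 0,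
      and the factor \<open>real (\<alpha> i)\<close> kills the term.\<close>
    let ?\<beta> = "\<alpha>(i := \<alpha> i - 1)"
    have m: "?m differentiable (at x)" for x
      using has_derivative_monomial unfolding differentiable_def by blast
    have pd: "partial_deriv i ?m x = real (\<alpha> i) * (\<Prod>j\<in>UNIV. (x $ j) ^ ?\<beta> j)" for x
    proof -
      have "partial_deriv i ?m x = (\<Sum>j\<in>UNIV. if j = i then real (\<alpha> j) * (x $ j) ^ (\<alpha> j - 1) * (\<Prod>j\<in>UNIV - {j}. (x $ j) ^ \<alpha> j) else 0)"
        unfolding partial_deriv_eq[OF has_derivative_monomial] by (intro sum.cong) (auto simp: axis_def)
      also have "\<dots> = real (\<alpha> i) * ((x $ i) ^ ?\<beta> i * (\<Prod>j\<in>UNIV - {i}. (x $ j) ^ ?\<beta> j))"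
        by (simp cong: prod.cong_simp)
      also have "\<dots> = real (\<alpha> i) * (\<Prod>j\<in>UNIV. (x $ j) ^ ?\<beta> j)"
        by (subst (2) prod.remove[of _ i]) auto
      finally show ?thesis .
    qed
    have "partial_deriv i (\<lambda>x. a * ?m x) = (\<lambda>x. (a * real (\<alpha> i)) * (\<Prod>j\<in>UNIV. (x $ j) ^ ?\<beta> j))"
      by (rule ext, subst partial_deriv_cmult[OF m], subst pd) (simp only: mult.assoc)
    also have "\<dots> \<in> tensor_polys k"
    proof (rule tensor_polys.monomial)
      show "?\<beta> j \<le> k" for j using monomial[of j] by auto
    qed
    finally show ?case .
  next
    case (add f g)
    have "partial_deriv i (\<lambda>x. f x + g x) = (\<lambda>x. partial_deriv i f x + partial_deriv i g x)"
      using add d by (auto simp: fun_eq_iff partial_deriv_add)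
    then show ?case using add by (auto intro: tensor_polys.add)
  qed
qed

lemma tensor_polys_continuous: "f \<in> tensor_polys k \<Longrightarrow> continuous_on A f"
  by (meson continuous_at_imp_continuous_on differentiable_imp_continuous_within tensor_polys_derivative(1))

text \<open>Parallel to an axis only one variable moves, so the degree does not grow with the
  dimension and the weight k^2 of the one-dimensional formula carries over.\<close>

lemma tensor_polys_line:
  fixes f :: "real ^ 'd::finite \<Rightarrow> real"
  assumes "f \<in> tensor_polys k"
  shows "\<exists>p. degree p \<le> k \<and> (\<forall>t. f (x + (a * t + b) *\<^sub>R axis i 1) = poly p t)"
  using assms
proof induction
  case (monomial \<alpha> c)
  let ?C = "c * (\<Prod>j\<in>UNIV - {i}. (x $ j) ^ \<alpha> j)"
  let ?p = "smult ?C ([:x $ i + b, a:] ^ \<alpha> i)"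
  have "degree ?p \<le> degree ([:x $ i + b, a:] ^ \<alpha> i)" by (rule degree_smult_le)
  also have "\<dots> \<le> degree [:x $ i + b, a:] * \<alpha> i" by (rule degree_power_le)
  also have "\<dots> \<le> 1 * \<alpha> i" by (intro mult_right_mono) auto
  also have "\<dots> \<le> k" using monomial by simp
  finally have "degree ?p \<le> k" .
  moreover have "c * (\<Prod>j\<in>UNIV. ((x + (a * t + b) *\<^sub>R axis i 1) $ j) ^ \<alpha> j) = poly ?p t" for t
  proof -
    have "(\<Prod>j\<in>UNIV. ((x + (a * t + b) *\<^sub>R axis i 1) $ j) ^ \<alpha> j)
       = (x $ i + (a * t + b)) ^ \<alpha> i * (\<Prod>j\<in>UNIV - {i}. (x $ j) ^ \<alpha> j)"
      by (subst prod.remove[of _ i]) (auto simp: axis_def intro!: prod.cong)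
    moreover have "poly [:x $ i + b, a:] t = x $ i + (a * t + b)" by simp
    ultimately show ?thesis by (simp only: poly_smult poly_power mult_ac)
  qed
  ultimately show ?case by blast
next
  case (add f g)
  then obtain p q where "degree p \<le> k" "\<forall>t. f (x + (a * t + b) *\<^sub>R axis i 1) = poly p t"
    "degree q \<le> k" "\<forall>t. g (x + (a * t + b) *\<^sub>R axis i 1) = poly q t" by blast
  then show ?case by (intro exI[of _ "p + q"]) (auto intro: degree_add_le)
qed

text \<open>Reading off the derivative at \<open>x\<close> from values on a segment that ends in \<open>x\<close> and points away
  from the nearest face of the cube.\<close>

lemma tensor_polys_partial_deriv_quadrature:
  assumes "k \<ge> 1"
  shows "\<exists>c y. (\<Sum>r\<le>k. \<bar>c r\<bar>) = 4 * (real k)\<^sup>2 \<and> (\<forall>r\<le>k. 0 \<le> y r \<and> y r \<le> 1/2) \<and>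
    (\<forall>f\<in>tensor_polys k. \<forall>i. \<forall>x :: real ^ 'd::finite. \<forall>s\<in>{-1, 1}.
       partial_deriv i f x = (\<Sum>r\<le>k. s * c r * f (x + (- s * y r) *\<^sub>R axis i 1)))"
proof -
  obtain c z where z: "\<And>r. r \<le> k \<Longrightarrow> \<bar>z r\<bar> \<le> 1" and c: "(\<Sum>r\<le>k. \<bar>c r\<bar>) = (real k)\<^sup>2"
    and form: "\<And>p :: real poly. degree p \<le> k \<Longrightarrow> poly (pderiv p) 1 = (\<Sum>r\<le>k. c r * poly p (z r))"
    using markov_quadrature[OF assms] by blast
  have q: "partial_deriv i f x = (\<Sum>r\<le>k. s * (4 * c r) * f (x + (- s * ((1 - z r) / 4)) *\<^sub>R axis i 1))"
    if f: "f \<in> tensor_polys k" and s: "s \<in> {-1, 1}" for f i and x :: "real ^ 'd" and s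
  proof -
    \<comment> \<open>The substitution sends \<open>t = 1\<close> to \<open>x\<close> and
      \<open>[-1, 1]\<close> onto a segment of length 1/2 in direction \<open>-s\<close>; its slope
      \<open>s / 4\<close> is the origin of the factor 4 in the weights.\<close>
    obtain p where p: "degree p \<le> k" "\<And>t. f (x + (s / 4 * t + (- s / 4)) *\<^sub>R axis i 1) = poly p t"
      using tensor_polys_line[OF f] by blast
    have "((\<lambda>t. f (x + t *\<^sub>R axis i 1)) has_real_derivative partial_deriv i f (x + (s / 4 * 1 + (- s / 4)) *\<^sub>R axis i 1))
        (at (s / 4 * 1 + (- s / 4)))"
      by (rule partial_deriv_line[OF tensor_polys_derivative(1)[OF f]])
    moreover have "((\<lambda>t. s / 4 * t + (- s / 4)) has_real_derivative s / 4) (at 1)"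
      by (auto intro!: derivative_eq_intros)
    ultimately have "((\<lambda>t. f (x + (s / 4 * t + (- s / 4)) *\<^sub>R axis i 1)) has_real_derivative
      partial_deriv i f (x + (s / 4 * 1 + (- s / 4)) *\<^sub>R axis i 1) * (s / 4)) (at 1)"
      by (rule DERIV_chain2)
    then have "(poly p has_real_derivative partial_deriv i f x * (s / 4)) (at 1)" unfolding p(2) by simp
    then have "poly (pderiv p) 1 = partial_deriv i f x * (s / 4)" by (rule DERIV_unique[OF poly_DERIV])
    moreover have "s * s = 1" using s by auto
    ultimately have "partial_deriv i f x = s * 4 * poly (pderiv p) 1"
      by (simp add: algebra_simps)
    also have "\<dots> = (\<Sum>r\<le>k. s * (4 * c r) * poly p (z r))"
      unfolding form[OF p(1)] sum_distrib_left by (intro sum.cong refl) simp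
    also have "\<dots> = (\<Sum>r\<le>k. s * (4 * c r) * f (x + (- s * ((1 - z r) / 4)) *\<^sub>R axis i 1))"
    proof (intro sum.cong refl)
      fix r
      have "s / 4 * z r + (- s / 4) = - s * ((1 - z r) / 4)" by (simp add: field_simps)
      then show "s * (4 * c r) * poly p (z r) = s * (4 * c r) * f (x + (- s * ((1 - z r) / 4)) *\<^sub>R axis i 1)"
        using p(2)[of "z r"] by (simp only:)
    qed
    finally show ?thesis .
  qed
  have w: "(\<Sum>r\<le>k. \<bar>4 * c r\<bar>) = 4 * (real k)\<^sup>2"
    unfolding c[symmetric] sum_distrib_left by (simp add: abs_mult)
  have y: "\<forall>r\<le>k. 0 \<le> (1 - z r) / 4 \<and> (1 - z r) / 4 \<le> 1/2"
  proof (intro allI impI)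
    fix r assume "r \<le> k"
    from z[OF this] have "z r \<le> 1" "- 1 \<le> z r" by linarith+
    then show "0 \<le> (1 - z r) / 4 \<and> (1 - z r) / 4 \<le> 1/2" by simp
  qed
  show ?thesis
    by (rule exI[of _ "\<lambda>r. 4 * c r"], rule exI[of _ "\<lambda>r. (1 - z r) / 4"]) (intro conjI ballI allI w y q)
qed

section \<open>Norms of functions restricted to or translated within a set\<close>

lemma continuous_Lp_space_infinity:
  fixes f :: "'a::euclidean_space \<Rightarrow> real"
  assumes f: "continuous_on UNIV f" and U: "bounded U"
  shows "f \<in> Lp_space \<infinity> U"
proof -
  have "compact (closure U)" using U by simp
  then have "bounded (f ` closure U)"
    by (intro compact_imp_bounded compact_continuous_image continuous_on_subset[OF f]) auto
  then obtain B where B: "\<forall>x\<in>closure U. \<bar>f x\<bar> \<le> B" by (auto simp: bounded_iff)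
  have "f \<in> borel_measurable lebesgue"
    using borel_measurable_continuous_onI[OF f] by (simp add: measurable_completion)
  then have "f \<in> borel_measurable (lebesgue_on U)" by (rule measurable_restrict_space1)
  moreover have "AE x in lebesgue_on U. \<bar>f x\<bar> \<le> B"
    using B closure_subset[of U] by (intro AE_I2) auto
  ultimately show ?thesis by (rule Lp_space_infinityI)
qed

lemma Lp_space_infinity_subset:
  assumes f: "f \<in> Lp_space \<infinity> U" and S: "S \<subseteq> U" "S \<in> sets lebesgue" "U \<in> sets lebesgue"
  shows "f \<in> Lp_space \<infinity> S"
proof -
  obtain c where "AE x in lebesgue_on U. \<bar>f x\<bar> \<le> c" using f by (auto simp: Lp_space_infinity_iff)
  then have "AE x in lebesgue. x \<in> U \<longrightarrow> \<bar>f x\<bar> \<le> c" using S by (simp add: AE_restrict_space_iff)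
  then have "AE x in lebesgue. x \<in> S \<longrightarrow> \<bar>f x\<bar> \<le> c" by (rule eventually_mono) (use S in auto)
  then have "AE x in lebesgue_on S. \<bar>f x\<bar> \<le> c" using S by (simp add: AE_restrict_space_iff)
  moreover have "f \<in> borel_measurable (lebesgue_on S)"
    using Lp_space_infinity_measurable[OF f] S(1) by (rule measurable_restrict_mono)
  ultimately show ?thesis by (rule Lp_space_infinityI[rotated])
qed

lemma Lp_norm_indicator:
  fixes g :: "'a::euclidean_space \<Rightarrow> real"
  assumes g: "g \<in> Lp_space \<infinity> S" and S: "S \<subseteq> U" "S \<in> sets lebesgue" "U \<in> sets lebesgue" and p: "1 \<le> p"
  shows "(\<lambda>x. indicator S x * g x) \<in> Lp_space \<infinity> U"
    and "Lp_norm p U (\<lambda>x. indicator S x * g x) = Lp_norm p S g"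
proof -
  let ?g = "\<lambda>x. indicator S x * g x"
  have "(\<lambda>x. if x \<in> S then g x else 0) = ?g" by (auto simp: fun_eq_iff)
  with borel_measurable_if_lebesgue_on[OF S(2,3,1), of g] Lp_space_infinity_measurable[OF g]
  have m: "?g \<in> borel_measurable (lebesgue_on U)" by simp
  have AE: "(AE x in lebesgue_on U. \<bar>?g x\<bar> \<le> c) \<longleftrightarrow> (AE x in lebesgue_on S. \<bar>g x\<bar> \<le> c)" if "c \<ge> 0" for c
  proof -
    have "(x \<in> U \<longrightarrow> \<bar>?g x\<bar> \<le> c) \<longleftrightarrow> (x \<in> S \<longrightarrow> \<bar>g x\<bar> \<le> c)" for x
      using S(1) that by (cases "x \<in> S") auto
    then show ?thesis using S by (simp add: AE_restrict_space_iff)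
  qed
  have "AE x in lebesgue_on S. \<bar>g x\<bar> \<le> Lp_norm \<infinity> S g" by (rule AE_le_Lp_norm_infinity[OF g])
  then have AE1: "AE x in lebesgue_on U. \<bar>?g x\<bar> \<le> Lp_norm \<infinity> S g"
    by (rule AE[OF Lp_norm_nonneg, THEN iffD2])
  show G: "?g \<in> Lp_space \<infinity> U" by (rule Lp_space_infinityI[OF m AE1])
  show "Lp_norm p U ?g = Lp_norm p S g"
    using p
  proof (cases rule: ennreal_exponent_cases)
    case 1
    have "Lp_norm \<infinity> U ?g \<le> Lp_norm \<infinity> S g" by (rule Lp_norm_infinity_le[OF m AE1 Lp_norm_nonneg])
    moreover have "AE x in lebesgue_on S. \<bar>g x\<bar> \<le> Lp_norm \<infinity> U ?g"
      by (rule AE[OF Lp_norm_nonneg, THEN iffD1, OF AE_le_Lp_norm_infinity[OF G]])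
    then have "Lp_norm \<infinity> S g \<le> Lp_norm \<infinity> U ?g"
      by (rule Lp_norm_infinity_le[OF Lp_space_infinity_measurable[OF g] _ Lp_norm_nonneg])
    ultimately show ?thesis using 1 by simp
  next
    case (2 r)
    have "(\<integral>x. \<bar>?g x\<bar> powr r \<partial>lebesgue_on U) = (\<integral>x. indicator U x *\<^sub>R \<bar>?g x\<bar> powr r \<partial>lebesgue)"
      using S by (intro integral_restrict_space) auto
    also have "(\<lambda>x. indicator U x *\<^sub>R \<bar>?g x\<bar> powr r) = (\<lambda>x. indicator S x *\<^sub>R \<bar>g x\<bar> powr r)"
    proof
      fix x show "indicator U x *\<^sub>R \<bar>?g x\<bar> powr r = indicator S x *\<^sub>R \<bar>g x\<bar> powr r"
        using S(1) by (cases "x \<in> S") auto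
    qed
    also have "(\<integral>x. indicator S x *\<^sub>R \<bar>g x\<bar> powr r \<partial>lebesgue) = (\<integral>x. \<bar>g x\<bar> powr r \<partial>lebesgue_on S)"
      using S by (intro integral_restrict_space[symmetric]) auto
    finally show ?thesis using 2 by (simp add: Lp_norm_finite)
  qed
qed

lemma Lp_norm_subset:
  fixes f :: "'a::euclidean_space \<Rightarrow> real"
  assumes f: "f \<in> Lp_space \<infinity> U" and S: "S \<subseteq> U" "S \<in> sets lebesgue" and U: "U \<in> lmeasurable" and p: "1 \<le> p"
  shows "Lp_norm p S f \<le> Lp_norm p U f"
proof -
  have Us: "U \<in> sets lebesgue" using U by auto
  note fS = Lp_space_infinity_subset[OF f S Us]
  have "Lp_norm p S f = Lp_norm p U (\<lambda>x. indicator S x * f x)"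
    by (rule Lp_norm_indicator(2)[OF fS S Us p, symmetric])
  also have "\<dots> \<le> Lp_norm p U f"
    using Lp_norm_indicator(1)[OF fS S Us p]
    by (intro Lp_norm_AE_mono Lp_space_infinity_measurable f U p) (auto simp: indicator_def)
  finally show ?thesis .
qed

text \<open>The indicator keeps only points whose translates stay in \<open>U\<close>, so by
  translation invariance the norm is that of \<open>f\<close> over a subset of
  \<open>U\<close>.\<close>

lemma Lp_norm_shift_le:
  fixes f :: "'a::euclidean_space \<Rightarrow> real"
  assumes f: "f \<in> Lp_space \<infinity> U" and S: "S \<subseteq> U" "S \<in> sets lebesgue" "(\<lambda>x. x + a) ` S \<subseteq> U"
    and U: "U \<in> lmeasurable" and p: "1 \<le> p"
  shows "(\<lambda>x. indicator S x * f (x + a)) \<in> Lp_space \<infinity> U"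
    and "Lp_norm p U (\<lambda>x. indicator S x * f (x + a)) \<le> Lp_norm p U f"
proof -
  have Us: "U \<in> sets lebesgue" using U by auto
  note j = has_jacobian_translation[of a]
  let ?S = "(\<lambda>x. x + a) ` S"
  have Ss: "?S \<in> sets lebesgue" by (rule has_jacobian_image_sets[OF j S(2)])
  have fS: "f \<in> Lp_space \<infinity> ?S" by (rule Lp_space_infinity_subset[OF f S(3) Ss Us])
  then have gS: "(\<lambda>x. f (x + a)) \<in> Lp_space \<infinity> S"
    by (simp add: Lp_space_infinity_image_has_jacobian[OF j S(2)])
  show "(\<lambda>x. indicator S x * f (x + a)) \<in> Lp_space \<infinity> U"
    by (rule Lp_norm_indicator(1)[OF gS S(1,2) Us p])
  have "Lp_norm p U (\<lambda>x. indicator S x * f (x + a)) = Lp_norm p S (\<lambda>x. f (x + a))"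
    by (rule Lp_norm_indicator(2)[OF gS S(1,2) Us p])
  also have "\<dots> = Lp_norm p ?S f"
    using Lp_norm_image_has_jacobian[OF j S(2) p fS] by simp
  also have "\<dots> \<le> Lp_norm p U f" by (rule Lp_norm_subset[OF f S(3) Ss U p])
  finally show "Lp_norm p U (\<lambda>x. indicator S x * f (x + a)) \<le> Lp_norm p U f" .
qed

section \<open>Markov and Nikolskii inequalities on the reference cube\<close>

lemma interior_ref_cube: "interior (ref_cube :: (real ^ 'd::finite) set) = box (\<chi> i. -1) (\<chi> i. 1)"
  by (simp add: ref_cube_def)

lemma mem_ref_cube: "x \<in> ref_cube \<longleftrightarrow> (\<forall>i. \<bar>x $ i\<bar> \<le> 1)"
  by (auto simp: ref_cube_def mem_box_cart abs_le_iff)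

lemma mem_interior_ref_cube: "x \<in> interior ref_cube \<longleftrightarrow> (\<forall>i. \<bar>x $ i\<bar> < 1)"
  unfolding interior_ref_cube mem_box_cart by (auto simp: abs_less_iff)

lemma interior_ref_cube_lmeasurable: "interior (ref_cube :: (real ^ 'd::finite) set) \<in> lmeasurable"
  by (simp add: interior_ref_cube)

lemma bounded_interior_ref_cube: "bounded (interior (ref_cube :: (real ^ 'd::finite) set))"
  by (simp add: interior_ref_cube)

lemma tensor_polys_Lp: "f \<in> tensor_polys k \<Longrightarrow> f \<in> Lp_space \<infinity> (interior ref_cube)"
  by (intro continuous_Lp_space_infinity tensor_polys_continuous bounded_interior_ref_cube)

text \<open>The cube is cut at \<open>x $ i = 0\<close>, and on each half the quadrature points are
  shifted towards the other half, hence stay in the cube. Each half contributes the weight 4 k^2,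
  together 8 k^2.\<close>

lemma tensor_polys_markov:
  fixes f :: "real ^ 'd::finite \<Rightarrow> real"
  assumes k: "k \<ge> 1" and f: "f \<in> tensor_polys k" and p: "1 \<le> p"
  shows "Lp_norm p (interior ref_cube) (partial_deriv i f) \<le> 8 * (real k)\<^sup>2 * Lp_norm p (interior ref_cube) f"
proof -
  let ?U = "interior ref_cube :: (real ^ 'd) set"
  obtain c y where c: "(\<Sum>r\<le>k. \<bar>c r\<bar>) = 4 * (real k)\<^sup>2" and y: "\<And>r. r \<le> k \<Longrightarrow> 0 \<le> y r \<and> y r \<le> 1/2"
    and form: "\<And>f i x s. f \<in> tensor_polys k \<Longrightarrow> s \<in> {-1, 1} \<Longrightarrow>
       partial_deriv i f (x :: real ^ 'd) = (\<Sum>r\<le>k. s * c r * f (x + (- s * y r) *\<^sub>R axis i 1))"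
    using tensor_polys_partial_deriv_quadrature[OF k, where 'd='d] by meson
  define S where "S s = {x \<in> ?U. if s = (1::real) then x $ i \<ge> 0 else x $ i < 0}" for s
  define a where "a s r = (- s * y r) *\<^sub>R axis i (1::real)" for s :: real and r
  have fL: "f \<in> Lp_space \<infinity> ?U" by (rule tensor_polys_Lp[OF f])
  have U: "?U \<in> lmeasurable" by (rule interior_ref_cube_lmeasurable)
  have Ss: "S s \<subseteq> ?U" "S s \<in> sets lebesgue" for s
  proof -
    show "S s \<subseteq> ?U" by (auto simp: S_def)
    have "{x :: real ^ 'd. x $ i \<ge> 0} \<in> sets borel" "{x :: real ^ 'd. x $ i < 0} \<in> sets borel"
      by (intro borel_closed closed_halfspace_component_ge_cart borel_open open_halfspace_component_lt_cart)+
    then have "?U \<inter> (if s = 1 then {x. x $ i \<ge> 0} else {x. x $ i < 0}) \<in> sets borel" by auto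
    moreover have "S s = ?U \<inter> (if s = 1 then {x. x $ i \<ge> 0} else {x. x $ i < 0})" by (auto simp: S_def)
    ultimately show "S s \<in> sets lebesgue" by simp
  qed
  have shift: "(\<lambda>x. x + a s r) ` S s \<subseteq> ?U" if "s \<in> {-1, 1}" "r \<le> k" for s r
  proof clarify
    fix x assume x: "x \<in> S s"
    have "\<bar>(x + a s r) $ j\<bar> < 1" for j
    proof -
      have "\<bar>x $ j\<bar> < 1" using x by (simp add: S_def mem_interior_ref_cube)
      then show ?thesis
        using x that y[of r] by (auto simp: S_def a_def axis_def abs_less_iff split: if_splits)
    qed
    then show "x + a s r \<in> ?U" by (simp add: mem_interior_ref_cube)
  qed
  let ?g = "\<lambda>s r x. indicator (S s) x * f (x + a s r)"
  have eq: "partial_deriv i f x = (\<Sum>r\<le>k. c r * ?g 1 r x) + (\<Sum>r\<le>k. (- c r) * ?g (-1) r x)" if "x \<in> ?U" for x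
  proof (cases "x $ i \<ge> 0")
    case True
    then have "indicator (S 1) x = (1::real)" "indicator (S (-1)) x = (0::real)" using that by (auto simp: S_def)
    then show ?thesis using form[OF f, of 1 i x] by (simp add: a_def)
  next
    case False
    then have "indicator (S 1) x = (0::real)" "indicator (S (-1)) x = (1::real)" using that by (auto simp: S_def)
    then show ?thesis using form[OF f, of "-1" i x] by (simp add: a_def)
  qed
  note g = Lp_norm_shift_le[OF fL Ss shift U p]
  have sumb: "(\<lambda>x. \<Sum>r\<le>k. e r * ?g s r x) \<in> Lp_space \<infinity> ?U"
    "Lp_norm p ?U (\<lambda>x. \<Sum>r\<le>k. e r * ?g s r x) \<le> (\<Sum>r\<le>k. \<bar>e r\<bar>) * Lp_norm p ?U f"
    if s: "s \<in> {-1, 1}" for s e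
  proof -
    show "(\<lambda>x. \<Sum>r\<le>k. e r * ?g s r x) \<in> Lp_space \<infinity> ?U"
      using g(1)[OF s] by (intro Lp_space_infinity_sum Lp_space_infinity_cmult) auto
    have "Lp_norm p ?U (\<lambda>x. \<Sum>r\<le>k. e r * ?g s r x) \<le> (\<Sum>r\<le>k. Lp_norm p ?U (\<lambda>x. e r * ?g s r x))"
      using g(1)[OF s] by (intro Lp_norm_sum U p Lp_space_infinity_cmult) auto
    also have "\<dots> \<le> (\<Sum>r\<le>k. \<bar>e r\<bar> * Lp_norm p ?U f)"
    proof (intro sum_mono)
      fix r assume "r \<in> {..k}"
      then have r: "r \<le> k" by simp
      show "Lp_norm p ?U (\<lambda>x. e r * ?g s r x) \<le> \<bar>e r\<bar> * Lp_norm p ?U f"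
        unfolding Lp_norm_cmult[OF g(1)[OF s r] p] by (intro mult_left_mono g(2)[OF s r]) simp
    qed
    finally show "Lp_norm p ?U (\<lambda>x. \<Sum>r\<le>k. e r * ?g s r x) \<le> (\<Sum>r\<le>k. \<bar>e r\<bar>) * Lp_norm p ?U f"
      by (simp add: sum_distrib_right)
  qed
  have L1: "(\<lambda>x. \<Sum>r\<le>k. c r * ?g 1 r x) \<in> Lp_space \<infinity> ?U" by (rule sumb(1)) simp
  have L2: "(\<lambda>x. \<Sum>r\<le>k. (- c r) * ?g (-1) r x) \<in> Lp_space \<infinity> ?U" by (rule sumb(1)) simp
  have "Lp_norm p ?U (partial_deriv i f)
    = Lp_norm p ?U (\<lambda>x. (\<Sum>r\<le>k. c r * ?g 1 r x) + (\<Sum>r\<le>k. (- c r) * ?g (-1) r x))"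
  proof (rule Lp_norm_AE_cong[OF _ Lp_space_infinity_measurable[OF Lp_space_infinity_add[OF L1 L2]] U p])
    show "partial_deriv i f \<in> Lp_space \<infinity> ?U" by (rule tensor_polys_Lp[OF tensor_polys_derivative(2)[OF f]])
    show "AE x in lebesgue_on ?U. partial_deriv i f x = (\<Sum>r\<le>k. c r * ?g 1 r x) + (\<Sum>r\<le>k. (- c r) * ?g (-1) r x)"
      by (intro AE_I2 eq) simp
  qed
  also have "\<dots> \<le> Lp_norm p ?U (\<lambda>x. \<Sum>r\<le>k. c r * ?g 1 r x) + Lp_norm p ?U (\<lambda>x. \<Sum>r\<le>k. (- c r) * ?g (-1) r x)"
    by (rule Lp_norm_triangle[OF L1 L2 U p])
  also have "\<dots> \<le> (\<Sum>r\<le>k. \<bar>c r\<bar>) * Lp_norm p ?U f + (\<Sum>r\<le>k. \<bar>- c r\<bar>) * Lp_norm p ?U f"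
    by (intro add_mono sumb(2)) auto
  also have "\<dots> = 8 * (real k)\<^sup>2 * Lp_norm p ?U f" by (simp add: c)
  finally show ?thesis .
qed

text \<open>The pointwise form on the closed cube is needed because a maximum point of
  \<open>\<bar>f\<bar>\<close> may lie on a face.\<close>

lemma tensor_polys_markov_sup:
  fixes f :: "real ^ 'd::finite \<Rightarrow> real"
  assumes k: "k \<ge> 1" and f: "f \<in> tensor_polys k" and M: "\<And>x. x \<in> ref_cube \<Longrightarrow> \<bar>f x\<bar> \<le> M"
    and x: "x \<in> ref_cube"
  shows "\<bar>partial_deriv i f x\<bar> \<le> 4 * (real k)\<^sup>2 * M"
proof -
  obtain c y where c: "(\<Sum>r\<le>k. \<bar>c r\<bar>) = 4 * (real k)\<^sup>2" and y: "\<And>r. r \<le> k \<Longrightarrow> 0 \<le> y r \<and> y r \<le> 1/2"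
    and form: "\<And>f i x s. f \<in> tensor_polys k \<Longrightarrow> s \<in> {-1, 1} \<Longrightarrow>
       partial_deriv i f (x :: real ^ 'd) = (\<Sum>r\<le>k. s * c r * f (x + (- s * y r) *\<^sub>R axis i 1))"
    using tensor_polys_partial_deriv_quadrature[OF k, where 'd='d] by meson
  define s :: real where "s = (if x $ i \<ge> 0 then 1 else -1)"
  have s: "s \<in> {-1, 1}" "\<bar>s\<bar> = 1" by (auto simp: s_def)
  have "\<bar>partial_deriv i f x\<bar> \<le> (\<Sum>r\<le>k. \<bar>s * c r * f (x + (- s * y r) *\<^sub>R axis i 1)\<bar>)"
    unfolding form[OF f s(1)] by (rule sum_abs)
  also have "\<dots> \<le> (\<Sum>r\<le>k. \<bar>c r\<bar> * M)"
  proof (intro sum_mono)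
    fix r assume "r \<in> {..k}"
    then have r: "r \<le> k" by simp
    have "\<bar>(x + (- s * y r) *\<^sub>R axis i 1) $ j\<bar> \<le> 1" for j
    proof -
      have "\<bar>x $ j\<bar> \<le> 1" using x by (simp add: mem_ref_cube)
      then show ?thesis
        using y[OF r] by (auto simp: axis_def s_def abs_le_iff split: if_splits)
    qed
    then have "x + (- s * y r) *\<^sub>R axis i 1 \<in> ref_cube" by (simp only: mem_ref_cube simp_thms)
    from M[OF this] show "\<bar>s * c r * f (x + (- s * y r) *\<^sub>R axis i 1)\<bar> \<le> \<bar>c r\<bar> * M"
      unfolding abs_mult s(2) by (intro mult_mono) auto
  qed
  finally show ?thesis by (simp add: c flip: sum_distrib_right)
qed

text \<open>On a box of side length \<open>1 / (8 d k\<^sup>2)\<close> with a corner at a maximum point \<open>x\<^sub>0\<close>, the Markov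
  inequality keeps \<open>\<bar>f\<bar>\<close> above half its maximum.\<close>

lemma tensor_polys_sup_le_Lp_norm:
  fixes f :: "real ^ 'd::finite \<Rightarrow> real"
  assumes k: "k \<ge> 1" and f: "f \<in> tensor_polys k" and q: "1 \<le> q" "q \<noteq> \<infinity>"
  shows "\<exists>M\<ge>0. (\<forall>x\<in>ref_cube. \<bar>f x\<bar> \<le> M) \<and>
    M \<le> 2 * (8 * real CARD('d) * (real k)\<^sup>2) powr (real CARD('d) * recip q) * Lp_norm q (interior ref_cube) f"
proof -
  let ?U = "interior ref_cube :: (real ^ 'd) set"
  let ?d = "real CARD('d)"
  obtain r where r: "r \<ge> 1" "q = ennreal r" "recip q = 1 / r"
    using q by (auto elim: ennreal_exponent_cases)
  have "compact (ref_cube :: (real ^ 'd) set)" "(ref_cube :: (real ^ 'd) set) \<noteq> {}"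
    using mem_ref_cube[of "0 :: real ^ 'd"] by (auto simp: ref_cube_def)
  then obtain x0 :: "real ^ 'd" where x0: "x0 \<in> ref_cube" "\<And>x. x \<in> ref_cube \<Longrightarrow> \<bar>f x\<bar> \<le> \<bar>f x0\<bar>"
    using continuous_attains_sup[of ref_cube "\<lambda>x. \<bar>f x\<bar>"] tensor_polys_continuous[OF f] continuous_on_rabs by blast
  define M where "M = \<bar>f x0\<bar>"
  \<comment> \<open>Chosen so that the d coordinates together change \<open>f\<close> by at most
    \<open>d * \<delta> * 4 * k^2 * M\<close>, which is \<open>M / 2\<close>.\<close>
  define \<delta> where "\<delta> = 1 / (8 * ?d * (real k)\<^sup>2)"
  have d1: "?d \<ge> 1" by (simp add: Suc_leI)
  have k1: "(real k)\<^sup>2 \<ge> 1" using k by simp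
  have \<delta>: "\<delta> > 0" "\<delta> \<le> 1"
  proof -
    have "8 * ?d * (real k)\<^sup>2 \<ge> 8 * 1 * 1" using d1 k1 by (intro mult_mono) auto
    then show "\<delta> > 0" "\<delta> \<le> 1" by (auto simp: \<delta>_def field_simps)
  qed
  \<comment> \<open>In each coordinate the box extends from \<open>x0\<close> towards the centre, so
    \<open>\<delta> \<le> 1\<close> keeps it inside the cube.\<close>
  define lo where "lo = (\<chi> i. if x0 $ i \<le> 0 then x0 $ i else x0 $ i - \<delta>)"
  define hi where "hi = (\<chi> i. lo $ i + \<delta>)"
  let ?B = "box lo hi"
  have close: "\<bar>x $ i - x0 $ i\<bar> \<le> \<delta>" if "x \<in> ?B" for x i
    using that \<delta> by (auto simp: mem_box_cart lo_def hi_def split: if_splits dest!: spec[of _ i])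
  have BU: "?B \<subseteq> ?U"
  proof
    fix x assume x: "x \<in> ?B"
    have "\<bar>x $ i\<bar> < 1" for i
    proof -
      have "lo $ i < x $ i" "x $ i < lo $ i + \<delta>" using x by (auto simp: mem_box_cart hi_def)
      moreover have "\<bar>x0 $ i\<bar> \<le> 1" using x0(1) by (simp add: mem_ref_cube)
      ultimately show ?thesis using \<delta> by (auto simp: lo_def abs_less_iff split: if_splits)
    qed
    then show "x \<in> ?U" by (simp add: mem_interior_ref_cube)
  qed
  have half: "\<bar>f x\<bar> \<ge> M / 2" if x: "x \<in> ?B" for x
  proof -
    have xc: "x \<in> ref_cube" using x BU interior_subset by blast
    let ?h = "x - x0"
    have "((\<lambda>t. f (x0 + t *\<^sub>R ?h)) has_real_derivative (\<Sum>i\<in>UNIV. ?h $ i * partial_deriv i f (x0 + t *\<^sub>R ?h))) (at t)" for t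
    proof -
      have "((\<lambda>t. x0 + t *\<^sub>R ?h) has_derivative (\<lambda>s. s *\<^sub>R ?h)) (at t)"
        by (auto intro!: derivative_eq_intros)
      from has_derivative_compose[OF this has_derivative_partial_deriv[OF tensor_polys_derivative(1)[OF f]]]
      show ?thesis
        by (rule has_derivative_imp_has_field_derivative) (simp add: sum_distrib_left mult_ac)
    qed
    then have "\<exists>t. 0 < t \<and> t < 1 \<and> f (x0 + 1 *\<^sub>R ?h) - f (x0 + 0 *\<^sub>R ?h)
      = (1 - 0) * (\<Sum>i\<in>UNIV. ?h $ i * partial_deriv i f (x0 + t *\<^sub>R ?h))"
      by (intro MVT2) auto
    then obtain t where t: "0 < t" "t < 1" "f x - f x0 = (\<Sum>i\<in>UNIV. ?h $ i * partial_deriv i f (x0 + t *\<^sub>R ?h))"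
      by auto
    have "convex (ref_cube :: (real ^ 'd) set)" by (simp add: ref_cube_def)
    then have "(1 - t) *\<^sub>R x0 + t *\<^sub>R x \<in> ref_cube" using x0(1) xc t by (intro convexD) auto
    then have z: "x0 + t *\<^sub>R ?h \<in> ref_cube" by (simp add: algebra_simps)
    have "\<bar>f x - f x0\<bar> \<le> (\<Sum>i\<in>UNIV. \<bar>?h $ i * partial_deriv i f (x0 + t *\<^sub>R ?h)\<bar>)"
      unfolding t(3) by (rule sum_abs)
    also have "\<dots> \<le> (\<Sum>i\<in>(UNIV :: 'd set). \<delta> * (4 * (real k)\<^sup>2 * M))"
      unfolding abs_mult using close[OF x] tensor_polys_markov_sup[OF k f x0(2) z] \<delta>
      by (intro sum_mono mult_mono) (auto simp: M_def)
    also have "\<dots> = M / 2" using k by (simp add: \<delta>_def field_simps)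
    finally show ?thesis unfolding M_def by linarith
  qed
  have Ulm: "?U \<in> lmeasurable" by (rule interior_ref_cube_lmeasurable)
  have mB: "measure lebesgue ?B = \<delta> ^ CARD('d)"
  proof -
    have "measure lborel ?B = (\<Prod>b\<in>Basis. (hi - lo) \<bullet> b)"
      using \<delta> by (intro measure_lborel_box) (auto simp: Basis_vec_def inner_axis hi_def)
    also have "\<dots> = (\<Prod>b\<in>(Basis :: (real ^ 'd) set). \<delta>)"
      by (intro prod.cong refl) (auto simp: Basis_vec_def inner_axis hi_def)
    finally show ?thesis by simp
  qed
  have fL: "f \<in> Lp_space \<infinity> ?U" by (rule tensor_polys_Lp[OF f])
  have "(M / 2) powr r * \<delta> ^ CARD('d) = (\<integral>x. (M / 2) powr r \<partial>lebesgue_on ?B)"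
    by (simp add: measure_restrict_space mB)
  also have "\<dots> \<le> (\<integral>x. \<bar>f x\<bar> powr r \<partial>lebesgue_on ?B)"
  proof (rule integral_mono)
    show "integrable (lebesgue_on ?B) (\<lambda>x. (M / 2) powr r)"
      by (intro finite_measure.integrable_const finite_measure_lebesgue_on) simp
    show "integrable (lebesgue_on ?B) (\<lambda>x. \<bar>f x\<bar> powr r)"
      using r by (intro integrable_powr_Lp_space_infinity Lp_space_infinity_subset[OF fL BU]) auto
    show "(M / 2) powr r \<le> \<bar>f x\<bar> powr r" if "x \<in> space (lebesgue_on ?B)" for x
      using that half[of x] r by (intro powr_mono2) (auto simp: M_def)
  qed
  finally have "((M / 2) powr r * \<delta> ^ CARD('d)) powr (1 / r) \<le> Lp_norm q ?B f"
    using r \<delta> by (auto simp: Lp_norm_finite intro!: powr_mono2)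
  also have "\<dots> \<le> Lp_norm q ?U f" by (intro Lp_norm_subset fL BU Ulm q) simp
  also have "((M / 2) powr r * \<delta> ^ CARD('d)) powr (1 / r) = M / 2 * \<delta> powr (?d * recip q)"
    using r \<delta> by (simp add: powr_mult powr_powr M_def powr_realpow[symmetric])
  finally have "M \<le> 2 * (\<delta> powr (- (?d * recip q))) * Lp_norm q ?U f"
    using \<delta> by (simp add: powr_minus field_simps)
  also have "\<delta> powr (- (?d * recip q)) = (8 * ?d * (real k)\<^sup>2) powr (?d * recip q)"
    by (simp add: \<delta>_def powr_minus powr_divide)
  finally show ?thesis using x0(2) by (intro exI[of _ M]) (auto simp: M_def)
qed

text \<open>Interpolation between the q-norm and the sup bound with
  \<open>\<theta> = recip p / recip q\<close>; the sup bound enters with the power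
  \<open>1 - \<theta>\<close>, and \<open>d * recip q * (1 - \<theta>)\<close> is
  \<open>d * (recip q - recip p)\<close>.\<close>

lemma tensor_polys_nikolskii:
  fixes f :: "real ^ 'd::finite \<Rightarrow> real"
  assumes k: "k \<ge> 1" and f: "f \<in> tensor_polys k" and q: "1 \<le> q" "q \<le> p" "q \<noteq> \<infinity>"
  shows "Lp_norm p (interior ref_cube) f
    \<le> 2 * (8 * real CARD('d) * (real k)\<^sup>2) powr (real CARD('d) * (recip q - recip p)) * Lp_norm q (interior ref_cube) f"
proof -
  let ?U = "interior ref_cube :: (real ^ 'd) set"
  let ?d = "real CARD('d)"
  let ?A = "8 * ?d * (real k)\<^sup>2"
  let ?N = "Lp_norm q ?U f"
  obtain M where M: "M \<ge> 0" "\<And>x. x \<in> ref_cube \<Longrightarrow> \<bar>f x\<bar> \<le> M" "M \<le> 2 * ?A powr (?d * recip q) * ?N"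
    using tensor_polys_sup_le_Lp_norm[OF k f q(1,3)] by blast
  have p: "1 \<le> p" using q by auto
  have A: "?A \<ge> 1"
  proof -
    have "?d \<ge> 1" "(real k)\<^sup>2 \<ge> 1" using k by (auto simp: Suc_leI)
    then have "?A \<ge> 8 * 1 * 1" by (intro mult_mono) auto
    then show ?thesis by simp
  qed
  have rq: "recip q > 0" using q by (auto elim!: ennreal_exponent_cases)
  have rpq: "recip p \<le> recip q" "recip p \<ge> 0"
    using recip_antimono[OF q(1,2)] recip_bounds[OF p] by auto
  define \<theta> where "\<theta> = recip p / recip q"
  have \<theta>: "0 \<le> \<theta>" "\<theta> \<le> 1" using rq rpq by (auto simp: \<theta>_def)
  have "AE x in lebesgue_on ?U. \<bar>f x\<bar> \<le> M" using M(2) interior_subset by (intro AE_I2) auto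
  then have "Lp_norm p ?U f \<le> M powr (1 - \<theta>) * ?N powr \<theta>"
    unfolding \<theta>_def by (intro Lp_norm_interpolation tensor_polys_Lp[OF f] interior_ref_cube_lmeasurable q M(1))
  also have "\<dots> \<le> (2 * ?A powr (?d * recip q) * ?N) powr (1 - \<theta>) * ?N powr \<theta>"
    using M \<theta> by (intro mult_right_mono powr_mono2) auto
  also have "\<dots> = 2 powr (1 - \<theta>) * ?A powr (?d * recip q * (1 - \<theta>)) * (?N powr (1 - \<theta>) * ?N powr \<theta>)"
    using A by (simp add: powr_mult powr_powr Lp_norm_nonneg)
  also have "?N powr (1 - \<theta>) * ?N powr \<theta> = ?N"
    using Lp_norm_nonneg[of q ?U f] by (simp flip: powr_add)
  also have "?d * recip q * (1 - \<theta>) = ?d * (recip q - recip p)"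
    using rq by (simp add: \<theta>_def field_simps)
  also have "2 powr (1 - \<theta>) * ?A powr (?d * (recip q - recip p)) * ?N \<le> 2 * ?A powr (?d * (recip q - recip p)) * ?N"
    using \<theta> powr_mono[of "1 - \<theta>" 1 2] by (intro mult_right_mono) (auto simp: Lp_norm_nonneg)
  finally show ?thesis .
qed

section \<open>Shape-regular parallelotopes\<close>

lemma interior_affine_map_image:
  fixes J :: "real ^ 'd::finite ^ 'd"
  assumes J: "invertible J"
  shows "interior (affine_map J b ` S) = affine_map J b ` interior S"
proof
  let ?F = "affine_map J b"
  have bij: "bij ?F" by (rule affine_map_bij(1)[OF J])
  have "?F ` interior S \<subseteq> ?F ` S" by (intro image_mono interior_subset)
  then show "?F ` interior S \<subseteq> interior (?F ` S)"
    by (intro interior_maximal open_image_affine_map J open_interior)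
  have o: "open (?F -` interior (?F ` S))"
    by (rule open_vimage[OF open_interior continuous_on_affine_map])
  have "?F -` interior (?F ` S) \<subseteq> ?F -` ?F ` S" by (intro vimage_mono interior_subset)
  also have "\<dots> = S" using bij by (simp add: bij_is_inj inj_vimage_image_eq)
  finally have "?F -` interior (?F ` S) \<subseteq> interior S" using o by (rule interior_maximal)
  then have "?F ` ?F -` interior (?F ` S) \<subseteq> ?F ` interior S" by (rule image_mono)
  then show "interior (?F ` S) \<subseteq> ?F ` interior S" using bij by (simp add: bij_is_surj surj_image_vimage_eq)
qed

text \<open>The inball diameter is a supremum, so a ball with more than half of it is taken; this
  costs a factor 2 and explains \<open>4 * \<sigma> * r\<close> and \<open>\<sigma> > 1 / 2\<close>.
  An interior point makes the supremum positive.\<close>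

lemma inball_diameter_lower:
  fixes T :: "(real ^ 'd::finite) set"
  assumes T: "bounded T" "interior T \<noteq> {}" and ratio: "diameter T / inball_diameter T \<le> \<sigma>"
  obtains x r where "r > 0" "cball x r \<subseteq> T" "2 * r \<le> diameter T" "diameter T \<le> 4 * \<sigma> * r" "\<sigma> > 1 / 2"
proof -
  let ?D = "{diameter (cball x r) | x r. 0 \<le> r \<and> cball x r \<subseteq> T}"
  obtain x0 r0 where b0: "r0 > 0" "cball x0 r0 \<subseteq> T"
    using T(2) mem_interior_cball[of _ T] by auto
  have bdd: "bdd_above ?D"
    by (rule bdd_aboveI[of _ "diameter T"]) (auto intro!: diameter_subset T simp del: diameter_cball)
  have "2 * r0 \<in> ?D"
    by (rule CollectI, intro exI[of _ x0] exI[of _ r0]) (use b0 in simp)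
  then have "2 * r0 \<le> inball_diameter T" unfolding inball_diameter_def by (rule cSup_upper[OF _ bdd])
  then have pos: "inball_diameter T > 0" using b0 by simp
  have "inball_diameter T / 2 < Sup ?D" using pos by (simp add: inball_diameter_def)
  then obtain z where "z \<in> ?D" "inball_diameter T / 2 < z"
    using less_cSupD[of ?D "inball_diameter T / 2"] \<open>2 * r0 \<in> ?D\<close> by blast
  then obtain x r where r: "0 \<le> r" "cball x r \<subseteq> T" "inball_diameter T / 2 < 2 * r" by auto
  have r0: "r > 0" using r pos by simp
  have d: "2 * r \<le> diameter T" using diameter_subset[OF r(2) T(1)] r(1) by simp
  have h: "diameter T \<le> \<sigma> * inball_diameter T" using ratio pos by (simp add: field_simps)
  have "0 < \<sigma> * inball_diameter T" using h d r0 by linarith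
  then have "\<sigma> > 0" by (rule zero_less_mult_pos2[OF _ pos])
  then have "\<sigma> * inball_diameter T < \<sigma> * (4 * r)" using r by (intro mult_strict_left_mono) auto
  then have h2: "diameter T < 4 * \<sigma> * r" using h by simp
  then have "2 * r < (2 * r) * (2 * \<sigma>)" using d by simp
  then have "\<sigma> > 1 / 2" using r0 by (simp add: mult_less_cancel_left)
  then show ?thesis using that r0 r(2) d h2 by simp
qed

text \<open>The inverse map sends the ball points \<open>x\<close> and
  \<open>x + r *\<^sub>R axis i 1\<close> into the cube of width 2, and their images differ by
  \<open>r\<close> times column \<open>i\<close> of the inverse matrix.\<close>

lemma matrix_inv_entry_bound:
  fixes J :: "real ^ 'd::finite ^ 'd"
  assumes J: "invertible J" and r: "r > 0" "cball x r \<subseteq> affine_map J b ` ref_cube"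
  shows "\<bar>matrix_inv J $ j $ i\<bar> \<le> 2 / r"
proof -
  let ?y = "x + r *\<^sub>R axis i 1"
  have mem: "matrix_inv J *v (z - b) \<in> ref_cube" if z: "z \<in> cball x r" for z
  proof -
    obtain w where "w \<in> ref_cube" "z = affine_map J b w" using z r(2) by blast
    then show ?thesis using matrix_inv_vector_mult[OF J] by (simp add: affine_map_def)
  qed
  have "?y \<in> cball x r" using r(1) by (simp add: dist_norm norm_axis_1)
  from mem[OF this] have 1: "\<bar>(matrix_inv J *v (?y - b)) $ j\<bar> \<le> 1" by (simp only: mem_ref_cube simp_thms)
  have "x \<in> cball x r" using r(1) by simp
  from mem[OF this] have 2: "\<bar>(matrix_inv J *v (x - b)) $ j\<bar> \<le> 1" by (simp only: mem_ref_cube simp_thms)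
  have "?y - b = (x - b) + r *\<^sub>R axis i 1" by simp
  then have "matrix_inv J *v (?y - b) = matrix_inv J *v (x - b) + r *\<^sub>R (matrix_inv J *v axis i 1)"
    by (simp only: matrix_vector_right_distrib matrix_vector_mult_scaleR)
  moreover have "(matrix_inv J *v axis i 1) $ j = matrix_inv J $ j $ i"
    by (simp add: matrix_vector_mul_component inner_axis)
  ultimately have "(matrix_inv J *v (?y - b)) $ j = (matrix_inv J *v (x - b)) $ j + r * matrix_inv J $ j $ i"
    by simp
  then have "\<bar>r * matrix_inv J $ j $ i\<bar> \<le> 2" using 1 2 by linarith
  then show ?thesis using r(1) by (simp add: abs_mult field_simps)
qed

lemma measure_cube_around:
  fixes y :: "real ^ 'd::finite"
  assumes "s \<ge> 0"
  shows "measure lebesgue (cbox (\<chi> i. y $ i - s) (\<chi> i. y $ i + s)) = (2 * s) ^ CARD('d)"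
proof -
  have "measure lborel (cbox (\<chi> i. y $ i - s) (\<chi> i. y $ i + s))
    = (\<Prod>b\<in>Basis. ((\<chi> i. y $ i + s) - (\<chi> i. y $ i - s)) \<bullet> b)"
    using assms by (intro measure_lborel_cbox) (auto simp: Basis_vec_def inner_axis)
  also have "\<dots> = (\<Prod>b\<in>(Basis :: (real ^ 'd) set). 2 * s)"
    by (intro prod.cong refl) (auto simp: Basis_vec_def inner_axis)
  finally show ?thesis by simp
qed

text \<open>\<open>T\<close> has volume \<open>2 ^ d * c\<close>. It lies in the cube of half side
  \<open>diameter T\<close> around \<open>x\<close> and contains the one of half side
  \<open>r / d\<close>, which fits into the ball because the Euclidean norm is at most the sum of
  the absolute coordinates.\<close>

lemma jacobian_bounds:
  fixes J :: "real ^ 'd::finite ^ 'd"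
  assumes F: "has_jacobian (affine_map J b) c" and T: "T = affine_map J b ` ref_cube"
    and r: "r > 0" "cball x r \<subseteq> T"
  shows "c \<le> diameter T ^ CARD('d)" "(r / real CARD('d)) ^ CARD('d) \<le> c"
proof -
  let ?d = "CARD('d)"
  have d1: "real ?d \<ge> 1" by (simp add: Suc_leI)
  have cube: "(ref_cube :: (real ^ 'd) set) = cbox (\<chi> i. 0 $ i - 1) (\<chi> i. 0 $ i + 1)"
    by (simp add: ref_cube_def)
  have mc: "measure lebesgue (ref_cube :: (real ^ 'd) set) = 2 ^ ?d"
    unfolding cube by (subst measure_cube_around) auto
  have cs: "(ref_cube :: (real ^ 'd) set) \<in> lmeasurable" by (simp add: ref_cube_def)
  then have cs': "(ref_cube :: (real ^ 'd) set) \<in> sets lebesgue" by auto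
  have mT: "measure lebesgue T = c * 2 ^ ?d" and Tl: "T \<in> lmeasurable"
    using measure_image_has_jacobian[OF F cs'] cs mc by (auto simp: T)
  have "compact T" unfolding T by (intro compact_continuous_image continuous_on_affine_map) (simp add: ref_cube_def)
  then have bT: "bounded T" by (rule compact_imp_bounded)
  let ?h = "diameter T"
  have h0: "?h \<ge> 0" by (rule diameter_ge_0[OF bT])
  have xT: "x \<in> T" using r by auto
  have "T \<subseteq> cbox (\<chi> i. x $ i - ?h) (\<chi> i. x $ i + ?h)"
  proof
    fix y assume "y \<in> T"
    then have "norm (y - x) \<le> ?h" using diameter_bounded_bound[OF bT _ xT] by (simp add: dist_norm)
    then have "\<bar>y $ i - x $ i\<bar> \<le> ?h" for i using component_le_norm_cart[of "y - x" i] by simp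
    then have "x $ i - ?h \<le> y $ i \<and> y $ i \<le> x $ i + ?h" for i by (simp add: abs_le_iff algebra_simps)
    then show "y \<in> cbox (\<chi> i. x $ i - ?h) (\<chi> i. x $ i + ?h)" by (simp add: mem_box_cart)
  qed
  then have "measure lebesgue T \<le> (2 * ?h) ^ ?d"
    using measure_mono_fmeasurable[OF _ fmeasurableD[OF Tl] lmeasurable_cbox] measure_cube_around[OF h0, of x] by metis
  then show "c \<le> ?h ^ ?d" unfolding mT by (simp add: power_mult_distrib)
  let ?s = "r / real ?d"
  have s0: "?s \<ge> 0" using r by simp
  have "cbox (\<chi> i. x $ i - ?s) (\<chi> i. x $ i + ?s) \<subseteq> cball x r"
  proof
    fix y assume "y \<in> cbox (\<chi> i. x $ i - ?s) (\<chi> i. x $ i + ?s)"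
    then have "\<bar>(y - x) $ i\<bar> \<le> ?s" for i by (simp add: mem_box_cart abs_le_iff algebra_simps)
    then have "(\<Sum>i\<in>UNIV. \<bar>(y - x) $ i\<bar>) \<le> (\<Sum>i\<in>(UNIV :: 'd set). ?s)" by (intro sum_mono)
    then have "norm (y - x) \<le> r" using norm_le_l1_cart[of "y - x"] d1 by simp
    then show "y \<in> cball x r" by (simp add: dist_norm norm_minus_commute)
  qed
  then have sub: "cbox (\<chi> i. x $ i - ?s) (\<chi> i. x $ i + ?s) \<subseteq> T" using r(2) by blast
  have "(2 * ?s) ^ ?d \<le> measure lebesgue T"
    unfolding measure_cube_around[OF s0, of x, symmetric]
    by (rule measure_mono_fmeasurable[OF sub _ Tl]) simp
  then show "?s ^ ?d \<le> c" unfolding mT by (simp only: power_mult_distrib mult.commute[of c] mult_le_cancel_left_pos zero_less_power zero_less_numeral)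
qed

text \<open>Nonnegative exponents use the upper bound for \<open>c\<close>, negative ones the lower
  bound. Since \<open>\<bar>e\<bar> \<le> 1\<close>, the constant can be given the fixed power
  \<open>d\<close>, free of the integrability exponents behind \<open>e\<close>.\<close>

lemma jacobian_powr_bound:
  fixes h \<sigma> c e r :: real and d :: nat
  assumes r: "r > 0" "2 * r \<le> h" "h \<le> 4 * \<sigma> * r" "\<sigma> > 1 / 2" and d: "d \<ge> 1"
    and c: "c \<le> h ^ d" "(r / real d) ^ d \<le> c" and e: "\<bar>e\<bar> \<le> 1"
  shows "c powr e \<le> (4 * \<sigma> * real d) ^ d * h powr (real d * e)"
proof -
  let ?B = "4 * \<sigma> * real d"
  have h: "h > 0" using r by simp
  have B1: "?B \<ge> 1"
  proof -
    have "4 * \<sigma> * real d \<ge> 2 * 1" using r d by (intro mult_mono) auto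
    then show ?thesis by simp
  qed
  have lb: "(h / ?B) ^ d \<le> c"
  proof -
    have "h / ?B \<le> r / real d" using r d by (simp add: field_simps)
    then have "(h / ?B) ^ d \<le> (r / real d) ^ d" using h B1 by (intro power_mono) auto
    then show ?thesis using c by simp
  qed
  have hB: "h / ?B > 0" using h B1 by simp
  then have c0: "c > 0" using lb zero_less_power[of "h / ?B" d] by linarith
  show ?thesis
  proof (cases "e \<ge> 0")
    case True
    have "c powr e \<le> (h ^ d) powr e" using c c0 True by (intro powr_mono2) auto
    also have "\<dots> = 1 * h powr (real d * e)" using h by (simp add: powr_realpow[symmetric] powr_powr)
    also have "\<dots> \<le> ?B ^ d * h powr (real d * e)" using B1 by (intro mult_right_mono) (auto simp: one_le_power)
    finally show ?thesis .
  next
    case False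
    have "c powr e \<le> ((h / ?B) ^ d) powr e" using lb False hB by (intro powr_mono2') auto
    also have "\<dots> = (h / ?B) powr (real d * e)" using hB by (simp add: powr_realpow[symmetric] powr_powr)
    also have "\<dots> = ?B powr (- (real d * e)) * h powr (real d * e)"
      using h B1 by (simp add: powr_divide powr_minus_divide)
    also have "?B powr (- (real d * e)) \<le> ?B powr (real d)"
    proof (rule powr_mono[OF _ B1])
      have "real d * (- e) \<le> real d * 1" using e by (intro mult_left_mono) auto
      then show "- (real d * e) \<le> real d" by simp
    qed
    also have "?B powr (real d) = ?B ^ d" using B1 by (simp add: powr_realpow)
    finally show ?thesis using h by (simp add: mult_right_mono)
  qed
qed

section \<open>The inverse estimate on an element\<close>

lemma finite_mi_order: "finite {\<alpha> :: 'd::finite \<Rightarrow> nat. mi_order \<alpha> \<le> l}"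
proof (rule finite_subset)
  show "{\<alpha> :: 'd \<Rightarrow> nat. mi_order \<alpha> \<le> l} \<subseteq> PiE UNIV (\<lambda>_. {..l})"
  proof
    fix \<alpha> :: "'d \<Rightarrow> nat" assume "\<alpha> \<in> {\<alpha>. mi_order \<alpha> \<le> l}"
    moreover have "\<alpha> i \<le> mi_order \<alpha>" for i unfolding mi_order_def by (rule member_le_sum) auto
    ultimately show "\<alpha> \<in> PiE UNIV (\<lambda>_. {..l})" by (auto intro: order_trans)
  qed
qed (auto intro: finite_PiE)

lemma zero_mi_order: "(\<lambda>_. 0) \<in> {\<alpha>. mi_order \<alpha> \<le> l}"
  by (simp add: mi_order_def)

lemma Lp_norm_wderiv_le_Sobolev_norm:
  assumes \<beta>: "mi_order \<beta> \<le> m" and q: "1 \<le> q"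
  shows "Lp_norm q U (wderiv U \<beta> v) \<le> Sobolev_norm m q U v"
  using q
proof (cases rule: ennreal_exponent_cases)
  case 1
  then show ?thesis using \<beta> finite_mi_order[of m] by (auto simp: Sobolev_norm_def intro!: Max_ge)
next
  case (2 s)
  let ?a = "\<lambda>\<alpha>. Lp_norm q U (wderiv U \<alpha> v)"
  have "?a \<beta> = (?a \<beta> powr s) powr (1 / s)" using 2 by (simp add: powr_powr abs_of_nonneg[OF Lp_norm_nonneg])
  also have "\<dots> \<le> (\<Sum>\<alpha> | mi_order \<alpha> \<le> m. ?a \<alpha> powr s) powr (1 / s)"
    using 2 \<beta> by (intro powr_mono2 member_le_sum finite_mi_order) auto
  finally show ?thesis using 2 by (simp add: Sobolev_norm_def)
qed

text \<open>For finite \<open>p\<close> the sum yields the cardinality to the power 1/p; the full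
  cardinality is a factor that works for every \<open>p\<close>.\<close>

lemma Sobolev_norm_le_card:
  fixes U :: "(real ^ 'd::finite) set"
  assumes X: "\<And>\<alpha>. mi_order \<alpha> \<le> l \<Longrightarrow> Lp_norm p U (wderiv U \<alpha> v) \<le> X" and p: "1 \<le> p"
  shows "Sobolev_norm l p U v \<le> real (card {\<alpha> :: 'd \<Rightarrow> nat. mi_order \<alpha> \<le> l}) * X"
proof -
  let ?I = "{\<alpha> :: 'd \<Rightarrow> nat. mi_order \<alpha> \<le> l}"
  have X0: "X \<ge> 0" using X[of "\<lambda>_. 0"] Lp_norm_nonneg[of p U] zero_mi_order[of l] by (auto intro: order_trans)
  have card: "real (card ?I) \<ge> 1"
  proof -
    have "card ?I > 0" using finite_mi_order[of l] zero_mi_order[of l] by (auto simp: card_gt_0_iff)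
    then show ?thesis by simp
  qed
  show ?thesis
    using p
  proof (cases rule: ennreal_exponent_cases)
    case 1
    have "Sobolev_norm l p U v \<le> X"
    proof -
      have "Max ((\<lambda>\<alpha>. Lp_norm p U (wderiv U \<alpha> v)) ` ?I) \<le> X"
        using X finite_mi_order[of l] zero_mi_order[of l] by (intro Max.boundedI) auto
      then show ?thesis using 1 by (simp add: Sobolev_norm_def)
    qed
    also have "\<dots> \<le> real (card ?I) * X" using card X0 mult_right_mono[of 1 "real (card ?I)" X] by simp
    finally show ?thesis .
  next
    case (2 r)
    let ?a = "\<lambda>\<alpha>. Lp_norm p U (wderiv U \<alpha> v)"
    have "(\<Sum>\<alpha>\<in>?I. ?a \<alpha> powr r) \<le> (\<Sum>\<alpha>\<in>?I. X powr r)"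
      using 2 X by (intro sum_mono powr_mono2) (auto simp: Lp_norm_nonneg)
    then have "Sobolev_norm l p U v \<le> (\<Sum>\<alpha>\<in>?I. X powr r) powr (1 / r)"
      using 2 by (auto simp: Sobolev_norm_def intro!: powr_mono2 sum_nonneg)
    also have "\<dots> = real (card ?I) powr (1 / r) * X"
      using 2 X0 by (simp add: powr_mult powr_powr)
    also have "\<dots> \<le> real (card ?I) powr 1 * X"
      using 2 card X0 by (intro mult_right_mono powr_mono) auto
    finally show ?thesis using card by simp
  qed
qed

text \<open>Uniqueness almost everywhere removes the choice made in \<open>wderiv\<close>;
  measurability of the chosen function comes from its local integrability.\<close>

lemma weak_deriv_Lp_norm_wderiv:
  fixes U :: "(real ^ 'd::finite) set"
  assumes U: "open U" "U \<in> lmeasurable" and wd: "weak_deriv U \<alpha> v w" and w: "w \<in> Lp_space \<infinity> U" and p: "1 \<le> p"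
  shows "Lp_norm p U (wderiv U \<alpha> v) = Lp_norm p U w"
proof -
  note wd' = weak_deriv_wderiv[OF wd]
  have "wderiv U \<alpha> v \<in> borel_measurable (lebesgue_on U)"
    using locally_integrable_measurable[OF U(1) weak_derivD(2)[OF wd']] .
  then show ?thesis
    using Lp_norm_AE_cong[OF w _ U(2) p weak_deriv_unique[OF U(1) wd wd']] by simp
qed

text \<open>The spaces \<open>V j\<close> contain the weak derivatives of order \<open>j\<close>. Derivatives of order at most \<open>m\<close>
  only change the exponent, and the remaining ones are taken one at a time.\<close>

lemma Sobolev_norm_inverse_estimate:
  fixes U :: "(real ^ 'd::finite) set" and V :: "nat \<Rightarrow> (real ^ 'd \<Rightarrow> real) set"
  assumes U: "open U" "U \<in> lmeasurable" and p: "1 \<le> p" and q: "1 \<le> q" and ml: "m \<le> l"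
    and VL: "\<And>j w. j \<le> l \<Longrightarrow> w \<in> V j \<Longrightarrow> w \<in> Lp_space \<infinity> U"
    and start: "weak_deriv U (count_list []) v v0" "v0 \<in> V 0"
    and step: "\<And>j w i. j < l \<Longrightarrow> w \<in> V j \<Longrightarrow>
      \<exists>w'\<in>V (Suc j). weak_deriv U (count_list [i]) w w' \<and> Lp_norm p U w' \<le> M * Lp_norm p U w"
    and nik: "\<And>j w. j \<le> l \<Longrightarrow> w \<in> V j \<Longrightarrow> Lp_norm p U w \<le> N * Lp_norm q U w"
    and MN: "M \<ge> 1" "N \<ge> 0"
  shows "Sobolev_norm l p U v
    \<le> real (card {\<alpha> :: 'd \<Rightarrow> nat. mi_order \<alpha> \<le> l}) * (M ^ (l - m) * N * Sobolev_norm m q U v)"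
proof (rule Sobolev_norm_le_card[OF _ p])
  let ?S = "Sobolev_norm m q U v"
  have S0: "?S \<ge> 0"
    using Lp_norm_wderiv_le_Sobolev_norm[OF _ q, of "\<lambda>_. 0" m U v] Lp_norm_nonneg[of q U "wderiv U (\<lambda>_. 0) v"] zero_mi_order[of m]
    by (auto intro: order_trans)
  \<comment> \<open>Up to order \<open>m\<close> the q-norm of the derivative is already part of the
    Sobolev norm on the right, so only the change of exponent is paid.\<close>
  have low: "Lp_norm p U w \<le> N * ?S"
    if w: "w \<in> V (length is)" "weak_deriv U (count_list is) v w" and len: "length is \<le> m" for w "is"
  proof -
    have l: "length is \<le> l" using len ml by simp
    have "Lp_norm q U w = Lp_norm q U (wderiv U (count_list is) v)"
      by (rule weak_deriv_Lp_norm_wderiv[OF U w(2) VL[OF l w(1)] q, symmetric])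
    also have "\<dots> \<le> ?S"
      using len by (intro Lp_norm_wderiv_le_Sobolev_norm q) (simp add: mi_order_count_list)
    finally show ?thesis using nik[OF l w(1)] MN by (meson mult_left_mono order_trans)
  qed
  \<comment> \<open>Truncated subtraction in \<open>length is - m\<close> charges no factor
    \<open>M\<close> up to order \<open>m\<close> and one for each derivative beyond it.\<close>
  have main: "\<exists>w\<in>V (length is). weak_deriv U (count_list is) v w \<and> Lp_norm p U w \<le> M ^ (length is - m) * (N * ?S)"
    if "length is \<le> l" for "is"
    using that
  proof (induction "is")
    case Nil
    have "Lp_norm p U v0 \<le> N * ?S" using low[of v0 "[]"] start by (simp del: count_list.simps)
    then have "Lp_norm p U v0 \<le> M ^ (length ([] :: 'd list) - m) * (N * ?S)" by simp
    moreover have "v0 \<in> V (length ([] :: 'd list))" using start(2) by simp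
    ultimately show ?case using start(1) by blast
  next
    case (Cons i js)
    then obtain w where w: "w \<in> V (length js)" "weak_deriv U (count_list js) v w"
      "Lp_norm p U w \<le> M ^ (length js - m) * (N * ?S)" by auto
    have "length js < l" using Cons by simp
    from step[OF this w(1), of i] obtain w' where w': "w' \<in> V (Suc (length js))"
      "weak_deriv U (count_list [i]) w w'" "Lp_norm p U w' \<le> M * Lp_norm p U w" by blast
    have wd: "weak_deriv U (count_list (i # js)) v w'" by (rule weak_deriv_Cons[OF w(2) w'(2)])
    have "Lp_norm p U w' \<le> M ^ (length (i # js) - m) * (N * ?S)"
    proof (cases "length (i # js) \<le> m")
      case True
      then show ?thesis using low[of w' "i # js"] w'(1) wd by simp
    next
      case False
      have "Lp_norm p U w' \<le> M * (M ^ (length js - m) * (N * ?S))"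
        using w'(3) w(3) MN by (meson mult_left_mono order_trans zero_le_one)
      also have "\<dots> = M ^ (length (i # js) - m) * (N * ?S)"
        using False by (simp add: Suc_diff_le)
      finally show ?thesis .
    qed
    moreover have "w' \<in> V (length (i # js))" using w'(1) by simp
    ultimately show ?case using wd by blast
  qed
  fix \<alpha> :: "'d \<Rightarrow> nat" assume \<alpha>: "mi_order \<alpha> \<le> l"
  obtain "is" where i: "count_list is = \<alpha>" using exists_list_with_counts by blast
  have len: "length is \<le> l" using \<alpha> i mi_order_count_list[of "is"] by simp
  from main[OF this] obtain w where w: "w \<in> V (length is)" "weak_deriv U \<alpha> v w"
    "Lp_norm p U w \<le> M ^ (length is - m) * (N * ?S)" unfolding i by blast
  have "Lp_norm p U (wderiv U \<alpha> v) = Lp_norm p U w"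
    by (rule weak_deriv_Lp_norm_wderiv[OF U w(2) VL[OF len w(1)] p])
  also have "\<dots> \<le> M ^ (length is - m) * (N * ?S)" by (rule w(3))
  \<comment> \<open>\<open>M \<ge> 1\<close> raises the bound for every order to the one for order
    \<open>l\<close>.\<close>
  also have "\<dots> \<le> M ^ (l - m) * (N * ?S)"
    using len MN S0 by (intro mult_right_mono power_increasing) auto
  finally show "Lp_norm p U (wderiv U \<alpha> v) \<le> M ^ (l - m) * N * ?S" by (simp add: mult.assoc)
qed

text \<open>The spaces on \<open>T\<close> are the images of the \<open>V j\<close> under
  composition with the inverse map. One derivative on \<open>T\<close> mixes all first derivatives
  on the cube, which is why \<open>V j\<close> has to be closed under linear combinations.\<close>

lemma inverse_estimate_affine:
  fixes J :: "real ^ 'd::finite ^ 'd" and V :: "nat \<Rightarrow> (real ^ 'd \<Rightarrow> real) set"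
  assumes p: "1 \<le> p" and q: "1 \<le> q" and ml: "m \<le> l"
    and VL: "\<And>j w. j \<le> l \<Longrightarrow> w \<in> V j \<Longrightarrow> w \<in> Lp_space \<infinity> (interior ref_cube)"
    and lin: "\<And>j w a. j \<le> l \<Longrightarrow> (\<And>i. w i \<in> V j) \<Longrightarrow> (\<lambda>x. \<Sum>i\<in>(UNIV :: 'd set). a i * w i x) \<in> V j"
    and start: "weak_deriv (interior ref_cube) (count_list []) v v0" "v0 \<in> V 0"
    and step: "\<And>j w i. j < l \<Longrightarrow> w \<in> V j \<Longrightarrow>
      \<exists>w'\<in>V (Suc j). weak_deriv (interior ref_cube) (count_list [i]) w w' \<and>
         Lp_norm p (interior ref_cube) w' \<le> M * Lp_norm p (interior ref_cube) w"
    and nik: "\<And>j w. j \<le> l \<Longrightarrow> w \<in> V j \<Longrightarrow>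
      Lp_norm p (interior ref_cube) w \<le> N * Lp_norm q (interior ref_cube) w"
    and MN: "M \<ge> 1" "N \<ge> 0"
    and J: "invertible J" and T: "T = affine_map J b ` ref_cube"
    and h1: "diameter T \<le> 1" and ratio: "diameter T / inball_diameter T \<le> \<sigma>"
  shows "diameter T > 0 \<and> \<sigma> > 1 / 2 \<and>
    Sobolev_norm l p (interior T) (v \<circ> inv (affine_map J b))
      \<le> real (card {\<alpha> :: 'd \<Rightarrow> nat. mi_order \<alpha> \<le> l}) *
        ((8 * \<sigma> * real CARD('d) * M / diameter T) ^ (l - m) *
         (N * ((4 * \<sigma> * real CARD('d)) ^ CARD('d) * diameter T powr (real CARD('d) * (recip p - recip q)))) *
         Sobolev_norm m q (interior T) (v \<circ> inv (affine_map J b)))"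
proof -
  let ?U = "interior ref_cube :: (real ^ 'd) set"
  let ?F = "affine_map J b"
  let ?G = "inv ?F"
  let ?d = "CARD('d)"
  let ?h = "diameter T"
  have d1: "real ?d \<ge> 1" by (simp add: Suc_leI)
  obtain c where c: "has_jacobian ?F c" using affine_map_has_jacobian[OF J] .
  have c0: "c > 0" using c by (simp add: has_jacobian_def)
  have bij: "bij ?F" by (rule affine_map_bij(1)[OF J])
  have GF: "?G (?F x) = x" for x using bij by (simp add: bij_is_inj)
  have int: "interior T = ?F ` ?U" unfolding T by (rule interior_affine_map_image[OF J])
  have U: "open ?U" "?U \<in> sets lebesgue" by auto
  have "0 \<in> ?U" by (simp add: mem_interior_ref_cube)
  then have ne: "interior T \<noteq> {}" unfolding int by auto
  have "compact T" unfolding T by (intro compact_continuous_image continuous_on_affine_map) (simp add: ref_cube_def)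
  then have bT: "bounded T" by (rule compact_imp_bounded)
  obtain x r where r: "r > 0" "cball x r \<subseteq> T" "2 * r \<le> ?h" "?h \<le> 4 * \<sigma> * r" "\<sigma> > 1 / 2"
    using inball_diameter_lower[OF bT ne ratio] .
  have h0: "?h > 0" using r by simp
  have entry: "\<bar>matrix_inv J $ j $ i\<bar> \<le> 8 * \<sigma> / ?h" for i j
  proof -
    have "\<bar>matrix_inv J $ j $ i\<bar> \<le> 2 / r" using r(1,2) unfolding T by (rule matrix_inv_entry_bound[OF J])
    also have "\<dots> \<le> 8 * \<sigma> / ?h" using r h0 by (simp add: field_simps)
    finally show ?thesis .
  qed
  have jac: "c powr e \<le> (4 * \<sigma> * real ?d) ^ ?d * ?h powr (real ?d * e)" if "\<bar>e\<bar> \<le> 1" for e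
    using jacobian_bounds[OF c T r(1,2)] that by (intro jacobian_powr_bound[OF r(1,3,4,5)]) (auto simp: Suc_leI)
  have UT: "open (?F ` ?U)" "?F ` ?U \<in> lmeasurable"
    using measure_image_has_jacobian(2)[OF c U(2) interior_ref_cube_lmeasurable] open_image_affine_map[OF J U(1)]
    by auto
  have Linf: "(\<lambda>y. w (?G y)) \<in> Lp_space \<infinity> (?F ` ?U)" if "w \<in> Lp_space \<infinity> ?U" for w
    using that by (simp add: Lp_space_infinity_image_has_jacobian[OF c U(2)] GF)
  have norm: "Lp_norm s (?F ` ?U) (\<lambda>y. w (?G y)) = c powr recip s * Lp_norm s ?U w"
    if "w \<in> Lp_space \<infinity> ?U" "1 \<le> s" for w s
    using Lp_norm_image_has_jacobian[OF c U(2) that(2) Linf[OF that(1)]] by (simp add: GF)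
  define W where "W j = (\<lambda>w y. w (?G y)) ` V j" for j
  \<comment> \<open>Cost of one derivative: \<open>d\<close> terms of the chain rule, entries of the
    inverse matrix of size at most \<open>8 * \<sigma> / ?h\<close>, and the factor \<open>M\<close>
    on the cube.\<close>
  define M' where "M' = 8 * \<sigma> * real ?d * M / ?h"
  define N' where "N' = N * ((4 * \<sigma> * real ?d) ^ ?d * ?h powr (real ?d * (recip p - recip q)))"
  have M': "M' \<ge> 1"
  proof -
    have "8 * \<sigma> * real ?d * M \<ge> (8 * \<sigma>) * 1 * 1" using r d1 MN by (intro mult_mono) auto
    then have "8 * \<sigma> * real ?d * M \<ge> ?h" using h1 r by linarith
    then show ?thesis using h0 by (simp add: M'_def)
  qed
  have N': "N' \<ge> 0" using MN r by (simp add: N'_def)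
  have "Sobolev_norm l p (?F ` ?U) (\<lambda>y. v (?G y)) \<le> real (card {\<alpha> :: 'd \<Rightarrow> nat. mi_order \<alpha> \<le> l}) *
      (M' ^ (l - m) * N' * Sobolev_norm m q (?F ` ?U) (\<lambda>y. v (?G y)))"
  proof (rule Sobolev_norm_inverse_estimate[where V=W, OF UT p q ml])
    show "w \<in> Lp_space \<infinity> (?F ` ?U)" if "j \<le> l" "w \<in> W j" for j w
      using that VL Linf by (auto simp: W_def)
    show "weak_deriv (?F ` ?U) (count_list []) (\<lambda>y. v (?G y)) (\<lambda>y. v0 (?G y))"
      by (rule weak_deriv_Nil_affine[OF J U(1) start(1)])
    show "(\<lambda>y. v0 (?G y)) \<in> W 0" using start(2) by (auto simp: W_def)
    show "M' \<ge> 1" "N' \<ge> 0" by (fact M' N')+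
    show "Lp_norm p (?F ` ?U) w \<le> N' * Lp_norm q (?F ` ?U) w" if j: "j \<le> l" "w \<in> W j" for j w
    proof -
      obtain u where u: "u \<in> V j" "w = (\<lambda>y. u (?G y))" using j by (auto simp: W_def)
      note uL = VL[OF j(1) u(1)]
      let ?e = "recip p - recip q"
      have e: "\<bar>?e\<bar> \<le> 1" using recip_bounds[OF p] recip_bounds[OF q] by linarith
      have "Lp_norm p (?F ` ?U) w \<le> c powr recip p * (N * Lp_norm q ?U u)"
        unfolding u(2) norm[OF uL p] by (intro mult_left_mono nik[OF j(1) u(1)]) simp
      \<comment> \<open>The Jacobian enters both norms, and only the quotient of its two powers
        survives.\<close>
      also have "\<dots> = N * c powr ?e * (c powr recip q * Lp_norm q ?U u)"
        using c0 by (simp add: powr_diff)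
      also have "\<dots> = N * c powr ?e * Lp_norm q (?F ` ?U) w" unfolding u(2) norm[OF uL q] ..
      also have "\<dots> \<le> N' * Lp_norm q (?F ` ?U) w"
        unfolding N'_def using MN(2) jac[OF e] by (intro mult_right_mono mult_left_mono Lp_norm_nonneg)
      finally show ?thesis .
    qed
    show "\<exists>w'\<in>W (Suc j). weak_deriv (?F ` ?U) (count_list [i]) w w' \<and>
        Lp_norm p (?F ` ?U) w' \<le> M' * Lp_norm p (?F ` ?U) w" if j: "j < l" "w \<in> W j" for j w i
    proof -
      obtain u where u: "u \<in> V j" "w = (\<lambda>y. u (?G y))" using j by (auto simp: W_def)
      have jl: "j \<le> l" "Suc j \<le> l" using j by auto
      note uL = VL[OF jl(1) u(1)]
      have "\<forall>n. \<exists>u'. u' \<in> V (Suc j) \<and> weak_deriv ?U (count_list [n]) u u' \<and> Lp_norm p ?U u' \<le> M * Lp_norm p ?U u"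
        using step[OF j(1) u(1)] by blast
      from choice[OF this] obtain g where g: "\<And>n. g n \<in> V (Suc j)" "\<And>n. weak_deriv ?U (count_list [n]) u (g n)"
        "\<And>n. Lp_norm p ?U (g n) \<le> M * Lp_norm p ?U u" by blast
      note gL = VL[OF jl(2) g(1)]
      let ?a = "\<lambda>n. matrix_inv J $ n $ i"
      let ?w' = "\<lambda>y. \<Sum>n\<in>UNIV. ?a n * g n (?G y)"
      have "(\<lambda>x. \<Sum>n\<in>UNIV. ?a n * g n x) \<in> V (Suc j)" by (rule lin[OF jl(2) g(1)])
      then have mem: "?w' \<in> W (Suc j)" by (auto simp: W_def)
      have wd: "weak_deriv (?F ` ?U) (count_list [i]) w ?w'"
        unfolding u(2) by (rule weak_deriv_affine[OF J U(1) g(2)])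
      have "Lp_norm p (?F ` ?U) ?w' \<le> (\<Sum>n\<in>UNIV. Lp_norm p (?F ` ?U) (\<lambda>y. ?a n * g n (?G y)))"
        by (intro Lp_norm_sum UT p Lp_space_infinity_cmult Linf gL)
      also have "\<dots> \<le> (\<Sum>n\<in>(UNIV :: 'd set). 8 * \<sigma> / ?h * (M * Lp_norm p (?F ` ?U) w))"
      proof (intro sum_mono)
        fix n
        have "Lp_norm p (?F ` ?U) (\<lambda>y. ?a n * g n (?G y)) = \<bar>?a n\<bar> * (c powr recip p * Lp_norm p ?U (g n))"
          unfolding norm[OF gL p, symmetric] by (intro Lp_norm_cmult Linf gL p)
        also have "\<dots> \<le> 8 * \<sigma> / ?h * (c powr recip p * (M * Lp_norm p ?U u))"
          using r h0 by (intro mult_mono entry mult_left_mono g(3)) (auto simp: Lp_norm_nonneg)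
        also have "\<dots> = 8 * \<sigma> / ?h * (M * Lp_norm p (?F ` ?U) w)"
          unfolding u(2) norm[OF uL p] by simp
        finally show "Lp_norm p (?F ` ?U) (\<lambda>y. ?a n * g n (?G y)) \<le> 8 * \<sigma> / ?h * (M * Lp_norm p (?F ` ?U) w)" .
      qed
      also have "\<dots> = M' * Lp_norm p (?F ` ?U) w" by (simp add: M'_def)
      finally show ?thesis using mem wd by blast
    qed
  qed
  then show ?thesis using h0 r(5) unfolding int M'_def N'_def o_def by blast
qed

section \<open>Finite-dimensional spaces on the reference cube\<close>

lemma Lp_coefficient_seminorm:
  assumes f: "\<And>s. s \<in> S \<Longrightarrow> f s \<in> Lp_space \<infinity> U" and U: "U \<in> lmeasurable" and p: "1 \<le> p"
  shows "coefficient_seminorm (\<lambda>u. Lp_norm p U (\<lambda>x. \<Sum>s\<in>S. u s * f s x))"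
  unfolding coefficient_seminorm_def
proof (intro conjI allI)
  have L: "(\<lambda>x. \<Sum>s\<in>S. u s * f s x) \<in> Lp_space \<infinity> U" for u
    by (intro Lp_space_infinity_sum Lp_space_infinity_cmult f)
  fix c d :: "'a \<Rightarrow> real" and a :: real
  show "Lp_norm p U (\<lambda>x. \<Sum>s\<in>S. (c s + d s) * f s x)
    \<le> Lp_norm p U (\<lambda>x. \<Sum>s\<in>S. c s * f s x) + Lp_norm p U (\<lambda>x. \<Sum>s\<in>S. d s * f s x)"
    using Lp_norm_triangle[OF L L U p, of c d] by (simp add: distrib_right sum.distrib)
  show "Lp_norm p U (\<lambda>x. \<Sum>s\<in>S. a * c s * f s x) = \<bar>a\<bar> * Lp_norm p U (\<lambda>x. \<Sum>s\<in>S. c s * f s x)"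
    using Lp_norm_cmult[OF L p, of a c] by (simp add: sum_distrib_left mult.assoc)
qed

text \<open>Vanishing almost everywhere does not depend on the exponent, so one kernel condition
  serves all \<open>p\<close> and \<open>q\<close>. With \<open>g = f\<close> two norms are
  compared; with derivatives in place of \<open>g\<close> the differentiation map is
  bounded.\<close>

lemma finite_dimensional_Lp_bound:
  fixes f g :: "'i \<Rightarrow> 'a::euclidean_space \<Rightarrow> real"
  assumes S: "finite S" and f: "\<And>s. s \<in> S \<Longrightarrow> f s \<in> Lp_space \<infinity> U" and g: "\<And>s. s \<in> S \<Longrightarrow> g s \<in> Lp_space \<infinity> U"
    and U: "U \<in> lmeasurable" and p: "1 \<le> p" and q: "1 \<le> q"
    and ker: "\<And>u. AE x in lebesgue_on U. (\<Sum>s\<in>S. u s * f s x) = 0 \<Longrightarrow> AE x in lebesgue_on U. (\<Sum>s\<in>S. u s * g s x) = 0"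
  shows "\<exists>C\<ge>0. \<forall>u. Lp_norm p U (\<lambda>x. \<Sum>s\<in>S. u s * g s x) \<le> C * Lp_norm q U (\<lambda>x. \<Sum>s\<in>S. u s * f s x)"
proof -
  have Lf: "(\<lambda>x. \<Sum>s\<in>S. u s * f s x) \<in> Lp_space \<infinity> U" for u
    by (intro Lp_space_infinity_sum Lp_space_infinity_cmult f)
  have Lg: "(\<lambda>x. \<Sum>s\<in>S. u s * g s x) \<in> Lp_space \<infinity> U" for u
    by (intro Lp_space_infinity_sum Lp_space_infinity_cmult g)
  have "Lp_norm p U (\<lambda>x. \<Sum>s\<in>S. u s * g s x) = 0" if "Lp_norm q U (\<lambda>x. \<Sum>s\<in>S. u s * f s x) = 0" for u
    using ker[OF that[unfolded Lp_norm_eq_0_iff[OF Lf U q]]] by (simp only: Lp_norm_eq_0_iff[OF Lg U p])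
  then have "\<exists>C\<ge>0. \<forall>u. (\<forall>i. i \<notin> S \<longrightarrow> u i = 0) \<longrightarrow>
    Lp_norm p U (\<lambda>x. \<Sum>s\<in>S. u s * g s x) \<le> C * Lp_norm q U (\<lambda>x. \<Sum>s\<in>S. u s * f s x)"
    by (intro coefficient_seminorm_bound Lp_coefficient_seminorm f g U p q S)
  then obtain C where C: "C \<ge> 0" "\<And>u. (\<forall>i. i \<notin> S \<longrightarrow> u i = 0) \<Longrightarrow>
    Lp_norm p U (\<lambda>x. \<Sum>s\<in>S. u s * g s x) \<le> C * Lp_norm q U (\<lambda>x. \<Sum>s\<in>S. u s * f s x)" by blast
  have "Lp_norm p U (\<lambda>x. \<Sum>s\<in>S. u s * g s x) \<le> C * Lp_norm q U (\<lambda>x. \<Sum>s\<in>S. u s * f s x)" for u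
  proof -
    \<comment> \<open>The seminorm bound concerns coefficient vectors supported in \<open>S\<close>;
      cutting off the rest leaves both sums unchanged.\<close>
    define u' where "u' s = (if s \<in> S then u s else 0)" for s
    have "(\<lambda>x. \<Sum>s\<in>S. u' s * h s x) = (\<lambda>x. \<Sum>s\<in>S. u s * h s x)" for h :: "'i \<Rightarrow> 'a \<Rightarrow> real"
      by (rule ext, rule sum.cong[OF refl]) (simp add: u'_def)
    moreover have "\<forall>i. i \<notin> S \<longrightarrow> u' i = 0" by (simp add: u'_def)
    note C(2)[OF this]
    ultimately show ?thesis by (simp only:)
  qed
  then show ?thesis using C(1) by blast
qed

lemma sum_fun_apply: "(\<Sum>i\<in>A. f i) x = (\<Sum>i\<in>A. f i x :: real)"
  by (induction A rule: infinite_finite_induct) (auto simp: zero_fun_def plus_fun_def)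

lemma fun_span_finite:
  fixes S :: "('a \<Rightarrow> real) set"
  assumes "finite S"
  shows "fun_space.span S = range (\<lambda>u x. \<Sum>s\<in>S. u s * s x)"
proof -
  have "(\<Sum>s\<in>S. (\<lambda>x. u s * s x)) = (\<lambda>x. \<Sum>s\<in>S. u s * s x)" for u :: "('a \<Rightarrow> real) \<Rightarrow> real"
    by (rule ext) (simp add: sum_fun_apply)
  then show ?thesis using fun_space.span_finite[OF assms] by simp
qed

text \<open>Indexing by lists instead of multi-indices makes one more derivative one more list
  entry. Lists with equal counts may receive different representatives, which at most adds
  generators.\<close>

definition derivative_space ::
  "((real ^ 'd::finite \<Rightarrow> real) \<Rightarrow> 'd list \<Rightarrow> real ^ 'd \<Rightarrow> real) \<Rightarrow> (real ^ 'd \<Rightarrow> real) set \<Rightarrow> nat \<Rightarrow> (real ^ 'd \<Rightarrow> real) set" where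
  "derivative_space D B j = {D b is | b is. b \<in> B \<and> length is = j}"

lemma finite_derivative_space: "finite B \<Longrightarrow> finite (derivative_space D B j)"
proof -
  assume B: "finite B"
  have "derivative_space D B j = (\<lambda>(b, is). D b is) ` (B \<times> {is. set is \<subseteq> UNIV \<and> length is = j})"
    by (auto simp: derivative_space_def)
  moreover have "finite \<dots>"
    by (intro finite_imageI finite_cartesian_product B finite_lists_length_eq) simp
  ultimately show ?thesis by (simp only:)
qed

text \<open>Differentiation is defined on the generators of order \<open>j\<close> and extended
  through coefficients. It maps null functions to null functions, because a weak derivative of a
  null function is null, and this is the kernel condition of the finite-dimensional bound.\<close>

lemma reference_inverse_estimates:
  fixes P :: "(real ^ 'd::finite \<Rightarrow> real) set"
  assumes B: "finite B" "P = fun_space.span B" and P: "P \<subseteq> Sobolev l \<infinity> (interior ref_cube)"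
    and p: "1 \<le> p" and q: "1 \<le> q"
  obtains V M N where "M \<ge> 1" "N \<ge> (0::real)"
    "\<And>j w. j \<le> l \<Longrightarrow> w \<in> V j \<Longrightarrow> w \<in> Lp_space \<infinity> (interior ref_cube)"
    "\<And>j w a. j \<le> l \<Longrightarrow> (\<And>i. w i \<in> V j) \<Longrightarrow> (\<lambda>x. \<Sum>i\<in>(UNIV :: 'd set). a i * w i x) \<in> V j"
    "\<And>v. v \<in> P \<Longrightarrow> \<exists>v0\<in>V 0. weak_deriv (interior ref_cube) (count_list []) v v0"
    "\<And>j w i. j < l \<Longrightarrow> w \<in> V j \<Longrightarrow>
      \<exists>w'\<in>V (Suc j). weak_deriv (interior ref_cube) (count_list [i]) w w' \<and>
         Lp_norm p (interior ref_cube) w' \<le> M * Lp_norm p (interior ref_cube) w"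
    "\<And>j w. j \<le> l \<Longrightarrow> w \<in> V j \<Longrightarrow>
      Lp_norm p (interior ref_cube) w \<le> N * Lp_norm q (interior ref_cube) w"
proof -
  let ?U = "interior ref_cube :: (real ^ 'd) set"
  have U: "open ?U" "?U \<in> lmeasurable" by (simp_all add: interior_ref_cube_lmeasurable)
  have "\<exists>w\<in>Lp_space \<infinity> ?U. weak_deriv ?U (count_list is) b w" if "b \<in> B" "length is \<le> l" for b "is"
  proof -
    have "b \<in> Sobolev l \<infinity> ?U" using that P B(2) fun_space.span_base by blast
    then show ?thesis using that(2) by (auto simp: Sobolev_def mi_order_count_list)
  qed
  then have "\<forall>b is. \<exists>w. b \<in> B \<and> length is \<le> l \<longrightarrow> w \<in> Lp_space \<infinity> ?U \<and> weak_deriv ?U (count_list is) b w"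
    by blast
  then obtain D where D: "\<And>b is. b \<in> B \<Longrightarrow> length is \<le> l \<Longrightarrow> D b is \<in> Lp_space \<infinity> ?U"
    "\<And>b is. b \<in> B \<Longrightarrow> length is \<le> l \<Longrightarrow> weak_deriv ?U (count_list is) b (D b is)"
    by metis
  define S where "S = derivative_space D B"
  define V where "V j = fun_space.span (S j)" for j
  have finS: "finite (S j)" for j unfolding S_def by (rule finite_derivative_space[OF B(1)])
  have SL: "s \<in> Lp_space \<infinity> ?U" if "j \<le> l" "s \<in> S j" for j s
    using that D(1) by (auto simp: S_def derivative_space_def)
  have V_eq: "V j = range (\<lambda>u x. \<Sum>s\<in>S j. u s * s x)" for j
    unfolding V_def by (rule fun_span_finite[OF finS])
  have VL: "w \<in> Lp_space \<infinity> ?U" if "j \<le> l" "w \<in> V j" for j w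
    using that SL unfolding V_eq by (auto intro!: Lp_space_infinity_sum Lp_space_infinity_cmult)
  have lin: "(\<lambda>x. \<Sum>i\<in>I. a i * w i x) \<in> V j" if "\<And>i. i \<in> I \<Longrightarrow> w i \<in> V j" for I :: "'i set" and a w j
  proof -
    have "(\<Sum>i\<in>I. (\<lambda>x. a i * w i x)) \<in> V j"
      unfolding V_def using that by (intro fun_space.span_sum fun_space.span_scale) (simp add: V_def)
    moreover have "(\<Sum>i\<in>I. (\<lambda>x. a i * w i x)) = (\<lambda>x. \<Sum>i\<in>I. a i * w i x)"
      by (rule ext) (simp add: sum_fun_apply)
    ultimately show ?thesis by simp
  qed
  have start: "\<exists>v0\<in>V 0. weak_deriv ?U (count_list []) v v0" if "v \<in> P" for v
  proof -
    have "v \<in> range (\<lambda>u x. \<Sum>b\<in>B. u b * b x)" using that unfolding B(2) fun_span_finite[OF B(1)] .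
    then obtain u where u: "v = (\<lambda>x. \<Sum>b\<in>B. u b * b x)" by blast
    have "D b [] \<in> V 0" if "b \<in> B" for b
      unfolding V_def S_def derivative_space_def using that by (intro fun_space.span_base) auto
    then have "(\<lambda>x. \<Sum>b\<in>B. u b * D b [] x) \<in> V 0" by (intro lin)
    moreover have "weak_deriv ?U (count_list []) v (\<lambda>x. \<Sum>b\<in>B. u b * D b [] x)"
      unfolding u by (intro weak_deriv_sum U weak_deriv_cmult D(2)) auto
    ultimately show ?thesis by blast
  qed
  have "\<exists>C\<ge>0. \<forall>w\<in>V j. Lp_norm p ?U w \<le> C * Lp_norm q ?U w" if j: "j \<le> l" for j
    using finite_dimensional_Lp_bound[OF finS SL[OF j] SL[OF j] U(2) p q] unfolding V_eq by auto
  then have "\<forall>j. \<exists>C. j \<le> l \<longrightarrow> C \<ge> 0 \<and> (\<forall>w\<in>V j. Lp_norm p ?U w \<le> C * Lp_norm q ?U w)" by blast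
  from choice[OF this] obtain N where N: "\<And>j. j \<le> l \<Longrightarrow> N j \<ge> 0"
    "\<And>j w. j \<le> l \<Longrightarrow> w \<in> V j \<Longrightarrow> Lp_norm p ?U w \<le> N j * Lp_norm q ?U w" by blast
  have "\<exists>C\<ge>0. \<forall>w\<in>V j. \<exists>w'\<in>V (Suc j). weak_deriv ?U (count_list [i]) w w' \<and> Lp_norm p ?U w' \<le> C * Lp_norm p ?U w"
    if j: "j < l" for j i
  proof -
    have jl: "j \<le> l" "Suc j \<le> l" using j by auto
    \<comment> \<open>The same \<open>s\<close> may stem from several pairs of generator and list;
      any of them provides a derivative.\<close>
    have "\<exists>g. g \<in> S (Suc j) \<and> weak_deriv ?U (count_list [i]) s g" if s: "s \<in> S j" for s
    proof -
      obtain b "is" where bi: "b \<in> B" "length is = j" "s = D b is" using s by (auto simp: S_def derivative_space_def)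
      have "D b (i # is) \<in> S (Suc j)"
        using bi by (auto simp: S_def derivative_space_def intro!: exI[of _ b] exI[of _ "i # is"])
      moreover have "weak_deriv ?U (count_list [i]) (D b is) (D b (i # is))"
        using bi jl by (intro weak_deriv_Cons_imp[OF D(2) D(2)]) auto
      ultimately show ?thesis using bi(3) by blast
    qed
    then obtain g where g: "\<And>s. s \<in> S j \<Longrightarrow> g s \<in> S (Suc j)"
      "\<And>s. s \<in> S j \<Longrightarrow> weak_deriv ?U (count_list [i]) s (g s)" by metis
    have wd: "weak_deriv ?U (count_list [i]) (\<lambda>x. \<Sum>s\<in>S j. u s * s x) (\<lambda>x. \<Sum>s\<in>S j. u s * g s x)" for u
      by (intro weak_deriv_sum U weak_deriv_cmult g(2))
    have "\<exists>C\<ge>0. \<forall>u. Lp_norm p ?U (\<lambda>x. \<Sum>s\<in>S j. u s * g s x) \<le> C * Lp_norm p ?U (\<lambda>x. \<Sum>s\<in>S j. u s * s x)"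
      by (rule finite_dimensional_Lp_bound[OF finS SL[OF jl(1)] SL[OF jl(2) g(1)] U(2) p p])
        (assumption | rule weak_deriv_AE_zero[OF U(1) wd])+
    then obtain C where C: "C \<ge> 0"
      "\<And>u. Lp_norm p ?U (\<lambda>x. \<Sum>s\<in>S j. u s * g s x) \<le> C * Lp_norm p ?U (\<lambda>x. \<Sum>s\<in>S j. u s * s x)" by blast
    have "\<exists>w'\<in>V (Suc j). weak_deriv ?U (count_list [i]) w w' \<and> Lp_norm p ?U w' \<le> C * Lp_norm p ?U w" if w: "w \<in> V j" for w
    proof -
      obtain u where u: "w = (\<lambda>x. \<Sum>s\<in>S j. u s * s x)" using w unfolding V_eq by auto
      have "g s \<in> V (Suc j)" if "s \<in> S j" for s
        unfolding V_def using g(1)[OF that] by (rule fun_space.span_base)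
      then have "(\<lambda>x. \<Sum>s\<in>S j. u s * g s x) \<in> V (Suc j)" by (intro lin)
      then show ?thesis using wd[of u] C(2)[of u] unfolding u by blast
    qed
    then show ?thesis using C(1) by blast
  qed
  then have "\<forall>z. \<exists>C. fst z < l \<longrightarrow> C \<ge> 0 \<and> (\<forall>w\<in>V (fst z). \<exists>w'\<in>V (Suc (fst z)).
      weak_deriv ?U (count_list [snd z]) w w' \<and> Lp_norm p ?U w' \<le> C * Lp_norm p ?U w)" by blast
  from choice[OF this] obtain M where M: "\<And>z. fst z < l \<Longrightarrow> M z \<ge> 0 \<and> (\<forall>w\<in>V (fst z). \<exists>w'\<in>V (Suc (fst z)).
      weak_deriv ?U (count_list [snd z]) w w' \<and> Lp_norm p ?U w' \<le> M z * Lp_norm p ?U w)" by blast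
  \<comment> \<open>Sums over the finitely many orders and directions are common upper bounds; the
    summand 1 in \<open>M0\<close> ensures \<open>M0 \<ge> 1\<close>.\<close>
  define N0 where "N0 = (\<Sum>j\<le>l. N j)"
  define M0 where "M0 = 1 + (\<Sum>z\<in>{..<l} \<times> UNIV. M z)"
  have NN: "N j \<le> N0" if "j \<le> l" for j
    unfolding N0_def using that N(1) by (intro member_le_sum) auto
  have MM: "M (j, i) \<le> M0" if "j < l" for j i
  proof -
    have "M (j, i) \<le> (\<Sum>z\<in>{..<l} \<times> UNIV. M z)" using that M by (intro member_le_sum) auto
    then show ?thesis by (simp add: M0_def)
  qed
  show thesis
  proof (rule that[of M0 N0 V])
    have "(\<Sum>z\<in>{..<l} \<times> UNIV. M z) \<ge> 0" using M by (intro sum_nonneg) auto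
    then show "M0 \<ge> 1" by (simp add: M0_def)
    show "N0 \<ge> 0" unfolding N0_def using N(1) by (intro sum_nonneg) auto
    show "w \<in> Lp_space \<infinity> ?U" if "j \<le> l" "w \<in> V j" for j w by (rule VL[OF that])
    show "(\<lambda>x. \<Sum>i\<in>(UNIV :: 'd set). a i * w i x) \<in> V j" if "\<And>i. w i \<in> V j" for j w a
      using that by (intro lin)
    show "\<exists>v0\<in>V 0. weak_deriv ?U (count_list []) v v0" if "v \<in> P" for v by (rule start[OF that])
    show "Lp_norm p ?U w \<le> N0 * Lp_norm q ?U w" if "j \<le> l" "w \<in> V j" for j w
      using N(2)[OF that] NN[OF that(1)] by (meson Lp_norm_nonneg mult_right_mono order_trans)
    show "\<exists>w'\<in>V (Suc j). weak_deriv ?U (count_list [i]) w w' \<and> Lp_norm p ?U w' \<le> M0 * Lp_norm p ?U w"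
      if jw: "j < l" "w \<in> V j" for j w i
    proof -
      obtain w' where "w' \<in> V (Suc j)" "weak_deriv ?U (count_list [i]) w w'"
        "Lp_norm p ?U w' \<le> M (j, i) * Lp_norm p ?U w"
        using M[of "(j, i)", unfolded fst_conv snd_conv, OF jw(1)] jw(2) by blast
      then show ?thesis using MM[OF jw(1), of i] by (meson Lp_norm_nonneg mult_right_mono order_trans)
    qed
  qed
qed

section \<open>Constants valid for all elements of all quasiuniform families\<close>

lemma quasiuniform_elementD:
  assumes "quasiuniform_affine_family \<sigma>0 \<Omega> \<T> J b" "h \<in> {0<..1}" "T \<in> \<T> h"
  shows "invertible (J h T)" "T = affine_map (J h T) (b h T) ` ref_cube" "diameter T \<le> 1"
    "diameter T / inball_diameter T \<le> \<sigma>0"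
proof -
  have a: "affine_partition \<Omega> h (\<T> h) (J h) (b h)" "\<forall>T\<in>\<T> h. diameter T / inball_diameter T \<le> \<sigma>0"
    using assms unfolding quasiuniform_affine_family_def by blast+
  then show "invertible (J h T)" "T = affine_map (J h T) (b h T) ` ref_cube"
    using assms(3) unfolding affine_partition_def by blast+
  show "diameter T / inball_diameter T \<le> \<sigma>0" using a(2) assms(3) by blast
  have "diameter T \<le> Max (diameter ` \<T> h)" using a(1) assms(3) by (intro Max_ge) (auto simp: affine_partition_def)
  then show "diameter T \<le> 1" using a(1) assms(2) by (auto simp: affine_partition_def)
qed

lemma power_inverse_h:
  fixes h a :: real
  assumes "h > 0" "m \<le> l"
  shows "(a / h) ^ (l - m) = a ^ (l - m) * h powr (real m - real l)"
  using assms by (simp add: power_divide powr_diff powr_realpow power_diff)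

lemma inverse_estimate_fixed_space:
  fixes P :: "(real ^ 'd::finite \<Rightarrow> real) set"
  assumes ml: "m \<le> l" and P: "P \<subseteq> Sobolev l \<infinity> (interior ref_cube)" and p: "1 \<le> p" and q: "1 \<le> q"
    and B: "finite B" "P = fun_space.span B"
  shows "\<exists>C>0. \<forall>\<Omega> \<T> J b. quasiuniform_affine_family \<sigma>0 \<Omega> \<T> J b \<longrightarrow>
           (\<forall>h\<in>{0<..1}. \<forall>T\<in>\<T> h. \<forall>v\<in>local_space (J h T) (b h T) P.
              Sobolev_norm l p (interior T) v
              \<le> C * diameter T powr (real m - real l + real CARD('d) * (recip p - recip q))
                  * Sobolev_norm m q (interior T) v)"
proof -
  obtain V M N where V: "M \<ge> 1" "N \<ge> (0::real)"
    "\<And>j w. j \<le> l \<Longrightarrow> w \<in> V j \<Longrightarrow> w \<in> Lp_space \<infinity> (interior ref_cube)"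
    "\<And>j w a. j \<le> l \<Longrightarrow> (\<And>i. w i \<in> V j) \<Longrightarrow> (\<lambda>x. \<Sum>i\<in>(UNIV :: 'd set). a i * w i x) \<in> V j"
    "\<And>v. v \<in> P \<Longrightarrow> \<exists>v0\<in>V 0. weak_deriv (interior ref_cube) (count_list []) v v0"
    "\<And>j w i. j < l \<Longrightarrow> w \<in> V j \<Longrightarrow>
      \<exists>w'\<in>V (Suc j). weak_deriv (interior ref_cube) (count_list [i]) w w' \<and>
         Lp_norm p (interior ref_cube) w' \<le> M * Lp_norm p (interior ref_cube) w"
    "\<And>j w. j \<le> l \<Longrightarrow> w \<in> V j \<Longrightarrow>
      Lp_norm p (interior ref_cube) w \<le> N * Lp_norm q (interior ref_cube) w"
  proof (rule reference_inverse_estimates[OF B P p q], goal_cases)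
    case (1 V M N)
    show ?case by (rule 1(1)[OF 1(2-8)])
  qed
  let ?d = "real CARD('d)"
  let ?K = "real (card {\<alpha> :: 'd \<Rightarrow> nat. mi_order \<alpha> \<le> l})"
  let ?E = "real m - real l + ?d * (recip p - recip q)"
  \<comment> \<open>Positivity of \<open>\<sigma>0\<close> follows only once an element is given, so
    the constant is built from its absolute value. It may be 0, which is why \<open>C + 1\<close> is
    used in the end.\<close>
  define C where "C = ?K * ((8 * \<bar>\<sigma>0\<bar> * ?d * M) ^ (l - m) * (N * (4 * \<bar>\<sigma>0\<bar> * ?d) ^ CARD('d)))"
  have C0: "C \<ge> 0" using V(1,2) by (simp add: C_def)
  have "Sobolev_norm l p (interior T) v \<le> (C + 1) * diameter T powr ?E * Sobolev_norm m q (interior T) v"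
    if qa: "quasiuniform_affine_family \<sigma>0 \<Omega> \<T> J b" "h \<in> {0<..1}" "T \<in> \<T> h" and v: "v \<in> local_space (J h T) (b h T) P"
    for \<Omega> \<T> J b h T v
  proof -
    note T = quasiuniform_elementD[OF qa]
    obtain u where u: "u \<in> P" "v = u \<circ> inv (affine_map (J h T) (b h T))" using v by (auto simp: local_space_def)
    obtain v0 where v0: "weak_deriv (interior ref_cube) (count_list []) u v0" "v0 \<in> V 0" using V(5)[OF u(1)] by blast
    let ?S = "Sobolev_norm m q (interior T) v"
    have "diameter T > 0 \<and> \<sigma>0 > 1 / 2 \<and> Sobolev_norm l p (interior T) v
      \<le> ?K * ((8 * \<sigma>0 * ?d * M / diameter T) ^ (l - m) *
         (N * ((4 * \<sigma>0 * ?d) ^ CARD('d) * diameter T powr (?d * (recip p - recip q)))) * ?S)"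
      unfolding u(2) by (rule inverse_estimate_affine[where V=V and M=M and N=N and ?v0.0=v0]) (fact p q ml V v0 T)+
    then have est: "diameter T > 0" "\<sigma>0 > 1 / 2" "Sobolev_norm l p (interior T) v
      \<le> ?K * ((8 * \<sigma>0 * ?d * M / diameter T) ^ (l - m) *
         (N * ((4 * \<sigma>0 * ?d) ^ CARD('d) * diameter T powr (?d * (recip p - recip q)))) * ?S)" by blast+
    have S0: "?S \<ge> 0"
      using Lp_norm_wderiv_le_Sobolev_norm[OF _ q, of "\<lambda>_. 0" m] Lp_norm_nonneg zero_mi_order[of m]
      by (metis mem_Collect_eq order_trans)
    note est(3)
    also have "?K * ((8 * \<sigma>0 * ?d * M / diameter T) ^ (l - m) *
         (N * ((4 * \<sigma>0 * ?d) ^ CARD('d) * diameter T powr (?d * (recip p - recip q)))) * ?S)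
       = C * diameter T powr ?E * ?S"
      using est(1,2) unfolding power_inverse_h[OF est(1) ml] C_def by (simp add: powr_add)
    also have "\<dots> \<le> (C + 1) * diameter T powr ?E * ?S"
      using S0 by (intro mult_right_mono) auto
    finally show ?thesis .
  qed
  then show ?thesis using C0 by (intro exI[of _ "C + 1"]) auto
qed

text \<open>The constant is fixed before \<open>k\<close> and \<open>q\<close>. This works because
  the Markov and Nikolskii constants are explicit in \<open>k\<close>, so their powers of k^2 can be
  moved into the two mesh factors.\<close>

lemma inverse_estimate_tensor_polys:
  assumes ml: "m \<le> l" and p: "1 \<le> p"
  shows "\<exists>C>0. \<forall>(k :: nat) (q :: ennreal) \<Omega> \<T> J b.
           1 \<le> q \<and> q \<le> p \<and> 1 \<le> k \<and> quasiuniform_affine_family \<sigma>0 \<Omega> \<T> J b \<longrightarrow>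
           (\<forall>h\<in>{0<..1}. \<forall>T\<in>\<T> h. \<forall>v\<in>local_space (J h T) (b h T) (Q_space k ref_cube :: (real ^ 'd::finite \<Rightarrow> real) set).
              Sobolev_norm l p (interior T) v
              \<le> C * (diameter T / (real k)\<^sup>2) powr (real m - real l)
                  * (if p = q then 1
                     else (diameter T / (2 * (enn2real q + 1) * (real k)\<^sup>2))
                            powr (real CARD('d) * (recip p - recip q)))
                  * Sobolev_norm m q (interior T) v)"
proof -
  let ?U = "interior ref_cube :: (real ^ 'd) set"
  let ?d = "real CARD('d)"
  let ?K = "real (card {\<alpha> :: 'd \<Rightarrow> nat. mi_order \<alpha> \<le> l})"
  have d1: "?d \<ge> 1" by (simp add: Suc_leI)
  have d8: "8 * ?d \<ge> 1" using d1 by linarith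
  \<comment> \<open>The number 64 joins the 8 of the affine map with the 8 of the Markov inequality,
    and \<open>(8 * ?d) ^ CARD('d)\<close> bounds the remaining Nikolskii factor for every
    \<open>q\<close>.\<close>
  define C where "C = ?K * ((64 * \<bar>\<sigma>0\<bar> * ?d) ^ (l - m) * ((2 * (8 * ?d) ^ CARD('d)) * (4 * \<bar>\<sigma>0\<bar> * ?d) ^ CARD('d)))"
  have C0: "C \<ge> 0" using d1 by (simp add: C_def)
  have "Sobolev_norm l p (interior T) v
     \<le> (C + 1) * (diameter T / (real k)\<^sup>2) powr (real m - real l)
         * (if p = q then 1 else (diameter T / (2 * (enn2real q + 1) * (real k)\<^sup>2)) powr (?d * (recip p - recip q)))
         * Sobolev_norm m q (interior T) v"
    if q: "1 \<le> q" "q \<le> p" and k: "1 \<le> k" and qa: "quasiuniform_affine_family \<sigma>0 \<Omega> \<T> J b" "h \<in> {0<..1}" "T \<in> \<T> h"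
      and v: "v \<in> local_space (J h T) (b h T) (Q_space k ref_cube :: (real ^ 'd \<Rightarrow> real) set)"
    for k q \<Omega> \<T> J b h T v
  proof -
    note T = quasiuniform_elementD[OF qa]
    obtain u where u: "u \<in> Q_space k ref_cube" "v = u \<circ> inv (affine_map (J h T) (b h T))"
      using v by (auto simp: local_space_def)
    obtain g where g: "g \<in> tensor_polys k" "\<And>x. x \<in> ref_cube \<Longrightarrow> u x = g x"
      using Q_space_tensor_polys[OF u(1)] by blast
    \<comment> \<open>Differentiation does not leave \<open>tensor_polys k\<close>, so the same
      space serves every order.\<close>
    let ?V = "\<lambda>j :: nat. tensor_polys k :: (real ^ 'd \<Rightarrow> real) set"
    let ?e = "recip p - recip q"
    \<comment> \<open>For equal exponents, possibly both infinite, nothing has to be compared;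
      otherwise \<open>q < p\<close> makes \<open>q\<close> finite, as the Nikolskii inequality
      requires.\<close>
    define N where "N = (if p = q then 1 else 2 * (8 * ?d * (real k)\<^sup>2) powr (?d * (- ?e)))"
    have k1: "(real k)\<^sup>2 \<ge> 1" using k by simp
    have N0: "N \<ge> 0" by (simp add: N_def)
    have li: "g absolutely_integrable_on K" if "compact K" for K
      using that tensor_polys_continuous[OF g(1)] by (intro continuous_absolutely_integrable_on_compact)
    have "weak_deriv ?U (count_list []) g g" using li by (intro weak_deriv_NilI) auto
    moreover have "g x = u x" if "x \<in> ?U" for x
      using g(2)[OF subsetD[OF interior_subset that]] by simp
    ultimately have start: "weak_deriv ?U (count_list []) u g"
      using weak_deriv_cong[of ?U "count_list []" g g u g] by (simp del: count_list.simps)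
    have lin: "(\<lambda>x. \<Sum>i\<in>I. a i * w i x) \<in> tensor_polys k" if "\<And>i. w i \<in> tensor_polys k" for I :: "'d set" and a w
      using finite[of I]
    proof (induction I)
      case (insert i I)
      have "(\<lambda>x. a i * w i x + (\<Sum>i\<in>I. a i * w i x)) \<in> tensor_polys k"
        by (intro tensor_polys.add tensor_polys_cmult that insert.IH)
      then show ?case using insert.hyps by simp
    qed (simp add: tensor_polys_zero)
    have step: "\<exists>w'\<in>?V (Suc j). weak_deriv ?U (count_list [i]) w w' \<and> Lp_norm p ?U w' \<le> (8 * (real k)\<^sup>2) * Lp_norm p ?U w"
      if "j < l" and w: "w \<in> ?V j" for j w i
    proof -
      note w' = tensor_polys_derivative(2)[OF w, of i]
      have "weak_deriv ?U (count_list [i]) w (partial_deriv i w)"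
        by (intro weak_deriv_classical tensor_polys_derivative(1)[OF w] tensor_polys_continuous[OF w']) simp
      then show ?thesis using w' tensor_polys_markov[OF k w p] by blast
    qed
    have nik: "Lp_norm p ?U w \<le> N * Lp_norm q ?U w" if "j \<le> l" and w: "w \<in> ?V j" for j w
    proof (cases "p = q")
      case False
      then have "q \<noteq> \<infinity>" using q by (metis infinity_ennreal_def top.extremum_unique)
      then show ?thesis using tensor_polys_nikolskii[OF k w q] False by (simp add: N_def)
    qed (simp add: N_def)
    let ?S = "Sobolev_norm m q (interior T) v"
    let ?h = "diameter T"
    have M1: "8 * (real k)\<^sup>2 \<ge> 1" using k1 by simp
    have VL: "w \<in> Lp_space \<infinity> ?U" if "j \<le> l" "w \<in> ?V j" for j w using that(2) by (rule tensor_polys_Lp)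
    have lin': "(\<lambda>x. \<Sum>i\<in>(UNIV :: 'd set). a i * w i x) \<in> ?V j" if "j \<le> l" "\<And>i. w i \<in> ?V j" for j w a
      by (rule lin) (rule that(2))
    have "?h > 0 \<and> \<sigma>0 > 1 / 2 \<and> Sobolev_norm l p (interior T) v
      \<le> ?K * ((8 * \<sigma>0 * ?d * (8 * (real k)\<^sup>2) / ?h) ^ (l - m) *
         (N * ((4 * \<sigma>0 * ?d) ^ CARD('d) * ?h powr (?d * ?e))) * ?S)"
      unfolding u(2) by (rule inverse_estimate_affine[where V="?V" and M="8 * (real k)\<^sup>2" and N=N and ?v0.0=g])
        (fact p q(1) ml VL lin' start g(1) step nik M1 N0 T)+
    then have est: "?h > 0" "\<sigma>0 > 1 / 2" "Sobolev_norm l p (interior T) v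
      \<le> ?K * ((8 * \<sigma>0 * ?d * (8 * (real k)\<^sup>2) / ?h) ^ (l - m) *
         (N * ((4 * \<sigma>0 * ?d) ^ CARD('d) * ?h powr (?d * ?e))) * ?S)" by blast+
    have S0: "?S \<ge> 0"
      using Lp_norm_wderiv_le_Sobolev_norm[OF _ q(1), of "\<lambda>_. 0" m] Lp_norm_nonneg zero_mi_order[of m]
      by (metis mem_Collect_eq order_trans)
    let ?X = "if p = q then 1 else (?h / (2 * (enn2real q + 1) * (real k)\<^sup>2)) powr (?d * ?e)"
    let ?Y = "(?h / (real k)\<^sup>2) powr (real m - real l)"
    have A1: "(8 * \<sigma>0 * ?d * (8 * (real k)\<^sup>2) / ?h) ^ (l - m) = (64 * \<bar>\<sigma>0\<bar> * ?d) ^ (l - m) * ?Y"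
    proof -
      have "8 * \<sigma>0 * ?d * (8 * (real k)\<^sup>2) / ?h = (64 * \<bar>\<sigma>0\<bar> * ?d) / (?h / (real k)\<^sup>2)"
        using est(2) k1 by simp
      moreover have "?h / (real k)\<^sup>2 > 0" using est(1) k by simp
      ultimately show ?thesis using power_inverse_h[OF _ ml, of "?h / (real k)\<^sup>2" "64 * \<bar>\<sigma>0\<bar> * ?d"] by (simp only:)
    qed
    have A2: "N * ?h powr (?d * ?e) \<le> 2 * (8 * ?d) ^ CARD('d) * ?X"
    proof (cases "p = q")
      case True
      have "(8 * ?d) ^ CARD('d) \<ge> 1" using d8 by (rule one_le_power)
      then show ?thesis using True est(1) by (simp add: N_def)
    next
      case False
      then have qf: "q \<noteq> \<infinity>" using q by (metis infinity_ennreal_def top.extremum_unique)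
      have e: "?e \<le> 0" "?e \<ge> -1"
      proof -
        show "?e \<ge> -1" using recip_bounds[OF p] recip_bounds[OF q(1)] by linarith
        show "?e \<le> 0" using recip_antimono[OF q] by simp
      qed
      let ?x = "?d * ?e"
      have x: "?x \<le> 0" "- ?x \<le> ?d"
      proof -
        show "?x \<le> 0" using e(1) d1 by (simp add: mult_nonneg_nonpos)
        have "?d * (- ?e) \<le> ?d * 1" using e by (intro mult_left_mono) auto
        then show "- ?x \<le> ?d" by (simp only: mult_minus_right mult_1_right)
      qed
      have hk: "?h / (real k)\<^sup>2 > 0" using est(1) k by simp
      have "(8 * ?d * (real k)\<^sup>2) powr (- ?x) * ?h powr ?x = (8 * ?d) powr (- ?x) * (?h / (real k)\<^sup>2) powr ?x"
        using d1 k1 est(1) by (simp add: powr_mult powr_divide powr_minus_divide)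
      also have "\<dots> \<le> (8 * ?d) powr ?d * (?h / (2 * (enn2real q + 1) * (real k)\<^sup>2)) powr ?x"
      proof (intro mult_mono)
        show "(8 * ?d) powr (- ?x) \<le> (8 * ?d) powr ?d" using d8 x by (intro powr_mono) auto
        \<comment> \<open>The exponent is nonpositive, so enlarging the denominator by
          \<open>2 * (enn2real q + 1) \<ge> 1\<close> can only enlarge the power.\<close>
        have "(real k)\<^sup>2 \<le> 2 * (enn2real q + 1) * (real k)\<^sup>2"
          using mult_right_mono[of 1 "2 * (enn2real q + 1)" "(real k)\<^sup>2"] by (auto simp: enn2real_nonneg)
        moreover have "(real k)\<^sup>2 > 0" using k by simp
        ultimately have "?h / (2 * (enn2real q + 1) * (real k)\<^sup>2) \<le> ?h / (real k)\<^sup>2"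
          by (intro frac_le order_refl less_imp_le[OF est(1)])
        moreover have "?h / (2 * (enn2real q + 1) * (real k)\<^sup>2) > 0"
          using est(1) k enn2real_nonneg[of q] by (intro divide_pos_pos mult_pos_pos add_nonneg_pos) auto
        ultimately show "(?h / (real k)\<^sup>2) powr ?x \<le> (?h / (2 * (enn2real q + 1) * (real k)\<^sup>2)) powr ?x"
          using x(1) by (intro powr_mono2')
      qed auto
      also have "(8 * ?d) powr ?d = (8 * ?d) ^ CARD('d)" using d1 by (simp add: powr_realpow)
      finally have "2 * ((8 * ?d * (real k)\<^sup>2) powr (- ?x) * ?h powr ?x)
        \<le> 2 * ((8 * ?d) ^ CARD('d) * (?h / (2 * (enn2real q + 1) * (real k)\<^sup>2)) powr ?x)"
        by (intro mult_left_mono) auto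
      then show ?thesis using False by (simp only: N_def if_False mult_minus_right mult.assoc)
    qed
    have "?K * ((8 * \<sigma>0 * ?d * (8 * (real k)\<^sup>2) / ?h) ^ (l - m) *
         (N * ((4 * \<sigma>0 * ?d) ^ CARD('d) * ?h powr (?d * ?e))) * ?S)
       = (?K * (64 * \<bar>\<sigma>0\<bar> * ?d) ^ (l - m) * ?Y * (4 * \<bar>\<sigma>0\<bar> * ?d) ^ CARD('d) * ?S) * (N * ?h powr (?d * ?e))"
      unfolding A1 using est(2) by simp
    also have "\<dots> \<le> (?K * (64 * \<bar>\<sigma>0\<bar> * ?d) ^ (l - m) * ?Y * (4 * \<bar>\<sigma>0\<bar> * ?d) ^ CARD('d) * ?S) * (2 * (8 * ?d) ^ CARD('d) * ?X)"
      using S0 by (intro mult_left_mono A2 mult_nonneg_nonneg zero_le_power) auto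
    also have "\<dots> = C * ?Y * ?X * ?S" by (simp only: C_def mult_ac)
    also have "\<dots> \<le> (C + 1) * ?Y * ?X * ?S" using S0 by (intro mult_right_mono) auto
    finally show ?thesis using est(3) by linarith
  qed
  moreover have "C + 1 > 0" using C0 by simp
  ultimately show ?thesis by blast
qed

theorem lemma16:
  fixes l m :: nat and \<sigma>0 :: real
  assumes "m \<le> l"
  shows
    "(\<forall>P :: (real ^ 'd::finite \<Rightarrow> real) set. \<forall>p q :: ennreal.
        P \<subseteq> Sobolev l \<infinity> (interior ref_cube) \<and> 1 \<le> p \<and> 1 \<le> q \<longrightarrow>
        (\<exists>C>0. \<forall>dofs \<Omega> \<T> J b.
           finite_element ref_cube P dofs \<and> quasiuniform_affine_family \<sigma>0 \<Omega> \<T> J b \<longrightarrow>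
           (\<forall>h\<in>{0<..1}. \<forall>T\<in>\<T> h. \<forall>v\<in>local_space (J h T) (b h T) P.
              Sobolev_norm l p (interior T) v
              \<le> C * diameter T powr (real m - real l + real CARD('d) * (recip p - recip q))
                  * Sobolev_norm m q (interior T) v)))
     \<and>
     (\<forall>p :: ennreal. 1 \<le> p \<longrightarrow>
        (\<exists>C>0. \<forall>(P :: (real ^ 'd \<Rightarrow> real) set) dofs (k :: nat) (q :: ennreal) \<Omega> \<T> J b.
           1 \<le> q \<and> q \<le> p \<and> 1 \<le> k \<and> P = Q_space k ref_cube \<and>
           P \<subseteq> Sobolev l \<infinity> (interior ref_cube) \<and>
           finite_element ref_cube P dofs \<and> quasiuniform_affine_family \<sigma>0 \<Omega> \<T> J b \<longrightarrow>
           (\<forall>h\<in>{0<..1}. \<forall>T\<in>\<T> h. \<forall>v\<in>local_space (J h T) (b h T) P.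
              Sobolev_norm l p (interior T) v
              \<le> C * (diameter T / (real k)\<^sup>2) powr (real m - real l)
                  * (if p = q then 1
                     else (diameter T / (2 * (enn2real q + 1) * (real k)\<^sup>2))
                            powr (real CARD('d) * (recip p - recip q)))
                  * Sobolev_norm m q (interior T) v)))"
proof (intro conjI allI impI)
  fix P :: "(real ^ 'd \<Rightarrow> real) set" and p q :: ennreal
  assume a: "P \<subseteq> Sobolev l \<infinity> (interior ref_cube) \<and> 1 \<le> p \<and> 1 \<le> q"
  show "\<exists>C>0. \<forall>dofs \<Omega> \<T> J b.
           finite_element ref_cube P dofs \<and> quasiuniform_affine_family \<sigma>0 \<Omega> \<T> J b \<longrightarrow>
           (\<forall>h\<in>{0<..1}. \<forall>T\<in>\<T> h. \<forall>v\<in>local_space (J h T) (b h T) P.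
              Sobolev_norm l p (interior T) v
              \<le> C * diameter T powr (real m - real l + real CARD('d) * (recip p - recip q))
                  * Sobolev_norm m q (interior T) v)"
  \<comment> \<open>Finite dimension is part of \<open>finite_element\<close>, but the constant has
    to be chosen before \<open>dofs\<close>. If \<open>P\<close> has no finite spanning set, the
    premise fails for all \<open>dofs\<close> and any constant works.\<close>
  proof (cases "\<exists>B. finite B \<and> P = fun_space.span B")
    case True
    then obtain B where "finite B" "P = fun_space.span B" by blast
    from inverse_estimate_fixed_space[OF assms _ _ _ this, of p q \<sigma>0] a
    obtain C where "C > 0" "\<forall>\<Omega> \<T> J b. quasiuniform_affine_family \<sigma>0 \<Omega> \<T> J b \<longrightarrow>
           (\<forall>h\<in>{0<..1}. \<forall>T\<in>\<T> h. \<forall>v\<in>local_space (J h T) (b h T) P.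
              Sobolev_norm l p (interior T) v
              \<le> C * diameter T powr (real m - real l + real CARD('d) * (recip p - recip q))
                  * Sobolev_norm m q (interior T) v)"
      by blast
    then show ?thesis by (intro exI[of _ C]) blast
  next
    case False
    then have "\<not> finite_element ref_cube P dofs" for dofs by (auto simp: finite_element_def)
    then show ?thesis by (intro exI[of _ 1]) simp
  qed
next
  fix p :: ennreal
  assume "1 \<le> p"
  from inverse_estimate_tensor_polys[OF assms this, of \<sigma>0, where 'd='d]
  show "\<exists>C>0. \<forall>(P :: (real ^ 'd \<Rightarrow> real) set) dofs (k :: nat) (q :: ennreal) \<Omega> \<T> J b.
           1 \<le> q \<and> q \<le> p \<and> 1 \<le> k \<and> P = Q_space k ref_cube \<and>
           P \<subseteq> Sobolev l \<infinity> (interior ref_cube) \<and>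
           finite_element ref_cube P dofs \<and> quasiuniform_affine_family \<sigma>0 \<Omega> \<T> J b \<longrightarrow>
           (\<forall>h\<in>{0<..1}. \<forall>T\<in>\<T> h. \<forall>v\<in>local_space (J h T) (b h T) P.
              Sobolev_norm l p (interior T) v
              \<le> C * (diameter T / (real k)\<^sup>2) powr (real m - real l)
                  * (if p = q then 1
                     else (diameter T / (2 * (enn2real q + 1) * (real k)\<^sup>2))
                            powr (real CARD('d) * (recip p - recip q)))
                  * Sobolev_norm m q (interior T) v)"
    by (elim exE conjE) (rule exI, rule conjI, assumption, blast)
qed

end
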